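(* Assume the generalised Riemann hypothesis (GRH). Fix real numbers $\vartheta_1,\vartheta_2>0$ such that $$\vartheta_2<\min\left\{\frac{1+\vartheta_1}{2},\ \frac{2+3\vartheta_1}{5}\right\}.$$ Set $y=x^{\vartheta_1}$, let $k>2$ be an integer with $k\asymp x^{\vartheta_2}$, let $a$ be an integer with $\gcd(a,k)=1$, and fix $\beta\in(0,\tfrac12]$ with $\beta<1+2(\vartheta_1-\vartheta_2)$. Then for any sufficiently small $\varepsilon>0$, $$\mathcal N_k(a;x,y,x^{\beta})=\frac{\#\mathcal P_k(y)}{\varphi(k)}\,\Phi(x,x^{\beta}) + O\!\left(\frac{x^{1-\varepsilon+o(1)}\,y}{k}\right)$$ as $x\to\infty$.
   Context: $\mathcal N_k(a;x,y,z)$ denotes the number of pairs $(u,v)$ with $u$ an integer in $[2,x]$, $v$ a prime with $v\le y$, $uv\equiv a \pmod k$, and $P^-(u)\ge z$, where $P^-(m)$ is the smallest prime factor of $m$ for $m\ge 2$ (and $P^-(1)=\infty$). $\mathcal P_k(y)=\{p\le y: p \text{ prime}, \gcd(p,k)=1\}$. For $\beta\ge0$, $\Phi(x,x^{\beta})=\#\{n\le x: P^-(n)\ge x^{\beta}\}$. $\varphi$ is Euler's totient function. $A\asymp B$ means $A\ll B$ and $B\ll A$, where $A\ll B$ means $|A|\le cB$ for some constant $c>0$. GRH is the generalised Riemann hypothesis for Dirichlet $L$-functions. *)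

theory Defs
  imports "HOL-Complex_Analysis.Complex_Analysis" "HOL-Number_Theory.Number_Theory"
begin

definition dirichlet_character :: "nat \<Rightarrow> (nat \<Rightarrow> complex) \<Rightarrow> bool" where
  "dirichlet_character q \<psi> \<longleftrightarrow>
     q > 0 \<and>
     (\<forall>n. \<psi> (n + q) = \<psi> n) \<and>
     (\<forall>m n. \<psi> (m * n) = \<psi> m * \<psi> n) \<and>
     (\<forall>n. \<psi> n \<noteq> 0 \<longleftrightarrow> coprime n q)"

(* The meromorphic continuation of the Dirichlet series to the whole plane, whose only possible
   pole is at s = 1.  As the complement of {1} is connected, the continuation is unique there;
   the value chosen at s = 1 is irrelevant. *)
definition dirichlet_L :: "(nat \<Rightarrow> complex) \<Rightarrow> complex \<Rightarrow> complex" where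
  "dirichlet_L \<psi> =
     (SOME f. f holomorphic_on (- {1}) \<and>
        (\<forall>s. Re s > 1 \<longrightarrow> (\<lambda>n. \<psi> (Suc n) / of_nat (Suc n) powr s) sums f s))"

(* All characters are covered: the principal ones (hence also the Riemann zeta function, q = 1)
   and the imprimitive ones, whose extra Euler factors vanish only on the line Re s = 0. *)
definition GRH :: bool where
  "GRH \<longleftrightarrow>
     (\<forall>q \<psi> s. dirichlet_character q \<psi> \<and> 0 < Re s \<and> Re s < 1 \<and> dirichlet_L \<psi> s = 0
        \<longrightarrow> Re s = 1 / 2)"

(* Only used for m \<ge> 1. *)
definition P_minus :: "nat \<Rightarrow> ereal" where
  "P_minus m = (if m = 1 then \<infinity> else ereal (real (Min (prime_factors m))))"

definition N_count :: "nat \<Rightarrow> int \<Rightarrow> real \<Rightarrow> real \<Rightarrow> real \<Rightarrow> nat" where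
  "N_count k a x y z =
     card {(u :: nat, v :: nat). 2 \<le> u \<and> real u \<le> x \<and> prime v \<and> real v \<le> y \<and>
             [int u * int v = a] (mod int k) \<and> ereal z \<le> P_minus u}"

definition primes_coprime_upto :: "nat \<Rightarrow> real \<Rightarrow> nat set" where
  "primes_coprime_upto k y = {p. prime p \<and> real p \<le> y \<and> coprime p k}"

definition rough_count :: "real \<Rightarrow> real \<Rightarrow> nat" where
  "rough_count x z = card {n :: nat. 1 \<le> n \<and> real n \<le> x \<and> ereal z \<le> P_minus n}"

end

theory Submission
  imports Defs "HOL-Real_Asymp.Real_Asymp"
begin

text \<open>The pairs are counted with the characters modulo k.  The principal character gives the main term:
  the rough u that share a prime with k are at most x powr (1 - \<beta>) up to logarithms.  Every other
  character contributes the product of a sum over rough integers and a sum over primes.  Under GRH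
  both have square-root cancellation, so the error is (x y) powr (1/2 + e), which suffices because
  \<theta>2 < (1 + \<theta>1) / 2.

  For the primes, log L is O (log (k |s|)) to the right of 1/2 + e by the Borel-Caratheodory
  inequality, and Perron's formula applies.  A rough u \<le> x has at most 1 / \<beta> prime factors, and the
  Dirichlet polynomial over the u with a fixed number of prime factors is a polynomial in power sums
  over primes, of which all but the first are bounded trivially.  This bounds it on the line
  Re s = 1/2 + e, where Perron's formula for a Dirichlet polynomial needs no shift of contour.\<close>

section \<open>Dirichlet characters\<close>

text \<open>\<open>GRH\<close> speaks only of the open strip 0 < Re s < 1 and of a function picked
  by \<open>SOME\<close>. To apply it, one must construct an entire continuation of L for each
  nonprincipal character and exclude zeros on the line Re s = 1; otherwise log L need not be
  holomorphic for Re s > 1/2. Both are done from scratch, without structure theory of the unit group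
  and without the functional equation.

  The modulus k grows with x, so every constant must be uniform in k and in the character. The
  dependence on k is only a power of ln k, because the crude bound L = O (k |s|) enters through its
  logarithm; powers of ln k disappear in a small power of x.

  The exponent to beat is 1 + \<theta>1 - \<theta>2. It exceeds the exponent (1 + \<theta>1) / 2 of
  square-root cancellation by \<kappa> = (1 + \<theta>1) / 2 - \<theta>2, and this margin pays for
  the saving \<epsilon>, for the logarithms and for all losses proportional to e.\<close>

lemma sum_lessThan_add:
  fixes f :: "nat \<Rightarrow> 'a :: comm_monoid_add"
  shows "sum f {..<m + n} = sum f {..<m} + (\<Sum>i<n. f (m + i))"
  by (induction n) (auto simp: add.assoc)

lemma dchar_cong:
  assumes "dirichlet_character k \<psi>" "[m = n] (mod k)"
  shows "\<psi> m = \<psi> n"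
proof -
  have per: "\<psi> (i + j * k) = \<psi> i" for i j
  proof (induction j)
    case (Suc j)
    have "\<psi> (i + Suc j * k) = \<psi> ((i + j * k) + k)" by (simp add: algebra_simps)
    also have "\<dots> = \<psi> (i + j * k)" using assms(1) unfolding dirichlet_character_def by blast
    finally show ?case using Suc by simp
  qed simp
  have "\<psi> m = \<psi> (m mod k)" for m
    using per[of "m mod k" "m div k"] by simp
  then show ?thesis using assms(2) unfolding cong_def by metis
qed

lemma dchar_mult: "dirichlet_character k \<psi> \<Longrightarrow> \<psi> (m * n) = \<psi> m * \<psi> n"
  by (simp add: dirichlet_character_def)

lemma dchar_eq_0_iff: "dirichlet_character k \<psi> \<Longrightarrow> \<psi> n = 0 \<longleftrightarrow> \<not> coprime n k"
  unfolding dirichlet_character_def by blast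

lemma dchar_1: assumes "dirichlet_character k \<psi>" shows "\<psi> (Suc 0) = 1"
proof -
  have "\<psi> 1 = \<psi> 1 * \<psi> 1" using dchar_mult[OF assms, of 1 1] by simp
  moreover have "\<psi> 1 \<noteq> 0" using dchar_eq_0_iff[OF assms, of 1] by simp
  ultimately show ?thesis by simp
qed

lemma dchar_power: assumes "dirichlet_character k \<psi>" shows "\<psi> (n ^ j) = \<psi> n ^ j"
  by (induction j) (auto simp: dchar_1[OF assms] dchar_mult[OF assms])

lemma dchar_totient:
  assumes "dirichlet_character k \<psi>" "coprime n k" shows "\<psi> n ^ totient k = 1"
  using dchar_cong[OF assms(1) euler_theorem[OF assms(2)]] dchar_power[OF assms(1)] dchar_1[OF assms(1)]
  by simp

lemma norm_dchar:
  assumes "dirichlet_character k \<psi>" "coprime n k" shows "norm (\<psi> n) = 1"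
proof -
  have "k > 0" using assms(1) by (simp add: dirichlet_character_def)
  moreover have "norm (\<psi> n) ^ totient k = 1" using dchar_totient[OF assms] by (metis norm_one norm_power)
  ultimately show ?thesis using power_eq_imp_eq_base[of "norm (\<psi> n)" "totient k" 1] by simp
qed

lemma norm_dchar_le_1: "dirichlet_character k \<psi> \<Longrightarrow> norm (\<psi> n) \<le> 1"
  using norm_dchar[of k \<psi> n] dchar_eq_0_iff[of k \<psi> n] by (cases "coprime n k") auto

lemma dchar_times:
  assumes "dirichlet_character k \<psi>" "dirichlet_character k \<phi>"
  shows "dirichlet_character k (\<lambda>n. \<psi> n * \<phi> n)"
  using assms unfolding dirichlet_character_def by auto

lemma dchar_cnj:
  assumes "dirichlet_character k \<psi>"
  shows "dirichlet_character k (\<lambda>n. cnj (\<psi> n))"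
  using assms unfolding dirichlet_character_def by auto

definition principal_char :: "nat \<Rightarrow> nat \<Rightarrow> complex" where
  "principal_char k n = (if coprime n k then 1 else 0)"

lemma dchar_principal: "k > 0 \<Longrightarrow> dirichlet_character k (principal_char k)"
  proof -
  have "coprime (n + k) k \<longleftrightarrow> coprime n k" for n by (metis coprime_iff_gcd_eq_1 gcd_add1)
  then show "k > 0 \<Longrightarrow> dirichlet_character k (principal_char k)"
    unfolding dirichlet_character_def principal_char_def by auto
qed

lemma dchar_times_cnj:
  assumes "dirichlet_character k \<psi>" shows "\<psi> n * cnj (\<psi> n) = principal_char k n"
  using norm_dchar[OF assms, of n] dchar_eq_0_iff[OF assms, of n]
  by (auto simp: principal_char_def complex_norm_square[symmetric])

text \<open>A character is determined by its values at the k residues, and each value is 0 or a root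
  of unity of exponent \<open>totient k\<close>; so the characters embed in a finite
  product.\<close>

lemma finite_dchars: "finite {\<psi>. dirichlet_character k \<psi>}"
proof (cases "k > 0")
  case True
  define Z where "Z = insert 0 {z::complex. z ^ totient k = 1}"
  have "finite Z" unfolding Z_def using finite_roots_unity[of "totient k"] True by (simp add: Suc_leI)
  have "inj_on (\<lambda>\<psi>. restrict \<psi> {..<k}) {\<psi>. dirichlet_character k \<psi>}"
  proof (rule inj_onI, rule ext)
    fix \<psi> \<phi> :: "nat \<Rightarrow> complex" and n
    assume a: "\<psi> \<in> {\<psi>. dirichlet_character k \<psi>}" "\<phi> \<in> {\<psi>. dirichlet_character k \<psi>}"
      and e: "restrict \<psi> {..<k} = restrict \<phi> {..<k}"
    have "\<psi> (n mod k) = \<phi> (n mod k)" using fun_cong[OF e, of "n mod k"] True by simp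
    then show "\<psi> n = \<phi> n"
      using a dchar_cong[of k _ n "n mod k"] by (metis cong_mod_right cong_refl mem_Collect_eq)
  qed
  moreover have "(\<lambda>\<psi>. restrict \<psi> {..<k}) ` {\<psi>. dirichlet_character k \<psi>} \<subseteq> (\<Pi>\<^sub>E i\<in>{..<k}. Z)"
  proof (intro image_subsetI PiE_I)
    fix \<psi> x assume "\<psi> \<in> {\<psi>. dirichlet_character k \<psi>}"
    then show "restrict \<psi> {..<k} x \<in> Z" if "x \<in> {..<k}"
      using that dchar_totient[of k \<psi> x] dchar_eq_0_iff[of k \<psi> x] by (cases "coprime x k") (auto simp: Z_def)
  qed auto
  then have "finite ((\<lambda>\<psi>. restrict \<psi> {..<k}) ` {\<psi>. dirichlet_character k \<psi>})"
    by (rule finite_subset) (auto intro!: finite_PiE \<open>finite Z\<close>)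
  ultimately show ?thesis by (rule finite_imageD[rotated])
qed (simp add: dirichlet_character_def)

text \<open>A geometric sum: its ratio \<open>q\<close> satisfies q ^ n = 1, and 0 < j < n keeps it
  from being 1.\<close>

lemma sum_root_unity_powers:
  fixes \<xi> :: complex
  assumes "\<xi> = cis (2 * pi / n)" "0 < n" "j < n"
  shows "(\<Sum>i<n. inverse (\<xi> ^ i) ^ j) = (if j = 0 then of_nat n else 0)"
proof (cases "j = 0")
  case False
  define q where "q = inverse (\<xi> ^ j)"
  have q: "q = cis (- (2 * pi * j / n))" unfolding q_def assms(1) Complex.DeMoivre cis_inverse
    by (rule arg_cong[where f=cis]) simp
  have "q \<noteq> 1"
  proof
    assume "q = 1"
    then have "cos (2 * pi * j / n) = 1" unfolding q by (auto simp: complex_eq_iff)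
    then obtain m :: int where m: "2 * pi * j / n = of_int m * 2 * pi" using cos_one_2pi_int by (metis mult.assoc)
    then have "real j = of_int m * real n" using assms(2) by (simp add: field_simps)
    then have jm: "int j = m * int n" by (metis of_int_eq_iff of_int_mult of_int_of_nat_eq)
    then have "n dvd j" by (metis dvd_triv_right int_dvd_int_iff)
    then show False using False assms(3) by (auto dest: dvd_imp_le)
  qed
  have "q ^ n = cis (- (2 * pi * j))" unfolding q Complex.DeMoivre using assms(2) by simp
  also have "\<dots> = 1" using cis_multiple_2pi[of "- real j"] by simp
  finally have "q ^ n = 1" .
  have "(\<Sum>i<n. inverse (\<xi> ^ i) ^ j) = (\<Sum>i<n. q ^ i)"
    by (rule sum.cong) (auto simp: q_def power_inverse[symmetric] power_mult[symmetric] mult.commute)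
  also have "\<dots> = 0" using geometric_sum[OF \<open>q \<noteq> 1\<close>, of n] \<open>q ^ n = 1\<close> by simp
  finally show ?thesis using False by simp
qed simp

text \<open>The eigenprojections of a translation of finite order sum to the identity, so one of them
  does not annihilate f; it commutes with all other translations.\<close>

lemma translation_eigenfunction:
  fixes f :: "nat \<Rightarrow> complex"
  assumes k: "k > 0" and h: "coprime h k"
    and per: "\<And>x y. [x = y] (mod k) \<Longrightarrow> f x = f y"
    and supp: "\<And>x. \<not> coprime x k \<Longrightarrow> f x = 0"
    and nz: "f x0 \<noteq> 0"
  obtains \<omega> F x1 where "\<forall>x y. [x = y] (mod k) \<longrightarrow> F x = F y" "\<forall>x. \<not> coprime x k \<longrightarrow> F x = 0"
    "F x1 \<noteq> 0" "\<forall>x. F (h * x) = \<omega> * F x"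
    "\<forall>m c. (\<forall>x. f (m * x) = c * f x) \<longrightarrow> (\<forall>x. F (m * x) = c * F x)"
    "f (h * x0) \<noteq> f x0 \<longrightarrow> \<omega> \<noteq> 1"
proof -
  define n where "n = totient k"
  define \<xi> where "\<xi> = cis (2 * pi / n)"
  have n: "n > 0" unfolding n_def using k by simp
  have \<xi>n: "\<xi> ^ n = 1"
  proof -
    have "real n * (2 * pi / real n) = 2 * pi" using n by simp
    then show ?thesis unfolding \<xi>_def Complex.DeMoivre by (simp only: cis_2pi)
  qed
  have \<xi>0: "\<xi> \<noteq> 0" by (simp add: \<xi>_def)
  \<comment> \<open>Up to the factor n, \<open>F i\<close> is the projection of f onto the
    eigenvalue \<xi> ^ i of the translation by h, whose order divides n.\<close>
  define F where "F = (\<lambda>i x. \<Sum>j<n. inverse (\<xi> ^ i) ^ j * f (h ^ j * x))"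
  have F_per: "F i x = F i y" if "[x = y] (mod k)" for i x y
    unfolding F_def by (intro sum.cong refl arg_cong2[where f="(*)"] per cong_scalar_left that)
  have F_supp: "F i x = 0" if "\<not> coprime x k" for i x
    unfolding F_def by (intro sum.neutral ballI) (use that supp in auto)
  have F_h: "F i (h * x) = \<xi> ^ i * F i x" for i x
  proof -
    define g where "g = (\<lambda>j. inverse (\<xi> ^ i) ^ j * f (h ^ j * x))"
    have "inverse (\<xi> ^ i) ^ n = inverse ((\<xi> ^ n) ^ i)"
      by (metis mult.commute power_inverse power_mult)
    then have "inverse (\<xi> ^ i) ^ n = 1" using \<xi>n by simp
    moreover have "f (h ^ n * x) = f x"
      using per cong_scalar_right[OF euler_theorem[OF h], of x] by (simp add: n_def)
    ultimately have gn: "g n = g 0" by (simp add: g_def)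
    have "F i (h * x) = (\<Sum>j<n. \<xi> ^ i * g (Suc j))"
      unfolding F_def by (intro sum.cong refl) (use \<xi>0 in \<open>auto simp: g_def field_simps\<close>)
    also have "\<dots> = \<xi> ^ i * (\<Sum>j<n. g (Suc j))" by (simp add: sum_distrib_left)
    also have "(\<Sum>j<n. g (Suc j)) = (\<Sum>j<Suc n. g j) - g 0" by (subst sum.lessThan_Suc_shift) simp
    also have "\<dots> = (\<Sum>j<n. g j)" using gn by simp
    finally show ?thesis by (simp add: F_def g_def)
  qed
  have F_sum: "(\<Sum>i<n. F i x) = of_nat n * f x" for x
  proof -
    have "(\<Sum>i<n. F i x) = (\<Sum>j<n. (\<Sum>i<n. inverse (\<xi> ^ i) ^ j) * f (h ^ j * x))"
      unfolding F_def by (subst sum.swap) (simp add: sum_distrib_right)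
    also have "\<dots> = (\<Sum>j<n. (if j = 0 then of_nat n else 0) * f (h ^ j * x))"
      by (intro sum.cong refl arg_cong2[where f="(*)"] sum_root_unity_powers[OF \<xi>_def n]) auto
    also have "\<dots> = (\<Sum>j\<in>{0}. of_nat n * f (h ^ j * x))"
      by (rule sum.mono_neutral_cong_right) (use n in auto)
    finally show ?thesis by simp
  qed
  have F_comm: "F i (m * x) = c * F i x" if "\<And>x. f (m * x) = c * f x" for i m c x
  proof -
    have "f (h ^ j * (m * x)) = c * f (h ^ j * x)" for j
      using that[of "h ^ j * x"] by (simp add: mult.left_commute)
    then show ?thesis by (simp add: F_def sum_distrib_left mult.left_commute)
  qed
  have "\<exists>i x1. F i x1 \<noteq> 0 \<and> (f (h * x0) \<noteq> f x0 \<longrightarrow> \<xi> ^ i \<noteq> 1)"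
  proof (cases "f (h * x0) = f x0")
    case True
    have "(\<Sum>i<n. F i x0) \<noteq> 0" using F_sum nz n by simp
    then obtain i where "F i x0 \<noteq> 0" by (meson sum.neutral)
    then show ?thesis using True by blast
  next
    case False
    show ?thesis
    \<comment> \<open>Otherwise every nonzero projection has eigenvalue 1, and their sum, n times f,
      takes equal values at x0 and at h * x0.\<close>
    proof (rule ccontr)
      assume "\<nexists>i x1. F i x1 \<noteq> 0 \<and> (f (h * x0) \<noteq> f x0 \<longrightarrow> \<xi> ^ i \<noteq> 1)"
      then have *: "F i x \<noteq> 0 \<Longrightarrow> \<xi> ^ i = 1" for i x using False by blast
      have "F i (h * x0) = F i x0" for i using *[of i x0] F_h[of i x0] by (cases "F i x0 = 0") auto
      then have "of_nat n * f (h * x0) = of_nat n * f x0" using F_sum by (metis (no_types, lifting) sum.cong)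
      then show False using False n by simp
    qed
  qed
  then obtain i x1 where "F i x1 \<noteq> 0" "f (h * x0) \<noteq> f x0 \<Longrightarrow> \<xi> ^ i \<noteq> 1" by blast
  then show ?thesis using that[of "F i" x1 "\<xi> ^ i"] F_per F_supp F_h F_comm by blast
qed

text \<open>A function on the units that is an eigenfunction of all translations is a multiple of a
  character. The indicator of 1 is moved by the translation by g, so it has a component with
  eigenvalue \<omega> \<noteq> 1; the other translations are then diagonalised one at a time, each
  step keeping the eigenvalues already fixed.\<close>

lemma dchar_separates:
  assumes k: "k > 0" and g: "coprime g k" and g1: "\<not> [g = 1] (mod k)"
  obtains \<psi> where "dirichlet_character k \<psi>" "\<psi> g \<noteq> 1"
proof -
  define f0 where "f0 = (\<lambda>x. if [x = 1] (mod k) then 1 else 0 :: complex)"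
  have f0_per: "f0 x = f0 y" if "[x = y] (mod k)" for x y
    using that unfolding f0_def by (meson cong_sym cong_trans)
  have f0_supp: "f0 x = 0" if "\<not> coprime x k" for x
    using that unfolding f0_def by (metis cong_imp_coprime cong_sym coprime_1_left)
  have f0_g: "f0 (g * 1) \<noteq> f0 1" using g1 by (simp add: f0_def)
  have "f0 1 \<noteq> 0" by (simp add: f0_def)
  obtain \<omega> :: complex and F0 :: "nat \<Rightarrow> complex" and x0 where F0: "\<forall>x y. [x = y] (mod k) \<longrightarrow> F0 x = F0 y" "\<forall>x. \<not> coprime x k \<longrightarrow> F0 x = 0"
    "F0 x0 \<noteq> 0" "\<forall>x. F0 (g * x) = \<omega> * F0 x" "\<omega> \<noteq> 1"
    by (rule translation_eigenfunction[where f=f0 and ?x0.0=1, OF k g f0_per f0_supp \<open>f0 1 \<noteq> 0\<close>])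
      (use f0_g in blast)+
  have main: "\<exists>F x1. (\<forall>x y. [x = y] (mod k) \<longrightarrow> F x = F y) \<and> (\<forall>x. \<not> coprime x k \<longrightarrow> F x = 0) \<and>
          F x1 \<noteq> 0 \<and> (\<forall>x. F (g * x) = \<omega> * F x) \<and> (\<forall>h\<in>S. \<exists>c. \<forall>x. F (h * x) = c * F x)"
    if "finite S" "\<forall>h\<in>S. coprime h k" for S
    using that
  proof (induction S rule: finite_induct)
    case empty
    show ?case by (intro exI[of _ F0] exI[of _ x0]) (use F0 in auto)
  next
    case (insert h S)
    have "\<forall>h\<in>S. coprime h k" using insert.prems by simp
    from insert.IH[OF this] obtain F x1 where
      F': "\<forall>x y. [x = y] (mod k) \<longrightarrow> F x = F y" "\<forall>x. \<not> coprime x k \<longrightarrow> F x = 0"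
      "F x1 \<noteq> 0" "\<forall>x. F (g * x) = \<omega> * F x" "\<forall>h\<in>S. \<exists>c. \<forall>x. F (h * x) = c * F x" by blast
    note F = F'(1,2)[rule_format] F'(3) F'(4,5)[rule_format]
    have "coprime h k" using insert.prems by simp
    obtain \<rho> G x2 where
      G: "\<forall>x y. [x = y] (mod k) \<longrightarrow> G x = G y" "\<forall>x. \<not> coprime x k \<longrightarrow> G x = 0" "G x2 \<noteq> 0"
        "\<forall>x. G (h * x) = \<rho> * G x"
        "\<forall>m c. (\<forall>x. F (m * x) = c * F x) \<longrightarrow> (\<forall>x. G (m * x) = c * G x)"
      by (rule translation_eigenfunction[where f=F and ?x0.0=x1, OF k \<open>coprime h k\<close> F(1,2,3)]) blast+
    have "\<exists>c. \<forall>x. G (m * x) = c * G x" if "m \<in> insert h S" for m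
      using that G(4,5) F(5) by (metis insertE)
    then show ?case using G(1-3) G(5) F(4) by (intro exI[of _ G] exI[of _ x2]) auto
  qed
  define R where "R = {h. h < k \<and> coprime h k}"
  have "finite R" "\<forall>h\<in>R. coprime h k" by (auto simp: R_def)
  from main[OF this]
  obtain F x1 where F': "\<forall>x y. [x = y] (mod k) \<longrightarrow> F x = F y" "\<forall>x. \<not> coprime x k \<longrightarrow> F x = 0"
      "F x1 \<noteq> 0" "\<forall>x. F (g * x) = \<omega> * F x"
      "\<forall>h\<in>R. \<exists>c. \<forall>x. F (h * x) = c * F x" by blast
  note F = F'(1,2)[rule_format] F'(3) F'(4)[rule_format] F'(5)[rule_format]
  have Fh: "\<exists>c. \<forall>x. F (h * x) = c * F x" if "coprime h k" for h
  proof -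
    have "coprime (h mod k) k" using that k by (simp add: coprime_mod_left_iff)
    then obtain c where "\<And>x. F ((h mod k) * x) = c * F x" using F(5)[of "h mod k"] k by (auto simp: R_def)
    moreover have "F ((h mod k) * x) = F (h * x)" for x
      by (rule F(1)) (simp add: cong_def mod_mult_left_eq)
    ultimately show ?thesis by metis
  qed
  \<comment> \<open>x1 is a unit, so F x1 is a multiple of F 1. Hence F 1 is nonzero and F can be
    normalised there.\<close>
  have "coprime x1 k" using F(2,3) by blast
  then obtain c where "F x1 = c * F 1" using Fh by (metis mult_1_right)
  then have F1: "F 1 \<noteq> 0" using F(3) by auto
  define \<psi> where "\<psi> = (\<lambda>x. F x / F 1)"
  have mult: "F (m * n) * F 1 = F m * F n" for m n
  proof (cases "coprime m k")
    case True
    then obtain c where "\<And>x. F (m * x) = c * F x" using Fh by blast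
    then show ?thesis by (metis mult.assoc mult.commute mult_1_right)
  next
    case False
    then show ?thesis using F(2) by simp
  qed
  have "F n \<noteq> 0" if "coprime n k" for n
  proof -
    have "F (n ^ totient k) = F 1" by (rule F(1)) (rule euler_theorem[OF that])
    moreover have "n ^ totient k = n * n ^ (totient k - 1)"
      using k by (metis power_eq_if totient_gt_0_iff neq0_conv)
    ultimately show ?thesis using mult[of n "n ^ (totient k - 1)"] F1 by auto
  qed
  then have "F n \<noteq> 0 \<longleftrightarrow> coprime n k" for n using F(2) by blast
  moreover have "F (n + k) = F n" for n by (rule F(1)) (simp add: cong_def)
  moreover have "F (m * n) / F 1 = F m / F 1 * (F n / F 1)" for m n
    using mult[of m n] F1 by (simp add: field_simps)
  ultimately have "dirichlet_character k \<psi>" unfolding dirichlet_character_def \<psi>_def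
    using k F1 by simp
  moreover have "\<psi> g \<noteq> 1" unfolding \<psi>_def using F(4)[of 1] F0(5) F1 by simp
  ultimately show ?thesis using that by blast
qed

section \<open>Orthogonality relations and sums over intervals\<close>

lemma bij_betw_mult_mod:
  fixes h k :: nat assumes "k > 0" "coprime h k"
  shows "bij_betw (\<lambda>x. h * x mod k) {..<k} {..<k}"
proof -
  have "inj_on (\<lambda>x. h * x mod k) {..<k}"
    using assms by (auto intro!: inj_onI simp: cong_def[symmetric] cong_mult_lcancel_nat)
       (simp add: cong_def)
  moreover have "(\<lambda>x. h * x mod k) ` {..<k} \<subseteq> {..<k}" using assms by auto
  ultimately show ?thesis unfolding bij_betw_def by (simp add: endo_inj_surj)
qed

text \<open>Multiplication by a unit h with \<psi> h \<noteq> 1 permutes the residues and multiplies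
  the sum by \<psi> h. Such an h exists because \<psi> and the principal character vanish at the
  same places.\<close>

lemma sum_dchar_period:
  assumes "dirichlet_character k \<psi>" "\<psi> \<noteq> principal_char k"
  shows "(\<Sum>x<k. \<psi> x) = 0"
proof -
  have k: "k > 0" using assms(1) by (simp add: dirichlet_character_def)
  obtain h where h: "coprime h k" "\<psi> h \<noteq> 1"
    using assms dchar_eq_0_iff[OF assms(1)] by (fastforce simp: principal_char_def fun_eq_iff)
  have "(\<Sum>x<k. \<psi> x) = (\<Sum>x<k. \<psi> (h * x mod k))"
    using sum.reindex_bij_betw[OF bij_betw_mult_mod[OF k h(1)]] by metis
  also have "\<dots> = (\<Sum>x<k. \<psi> h * \<psi> x)"
    by (intro sum.cong refl) (metis assms(1) dchar_cong dchar_mult cong_mod_left cong_refl)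
  finally have "(\<Sum>x<k. \<psi> x) = \<psi> h * (\<Sum>x<k. \<psi> x)" unfolding sum_distrib_left .
  then show ?thesis using h(2) by simp
qed

lemma sum_principal_char: "k > 1 \<Longrightarrow> (\<Sum>x<k. principal_char k x) = of_nat (totient k)"
proof -
  assume k: "k > 1"
  have "(\<Sum>x<k. principal_char k x) = (\<Sum>x\<in>totatives k. 1)"
    unfolding principal_char_def
  proof (rule sum.mono_neutral_cong_right)
    show "totatives k \<subseteq> {..<k}" using totatives_less[OF _ k] by auto
    show "\<forall>i\<in>{..<k} - totatives k. (if coprime i k then 1 else 0) = (0::complex)"
    proof
      fix i assume i: "i \<in> {..<k} - totatives k"
      then have "\<not> coprime i k" using k by (cases "i = 0") (auto simp: in_totatives_iff)
      then show "(if coprime i k then 1 else 0) = (0::complex)" by simp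
    qed
  qed (auto simp: in_totatives_iff)
  then show ?thesis by (simp add: totient_def)
qed

text \<open>Multiplication by a character \<phi> with \<phi> g \<noteq> 1 permutes the characters,
  its inverse being multiplication by the conjugate, and multiplies the sum by \<phi> g.\<close>

lemma sum_dchars_eq_0:
  assumes "k > 0" "coprime g k" "\<not> [g = 1] (mod k)"
  shows "(\<Sum>\<psi> | dirichlet_character k \<psi>. \<psi> g) = 0"
proof -
  obtain \<phi> where \<phi>: "dirichlet_character k \<phi>" "\<phi> g \<noteq> 1" using dchar_separates[OF assms] .
  let ?X = "{\<psi>. dirichlet_character k \<psi>}"
  have canc: "(\<lambda>n. \<phi> n * (cnj (\<phi> n) * \<psi> n)) = \<psi>" "(\<lambda>n. cnj (\<phi> n) * (\<phi> n * \<psi> n)) = \<psi>"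
    if "\<psi> \<in> ?X" for \<psi>
    using that dchar_times_cnj[OF \<phi>(1)] dchar_eq_0_iff[of k \<psi>]
    by (auto simp: fun_eq_iff principal_char_def mult.assoc[symmetric] mult.commute)
  have "bij_betw (\<lambda>\<psi> n. \<phi> n * \<psi> n) ?X ?X"
    by (rule bij_betwI[where g="\<lambda>\<psi> n. cnj (\<phi> n) * \<psi> n"])
       (use canc dchar_times dchar_cnj \<phi>(1) in auto)
  then have "(\<Sum>\<psi>\<in>?X. \<psi> g) = (\<Sum>\<psi>\<in>?X. \<phi> g * \<psi> g)"
    using sum.reindex_bij_betw[of "\<lambda>\<psi> n. \<phi> n * \<psi> n" ?X ?X "\<lambda>\<psi>. \<psi> g"] by simp
  then have "(\<Sum>\<psi>\<in>?X. \<psi> g) = \<phi> g * (\<Sum>\<psi>\<in>?X. \<psi> g)" unfolding sum_distrib_left .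
  then show ?thesis using \<phi>(2) by simp
qed

text \<open>The case g = 1 is the number of characters. It is found by summing \<psi> x over all
  \<psi> and x in both orders: one order leaves only the principal character, the other only x =
  1.\<close>

lemma sum_dchars:
  assumes "k > 1" "coprime g k"
  shows "(\<Sum>\<psi> | dirichlet_character k \<psi>. \<psi> g) = (if [g = 1] (mod k) then of_nat (totient k) else 0)"
proof -
  let ?X = "{\<psi>. dirichlet_character k \<psi>}"
  have k: "k > 0" using assms by simp
  have a: "(\<Sum>\<psi>\<in>?X. \<Sum>x<k. \<psi> x) = of_nat (totient k)"
  proof -
    have "(\<Sum>\<psi>\<in>?X. \<Sum>x<k. \<psi> x) = (\<Sum>\<psi>\<in>{principal_char k}. \<Sum>x<k. \<psi> x)"
      by (rule sum.mono_neutral_right) (use finite_dchars sum_dchar_period dchar_principal[OF k] in auto)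
    then show ?thesis using sum_principal_char[OF assms(1)] by simp
  qed
  have "(\<Sum>\<psi>\<in>?X. \<Sum>x<k. \<psi> x) = (\<Sum>x<k. \<Sum>\<psi>\<in>?X. \<psi> x)" by (rule sum.swap)
  also have "\<dots> = (\<Sum>x\<in>{1}. \<Sum>\<psi>\<in>?X. \<psi> x)"
  proof (rule sum.mono_neutral_right)
    show "\<forall>i\<in>{..<k} - {1}. (\<Sum>\<psi>\<in>?X. \<psi> i) = 0"
    proof
      fix i assume i: "i \<in> {..<k} - {1}"
      show "(\<Sum>\<psi>\<in>?X. \<psi> i) = 0"
      proof (cases "coprime i k")
        case True
        have "\<not> [i = 1] (mod k)" using i assms by (auto simp: cong_def)
        then show ?thesis using sum_dchars_eq_0[OF k True] by blast
      next
        case False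
        then show ?thesis using dchar_eq_0_iff by (auto intro!: sum.neutral)
      qed
    qed
  qed (use assms in auto)
  also have "\<dots> = of_nat (card ?X)"
  proof -
    have "(\<Sum>\<psi>\<in>?X. \<psi> (Suc 0)) = (\<Sum>\<psi>\<in>?X. 1)" by (rule sum.cong) (auto simp: dchar_1)
    then show ?thesis by simp
  qed
  finally have card: "of_nat (card ?X) = (of_nat (totient k) :: complex)" using a by simp
  show ?thesis
  proof (cases "[g = 1] (mod k)")
    case True
    then have "\<And>\<psi>. \<psi> \<in> ?X \<Longrightarrow> \<psi> g = 1" using dchar_cong[of k _ g 1] dchar_1 by (metis One_nat_def mem_Collect_eq)
    then have "(\<Sum>\<psi>\<in>?X. \<psi> g) = (\<Sum>\<psi>\<in>?X. 1)" by (rule sum.cong[OF refl])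
    then show ?thesis using True card by simp
  qed (use sum_dchars_eq_0[OF k assms(2)] in simp)
qed

text \<open>Complete periods cancel, which leaves fewer than k terms. Nothing sharper is called for,
  as only the logarithm of this bound reaches the estimate of log L.\<close>

lemma norm_sum_dchar_le:
  assumes "dirichlet_character k \<psi>" "\<psi> \<noteq> principal_char k"
  shows "norm (\<Sum>x<n. \<psi> x) \<le> k"
proof -
  have k: "k > 0" using assms(1) by (simp add: dirichlet_character_def)
  have z: "(\<Sum>x<m * k. \<psi> x) = 0" for m
  proof (induction m)
    case (Suc m)
    have "(\<Sum>x<Suc m * k. \<psi> x) = (\<Sum>x<m * k + k. \<psi> x)" by (simp add: add.commute)
    also have "\<dots> = (\<Sum>x<m * k. \<psi> x) + (\<Sum>x<k. \<psi> (m * k + x))" by (rule sum_lessThan_add)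
    also have "(\<Sum>x<k. \<psi> (m * k + x)) = (\<Sum>x<k. \<psi> x)"
      by (intro sum.cong refl dchar_cong[OF assms(1)]) (simp add: cong_def)
    finally show ?case using Suc sum_dchar_period[OF assms] by simp
  qed simp
  have "(\<Sum>x<n. \<psi> x) = (\<Sum>x<n div k * k + n mod k. \<psi> x)" by simp
  also have "\<dots> = (\<Sum>x<n mod k. \<psi> (n div k * k + x))"
    by (subst sum_lessThan_add) (simp only: z, simp)
  also have "norm \<dots> \<le> (\<Sum>x<n mod k. 1)" by (rule sum_norm_le) (use norm_dchar_le_1[OF assms(1)] in auto)
  also have "\<dots> \<le> k" using mod_less_divisor[OF k, of n] by simp
  finally show ?thesis .
qed

section \<open>Continuation of periodic Dirichlet series\<close>

lemma holomorphic_on_suminf: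
  fixes g :: "nat \<Rightarrow> complex \<Rightarrow> complex"
  assumes S: "open S" and hol: "\<And>n. g n holomorphic_on S"
    and bnd: "\<And>s. s \<in> S \<Longrightarrow> \<exists>d M. 0 < d \<and> cball s d \<subseteq> S \<and> summable M \<and> (\<forall>n. \<forall>z\<in>cball s d. norm (g n z) \<le> M n)"
  shows "(\<lambda>s. \<Sum>n. g n s) holomorphic_on S"
proof (rule holomorphic_uniform_sequence[OF S, where f="\<lambda>n s. \<Sum>i<n. g i s"])
  fix s assume "s \<in> S"
  with bnd obtain d M where *: "0 < d" "cball s d \<subseteq> S" "summable M"
    "\<And>n z. z \<in> cball s d \<Longrightarrow> norm (g n z) \<le> M n" by metis
  have "uniform_limit (cball s d) (\<lambda>n s. \<Sum>i<n. g i s) (\<lambda>s. \<Sum>n. g n s) sequentially"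
    by (rule Weierstrass_m_test[where M=M]) (use * in auto)
  then show "\<exists>d>0. cball s d \<subseteq> S \<and> uniform_limit (cball s d) (\<lambda>n s. \<Sum>i<n. g i s) (\<lambda>s. \<Sum>n. g n s) sequentially"
    using * by blast
qed (auto intro!: holomorphic_intros hol)

text \<open>The j-fold difference of x powr (- s), with signs such that it is (-1) ^ j times the
  usual forward difference. It is taken over real x so that the mean value inequality
  applies.\<close>

fun powr_diff :: "nat \<Rightarrow> complex \<Rightarrow> real \<Rightarrow> complex" where
  "powr_diff 0 s x = of_real x powr (- s)"
| "powr_diff (Suc j) s x = powr_diff j s x - powr_diff j s (x + 1)"

declare powr_diff.simps [simp del]

text \<open>Differentiation commutes with the differences and only shifts s to s + 1; hence the
  induction needs s arbitrary.\<close>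

lemma powr_diff_deriv:
  "x > 0 \<Longrightarrow> (powr_diff j s has_vector_derivative - s * powr_diff j (s + 1) x) (at x within A)"
proof (induction j arbitrary: x s A)
  case 0
  have "((\<lambda>z. z powr (- s)) has_field_derivative (- s * of_real x powr (- s - 1))) (at (of_real x))"
    by (rule has_field_derivative_powr) (use 0 in \<open>auto simp: complex_nonpos_Reals_iff\<close>)
  from has_vector_derivative_real_field[OF this]
  have "((\<lambda>x. of_real x powr (- s)) has_vector_derivative (- s * of_real x powr (- s - 1))) (at x within A)" .
  moreover have "- (s + 1) = - s - 1" by simp
  ultimately show ?case unfolding powr_diff.simps(1)[abs_def] by simp
next
  case (Suc j)
  have "((\<lambda>x. powr_diff j s (x + 1)) has_vector_derivative - s * powr_diff j (s + 1) (x + 1)) (at x within A)"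
  proof -
    have "((\<lambda>x. x + 1) has_vector_derivative 1) (at x within A)" by (auto intro!: derivative_eq_intros)
    from vector_diff_chain_within[OF this Suc.IH[of "x + 1" s]] show ?thesis
      using Suc.prems by (simp add: o_def)
  qed
  from has_vector_derivative_diff[OF Suc.IH[of x s A, OF Suc.prems] this] show ?case
    by (simp add: powr_diff.simps(2)[abs_def] algebra_simps)
qed

text \<open>The mean value inequality on [x, x + 1] trades one difference for one derivative, that
  is, for a factor \<open>norm s\<close> and the shift of s to s + 1. The condition on Re s makes
  the bounding power nonincreasing, so its value at the left endpoint serves for the whole
  interval.\<close>

lemma norm_powr_diff_le:
  "x \<ge> 1 \<Longrightarrow> Re s + j \<ge> 0 \<Longrightarrow> norm (powr_diff j s x) \<le> (\<Prod>i<j. norm (s + of_nat i)) * x powr (- Re s - j)"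
proof (induction j arbitrary: x s)
  case 0
  then show ?case by (simp add: powr_diff.simps norm_powr_real_powr)
next
  case (Suc j)
  define B where "B = norm s * ((\<Prod>i<j. norm (s + 1 + of_nat i)) * x powr (- Re s - 1 - j))"
  have bd: "norm (- s * powr_diff j (s + 1) y) \<le> B" if y: "y \<in> {x..x+1}" for y
  proof -
    have "norm (powr_diff j (s + 1) y) \<le> (\<Prod>i<j. norm (s + 1 + of_nat i)) * y powr (- Re s - 1 - j)"
    proof -
      have e: "- Re (s + 1) - real j = - Re s - 1 - real j" by simp
      have "norm (powr_diff j (s + 1) y) \<le> (\<Prod>i<j. norm (s + 1 + of_nat i)) * y powr (- Re (s + 1) - j)"
        by (rule Suc.IH) (use Suc.prems y in auto)
      then show ?thesis by (simp only: e)
    qed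
    also have "\<dots> \<le> (\<Prod>i<j. norm (s + 1 + of_nat i)) * x powr (- Re s - 1 - j)"
      using Suc.prems y by (intro mult_left_mono powr_mono2') (auto intro!: prod_nonneg)
    finally show ?thesis unfolding B_def by (simp add: norm_mult mult_left_mono)
  qed
  have "norm (powr_diff j s (x + 1) - powr_diff j s x) \<le> B * norm (x + 1 - x)"
  proof (rule differentiable_bound[of "{x..x+1}" _ "\<lambda>y h. h *\<^sub>R (- s * powr_diff j (s + 1) y)"])
    fix y assume y: "y \<in> {x..x+1}"
    then show "(powr_diff j s has_derivative (\<lambda>h. h *\<^sub>R (- s * powr_diff j (s + 1) y))) (at y within {x..x+1})"
      using powr_diff_deriv[of y j s "{x..x+1}"] Suc.prems by (simp add: has_vector_derivative_def)
    show "onorm (\<lambda>h. h *\<^sub>R (- s * powr_diff j (s + 1) y)) \<le> B"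
    proof (rule onorm_bound)
      show "0 \<le> B" using bd[OF y] norm_ge_zero order_trans by blast
      show "norm (h *\<^sub>R (- s * powr_diff j (s + 1) y)) \<le> B * norm h" for h
        unfolding norm_scaleR mult.commute[of B] real_norm_def by (intro mult_left_mono bd y) auto
    qed
  qed auto
  then have "norm (powr_diff (Suc j) s x) \<le> B" by (simp add: powr_diff.simps(2) norm_minus_commute)
  also have "(\<Prod>i<Suc j. norm (s + of_nat i)) = norm s * (\<Prod>i<j. norm (s + 1 + of_nat i))"
    by (subst prod.lessThan_Suc_shift) (simp add: algebra_simps)
  then have "B = (\<Prod>i<Suc j. norm (s + of_nat i)) * x powr (- Re s - Suc j)"
    unfolding B_def by (simp add: algebra_simps)
  finally show ?case .
qed

lemma powr_diff_holomorphic [holomorphic_intros]: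
  "x > 0 \<Longrightarrow> (\<lambda>s. powr_diff j s x) holomorphic_on A"
  by (induction j arbitrary: x) (auto intro!: holomorphic_intros simp: powr_diff.simps complex_nonpos_Reals_iff)

lemma summable_powr_Suc: "e < -1 \<Longrightarrow> summable (\<lambda>n. real (Suc n) powr e)"
  using summable_Suc_iff[of "\<lambda>n. real n powr e"] summable_real_powr_iff[of e] by simp

text \<open>\<open>d\<close> is half the distance from s to the line Re s = 1 - j. On the whole disc
  the terms therefore decay with exponent - 1 - d, which is a summable majorant independent of
  z.\<close>

lemma norm_powr_diff_cball:
  assumes s: "Re s > 1 - j" and d: "d = (Re s + j - 1) / 2" and z: "z \<in> cball s d"
  shows "norm (powr_diff j z (real (Suc n))) \<le> (norm s + d + j) ^ j * real (Suc n) powr (- 1 - d)"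
proof -
  have rz: "\<bar>Re z - Re s\<bar> \<le> d" using z abs_Re_le_cmod[of "s - z"] by (simp add: dist_norm)
  then have "Re s - Re z \<le> d" by (simp add: abs_le_iff)
  then have rz': "Re z + j \<ge> 1 + d" using d by (simp add: field_simps)
  have d0: "d > 0" using s d by simp
  have nz: "norm z \<le> norm s + d" using z norm_triangle_ineq[of s "z - s"] by (simp add: dist_norm norm_minus_commute)
  have "norm (powr_diff j z (real (Suc n))) \<le> (\<Prod>i<j. norm (z + of_nat i)) * real (Suc n) powr (- Re z - j)"
    by (rule norm_powr_diff_le) (use rz' d0 in auto)
  also have "\<dots> \<le> (\<Prod>i<j. norm s + d + j) * real (Suc n) powr (- 1 - d)"
  proof (intro mult_mono prod_mono conjI powr_mono)
    fix i assume "i \<in> {..<j}"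
    then show "norm (z + of_nat i) \<le> norm s + d + j"
      using nz norm_triangle_ineq[of z "of_nat i"] by simp
  qed (use rz' d0 in \<open>auto intro!: prod_nonneg\<close>)
  finally show ?thesis by simp
qed

lemma powr_diff_series:
  assumes a: "\<And>n. norm (a n) \<le> A"
  shows "(\<lambda>s. \<Sum>n. a n * powr_diff j s (real (Suc n))) holomorphic_on {s. Re s > 1 - real j}"
    and "Re s > 1 - real j \<Longrightarrow> summable (\<lambda>n. norm (a n * powr_diff j s (real (Suc n))))"
proof -
  have A: "A \<ge> 0" using a[of 0] norm_ge_zero order_trans by blast
  have *: "\<exists>d M. 0 < d \<and> cball s d \<subseteq> {s. Re s > 1 - real j} \<and> summable M \<and>
     (\<forall>n. \<forall>z\<in>cball s d. norm (a n * powr_diff j z (real (Suc n))) \<le> M n)" if s: "Re s > 1 - real j" for s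
  proof -
    define d where "d = (Re s + j - 1) / 2"
    define M where "M = (\<lambda>n. A * ((norm s + d + j) ^ j * real (Suc n) powr (- 1 - d)))"
    have d: "d > 0" using s by (simp add: d_def)
    have "cball s d \<subseteq> {s. Re s > 1 - real j}"
    proof
      fix z assume "z \<in> cball s d"
      then have "\<bar>Re z - Re s\<bar> \<le> d" using abs_Re_le_cmod[of "s - z"] by (simp add: dist_norm)
      then have "Re s - Re z \<le> d" by (simp add: abs_le_iff)
      then have "Re z > 1 - real j" using s unfolding d_def by (simp add: field_simps)
      then show "z \<in> {s. Re s > 1 - real j}" by simp
    qed
    moreover have "summable M" unfolding M_def using d by (intro summable_mult summable_powr_Suc) simp
    moreover have "norm (a n * powr_diff j z (real (Suc n))) \<le> M n" if "z \<in> cball s d" for n z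
      unfolding M_def norm_mult using a A norm_powr_diff_cball[OF s d_def that] by (intro mult_mono) auto
    ultimately show ?thesis using d by blast
  qed
  have "open {s. Re s > 1 - real j}" by (rule open_halfspace_Re_gt)
  then show "(\<lambda>s. \<Sum>n. a n * powr_diff j s (real (Suc n))) holomorphic_on {s. Re s > 1 - real j}"
    by (rule holomorphic_on_suminf) (use * in \<open>auto intro!: holomorphic_intros\<close>)
  show "summable (\<lambda>n. norm (a n * powr_diff j s (real (Suc n))))" if s: "Re s > 1 - real j"
  proof -
    obtain d M where "0 < d" "summable M" "\<forall>n. \<forall>z\<in>cball s d. norm (a n * powr_diff j z (real (Suc n))) \<le> M n"
      using *[OF s] by blast
    then have "norm (norm (a n * powr_diff j s (real (Suc n)))) \<le> M n" for n by (simp add: less_imp_le)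
    then show ?thesis by (rule summable_comparison_test'[OF \<open>summable M\<close>])
  qed
qed

lemma sum_by_parts:
  fixes a u :: "nat \<Rightarrow> 'a :: comm_ring"
  shows "(\<Sum>n<N. a n * u n) = (\<Sum>n<N. (\<Sum>m<Suc n. a m) * (u n - u (Suc n))) + (\<Sum>m<N. a m) * u N"
  by (induction N) (auto simp: algebra_simps)

text \<open>Summation by parts. Against bounded partial sums the boundary term vanishes as soon as
  Re s > - j, one unit to the left of the region where the bound on the terms gives absolute
  convergence.\<close>

lemma powr_diff_abel:
  assumes a: "\<And>n. norm (\<Sum>m<n. a m) \<le> A" and s: "Re s > - real j"
  shows "(\<lambda>n. a n * powr_diff j s (real (Suc n))) sums (\<Sum>n. (\<Sum>m<Suc n. a m) * powr_diff (Suc j) s (real (Suc n)))"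
proof -
  define u where "u = (\<lambda>n. powr_diff j s (real (Suc n)))"
  have Re: "Re s + j > 0" using s by simp
  have "u \<longlonglongrightarrow> 0"
  proof (rule Lim_null_comparison)
    show "\<forall>\<^sub>F n in sequentially. norm (u n) \<le> (\<Prod>i<j. norm (s + of_nat i)) * real (Suc n) powr (- Re s - j)"
      unfolding u_def by (intro always_eventually allI norm_powr_diff_le) (use Re in auto)
    have "(\<lambda>n. real (Suc n) powr (- Re s - j)) \<longlonglongrightarrow> 0"
      by (rule tendsto_neg_powr[OF _ filterlim_compose[OF filterlim_real_sequentially filterlim_Suc]])
         (use Re in auto)
    then show "(\<lambda>n. (\<Prod>i<j. norm (s + of_nat i)) * real (Suc n) powr (- Re s - j)) \<longlonglongrightarrow> 0"
      by (rule tendsto_mult_right_zero)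
  qed
  then have "(\<lambda>N. norm (u N) * A) \<longlonglongrightarrow> 0" by (intro tendsto_mult_left_zero tendsto_norm_zero)
  then have "(\<lambda>N. (\<Sum>m<N. a m) * u N) \<longlonglongrightarrow> 0"
    by (rule Lim_null_comparison[rotated])
       (intro always_eventually allI, metis a mult.commute mult_left_mono norm_ge_zero norm_mult)
  moreover have "(\<lambda>n. (\<Sum>m<Suc n. a m) * powr_diff (Suc j) s (real (Suc n))) sums
      (\<Sum>n. (\<Sum>m<Suc n. a m) * powr_diff (Suc j) s (real (Suc n)))"
    by (rule summable_sums, rule summable_norm_cancel, rule powr_diff_series(2)[where A=A and j="Suc j"])
       (use a s in \<open>simp_all del: sum.lessThan_Suc\<close>)
  ultimately have "(\<lambda>N. (\<Sum>n<N. (\<Sum>m<Suc n. a m) * powr_diff (Suc j) s (real (Suc n))) + (\<Sum>m<N. a m) * u N)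
     \<longlonglongrightarrow> (\<Sum>n. (\<Sum>m<Suc n. a m) * powr_diff (Suc j) s (real (Suc n))) + 0"
    unfolding sums_def by (intro tendsto_add)
  moreover have "(\<Sum>n<N. a n * u n) = (\<Sum>n<N. (\<Sum>m<Suc n. a m) * powr_diff (Suc j) s (real (Suc n))) + (\<Sum>m<N. a m) * u N" for N
    unfolding sum_by_parts[of a u N] by (simp add: u_def powr_diff.simps(2) add.commute)
  ultimately show ?thesis unfolding sums_def u_def by simp
qed

lemma periodic_bounded:
  fixes a :: "nat \<Rightarrow> complex"
  assumes "q > 0" "\<And>n. a (n + q) = a n"
  obtains A where "\<And>n. norm (a n) \<le> A"
proof -
  have m: "a n = a (n mod q)" for n
  proof -
    have "a (i + j * q) = a i" for i j
    proof (induction j)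
      case (Suc j)
      have "a (i + Suc j * q) = a ((i + j * q) + q)" by (simp add: algebra_simps)
      then show ?case using Suc assms(2) by simp
    qed simp
    from this[of "n mod q" "n div q"] show ?thesis by simp
  qed
  have "norm (a n) \<le> (\<Sum>i<q. norm (a i))" for n
    using member_le_sum[of "n mod q" "{..<q}" "\<lambda>i. norm (a i)"] assms(1) m[of n] by simp
  then show ?thesis using that by blast
qed

lemma periodic_partial_sums:
  fixes a :: "nat \<Rightarrow> complex"
  assumes "\<And>n. a (n + q) = a n" "(\<Sum>n<q. a n) = 0"
  shows "(\<Sum>m<n + q. a m) = (\<Sum>m<n. a m)"
  by (induction n) (use assms in auto)

text \<open>Each summation by parts gains one unit of convergence.  The partial sums are periodic again, and
  subtracting their mean restores the hypothesis at the cost of a telescoping series.\<close>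

lemma periodic_strip_continuation:
  fixes a :: "nat \<Rightarrow> complex"
  assumes "q > 0" "\<And>n. a (n + q) = a n" "(\<Sum>n<q. a n) = 0"
  shows "\<exists>f. f holomorphic_on {s. Re s > 1 - real i - real j} \<and>
           (\<forall>s. Re s > 1 - real i \<longrightarrow> (\<lambda>n. a n * powr_diff i s (real (Suc n))) sums f s)"
  using assms(2,3)
\<comment> \<open>\<open>i\<close> counts the summations by parts already made and \<open>j\<close>
  those still to come.\<close>
proof (induction j arbitrary: i a)
  case 0
  obtain A where "\<And>n. norm (a n) \<le> A" using periodic_bounded[where a=a, OF assms(1) 0(1)] by blast
  note ser = powr_diff_series[OF this, where j=i]
  show ?case
    by (rule exI, rule conjI, use ser(1) in simp)
       (use summable_sums[OF summable_norm_cancel[OF ser(2)]] in auto)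
next
  case (Suc j)
  define A where "A = (\<lambda>n. \<Sum>m<Suc n. a m)"
  define c where "c = (\<Sum>n<q. A n) / of_nat q"
  define b where "b = (\<lambda>n. A n - c)"
  have perA: "(\<Sum>m<n + q. a m) = (\<Sum>m<n. a m)" for n by (rule periodic_partial_sums[OF Suc.prems])
  have b1: "b (n + q) = b n" for n unfolding b_def A_def using perA[of "Suc n"] by simp
  have b2: "(\<Sum>n<q. b n) = 0" unfolding b_def c_def sum_subtractf using assms(1) by simp
  obtain f where f: "f holomorphic_on {s. Re s > 1 - real (Suc i) - real j}"
    "\<And>s. Re s > 1 - real (Suc i) \<Longrightarrow> (\<lambda>n. b n * powr_diff (Suc i) s (real (Suc n))) sums f s"
    using Suc.IH[OF b1 b2, of "Suc i"] by blast
  obtain M where M: "\<And>n. norm (\<Sum>m<n. a m) \<le> M"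
    using periodic_bounded[OF assms(1), of "\<lambda>n. \<Sum>m<n. a m"] perA by blast
  have "(\<lambda>n. a n * powr_diff i s (real (Suc n))) sums (f s + c * powr_diff i s 1)" if s: "Re s > 1 - real i" for s
  proof -
    have s': "Re s > - real i" using s by simp
    have lim: "(\<lambda>n. powr_diff i s (real (Suc n))) \<longlonglongrightarrow> 0"
      using powr_diff_series(2)[of "\<lambda>_. 1" 1 i s] s
      by (intro tendsto_norm_zero_cancel[OF summable_LIMSEQ_zero]) auto
    have "(\<lambda>n. powr_diff i s (real (Suc n)) - powr_diff i s (real (Suc (Suc n)))) sums (powr_diff i s (real (Suc 0)) - 0)"
      by (rule telescope_sums'[OF lim])
    then have "(\<lambda>n. powr_diff (Suc i) s (real (Suc n))) sums powr_diff i s 1" by (simp add: powr_diff.simps(2) add.commute)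
    from sums_add[OF f(2) sums_mult[OF this, of c], of s]
    have "(\<lambda>n. A n * powr_diff (Suc i) s (real (Suc n))) sums (f s + c * powr_diff i s 1)"
      using s by (simp add: b_def algebra_simps)
    then have "(\<Sum>n. A n * powr_diff (Suc i) s (real (Suc n))) = f s + c * powr_diff i s 1"
      by (simp add: sums_iff)
    then show ?thesis using powr_diff_abel[OF M s'] by (simp only: A_def)
  qed
  moreover have "(\<lambda>s. f s + c * powr_diff i s 1) holomorphic_on {s. Re s > 1 - real i - real (Suc j)}"
    using f(1) by (intro holomorphic_intros) (auto simp: algebra_simps)
  ultimately show ?case by blast
qed

lemma halfplane_eq:
  fixes f g :: "complex \<Rightarrow> complex"
  assumes "f holomorphic_on {s. Re s > c}" "g holomorphic_on {s. Re s > c}"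
    and "\<And>s. Re s > d \<Longrightarrow> f s = g s" and "Re z > c" "c \<le> d"
  shows "f z = g z"
proof (rule analytic_continuation_open[where s="{s. Re s > d}" and s'="{s. Re s > c}" and f=f and g=g])
  show "connected {s. c < Re s}" by (intro convex_connected convex_halfspace_Re_gt)
  show "{s. d < Re s} \<noteq> {}" by (auto intro!: exI[of _ "of_real (d + 1)"])
qed (use assms in \<open>auto intro: open_halfspace_Re_gt\<close>)

text \<open>For each j there is a continuation to Re s > 1 - j. By the identity theorem they agree
  where they overlap, so they glue to an entire function; \<open>J s\<close> selects a half-plane
  that contains s.\<close>

theorem periodic_continuation:
  fixes a :: "nat \<Rightarrow> complex"
  assumes "q > 0" "\<And>n. a (n + q) = a n" "(\<Sum>n<q. a n) = 0"
  shows "\<exists>f. f holomorphic_on UNIV \<and> (\<forall>s. Re s > 1 \<longrightarrow> (\<lambda>n. a n / of_nat (Suc n) powr s) sums f s)"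
proof -
  have "\<exists>f. \<forall>j. f j holomorphic_on {s. Re s > 1 - real j} \<and>
     (\<forall>s. Re s > 1 \<longrightarrow> (\<lambda>n. a n * powr_diff 0 s (real (Suc n))) sums f j s)"
    using periodic_strip_continuation[OF assms, of 0] by (intro choice) auto
  then obtain f where f: "\<And>j. f j holomorphic_on {s. Re s > 1 - real j}"
     "\<And>j s. Re s > 1 \<Longrightarrow> (\<lambda>n. a n * powr_diff 0 s (real (Suc n))) sums f j s" by blast
  have eq: "f i s = f j s" if "i \<le> j" "Re s > 1 - real i" for i j s
  proof (rule halfplane_eq[where f="f i" and g="f j" and z=s and c="1 - real i" and d=1])
    show "f j holomorphic_on {s. 1 - real i < Re s}"
      using f(1)[of j] by (rule holomorphic_on_subset) (use that in auto)
  qed (use f(1) sums_unique2[OF f(2) f(2)] that in auto)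
  define J where "J = (\<lambda>s. nat \<lceil>\<bar>Re s\<bar>\<rceil> + 2)"
  have J: "Re s > 1 - real (J s)" for s unfolding J_def by linarith
  define F where "F = (\<lambda>s. f (J s) s)"
  have F: "F s = f j s" if "Re s > 1 - real j" for j s
    unfolding F_def using eq[of "J s" j s] eq[of j "J s" s] J[of s] that by (metis nat_le_linear)
  have "F holomorphic_on (\<Union>j. {s. Re s > 1 - real j})"
  proof (rule holomorphic_on_UN_open)
    fix j :: nat
    show "F holomorphic_on {s. Re s > 1 - real j}"
      by (rule holomorphic_transform[OF f(1)[of j]]) (simp add: F)
  qed (rule open_halfspace_Re_gt)
  moreover have "(\<Union>j. {s. Re s > 1 - real j}) = UNIV" using J by auto
  ultimately have "F holomorphic_on UNIV" by simp
  moreover have "(\<lambda>n. a n / of_nat (Suc n) powr s) sums F s" if "Re s > 1" for s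
  proof -
    have "F s = f 0 s" using F[of 0 s] that by simp
    moreover have "a n * powr_diff 0 s (real (Suc n)) = a n / of_nat (Suc n) powr s" for n
      by (simp add: powr_diff.simps(1) powr_minus field_simps)
    ultimately show ?thesis using f(2)[OF that, of 0] by (simp only:)
  qed
  ultimately show ?thesis by blast
qed

text \<open>One summation by parts represents f for Re s > 0. For Re s \<ge> 1/2 the first
  difference is at most \<open>norm s\<close> times a power of n with exponent - 3/2, hence the
  linear growth in s and the numerical series.\<close>

lemma continuation_bound:
  fixes a :: "nat \<Rightarrow> complex"
  assumes hol: "f holomorphic_on UNIV" and f: "\<And>s. Re s > 1 \<Longrightarrow> (\<lambda>n. a n / of_nat (Suc n) powr s) sums f s"
    and a: "\<And>n. norm (\<Sum>m<n. a m) \<le> A" and s: "Re s \<ge> 1/2"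
  shows "norm (f s) \<le> A * norm s * (\<Sum>n. real (Suc n) powr (-3/2))"
proof -
  define g where "g = (\<lambda>s. \<Sum>n. (\<Sum>m<Suc n. a m) * powr_diff (Suc 0) s (real (Suc n)))"
  have "f s = g s"
  proof (rule halfplane_eq[where f=f and g=g and z=s and c=0 and d=1])
    show "g holomorphic_on {s. 0 < Re s}"
      using powr_diff_series(1)[of "\<lambda>n. \<Sum>m<Suc n. a m" A "Suc 0"] a by (simp only: g_def) simp
    show "f s = g s" if "1 < Re s" for s
    proof -
      have "(\<lambda>n. a n * powr_diff 0 s (real (Suc n))) sums g s"
        unfolding g_def by (rule powr_diff_abel[OF a]) (use that in auto)
      moreover have "a n * powr_diff 0 s (real (Suc n)) = a n / of_nat (Suc n) powr s" for n
        by (simp add: powr_diff.simps(1) powr_minus field_simps)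
      ultimately show ?thesis using sums_unique2[OF f[OF that]] by simp
    qed
  qed (use s holomorphic_on_subset[OF hol] in auto)
  also have "norm (g s) \<le> (\<Sum>n. A * norm s * real (Suc n) powr (-3/2))"
    unfolding g_def
  proof (rule norm_suminf_le)
    show "summable (\<lambda>n. A * norm s * real (Suc n) powr (- 3 / 2))"
      by (intro summable_mult summable_powr_Suc) simp
    fix n
    have "norm (powr_diff (Suc 0) s (real (Suc n))) \<le> norm s * real (Suc n) powr (- Re s - 1)"
      using norm_powr_diff_le[of "real (Suc n)" s "Suc 0"] s by simp
    also have "\<dots> \<le> norm s * real (Suc n) powr (-3/2)"
      using s by (intro mult_left_mono powr_mono) auto
    finally show "norm ((\<Sum>m<Suc n. a m) * powr_diff (Suc 0) s (real (Suc n))) \<le> A * norm s * real (Suc n) powr (-3/2)"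
      using a[of "Suc n"] by (simp only: norm_mult mult.assoc) (intro mult_mono, auto intro: order_trans[OF norm_ge_zero])
  qed
  also have "\<dots> = A * norm s * (\<Sum>n. real (Suc n) powr (-3/2))"
    by (rule suminf_mult) (rule summable_powr_Suc, simp)
  finally show ?thesis .
qed

section \<open>Perron's formula\<close>

abbreviation vline :: "real \<Rightarrow> real \<Rightarrow> real \<Rightarrow> complex" where
  "vline c T \<equiv> linepath (Complex c (- T)) (Complex c T)"

lemma path_image_vline: "T \<ge> 0 \<Longrightarrow> path_image (vline c T) = {s. Re s = c \<and> \<bar>Im s\<bar> \<le> T}"
  by (auto simp: closed_segment_same_Re closed_segment_eq_real_ivl)

text \<open>What remains after subtracting the boundary integral is the two horizontal sides, each
  of length c - a.\<close>

lemma vline_difference_le: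
  assumes f: "continuous_on (path_image (rectpath (Complex a (-T)) (Complex c T))) f"
    and ac: "a \<le> c" and T: "0 \<le> T"
    and B: "0 \<le> B" "\<And>s. \<bar>Im s\<bar> = T \<Longrightarrow> a \<le> Re s \<Longrightarrow> Re s \<le> c \<Longrightarrow> norm (f s) \<le> B"
  shows "norm (contour_integral (vline c T) f - contour_integral (vline a T) f
           - contour_integral (rectpath (Complex a (-T)) (Complex c T)) f) \<le> 2 * B * (c - a)"
proof -
  let ?a1 = "Complex a (-T)" and ?a2 = "Complex c (-T)" and ?a3 = "Complex c T" and ?a4 = "Complex a T"
  have P: "path_image (rectpath ?a1 ?a3) =
      closed_segment ?a1 ?a2 \<union> closed_segment ?a2 ?a3 \<union> closed_segment ?a3 ?a4 \<union> closed_segment ?a4 ?a1"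
    by (simp add: rectpath_def Let_def path_image_join Un_assoc)
  have int: "f contour_integrable_on linepath ?a1 ?a2" "f contour_integrable_on linepath ?a2 ?a3"
    "f contour_integrable_on linepath ?a3 ?a4" "f contour_integrable_on linepath ?a4 ?a1"
    by (auto intro!: contour_integrable_continuous_linepath continuous_on_subset[OF f] simp: P)
  have eq: "contour_integral (rectpath ?a1 ?a3) f = contour_integral (linepath ?a1 ?a2) f +
     (contour_integral (linepath ?a2 ?a3) f + (contour_integral (linepath ?a3 ?a4) f + contour_integral (linepath ?a4 ?a1) f))"
    using int by (simp add: rectpath_def Let_def)
  have rev: "contour_integral (linepath ?a4 ?a1) f = - contour_integral (vline a T) f"
    using contour_integral_reverse_linepath[of "?a1" "?a4" f] continuous_on_subset[OF f, of "closed_segment ?a1 ?a4"] P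
    by (metis (no_types, lifting) add.inverse_inverse closed_segment_commute sup_ge2)
  have 1: "norm (contour_integral (linepath ?a1 ?a2) f) \<le> B * norm (?a2 - ?a1)"
    by (rule contour_integral_bound_linepath[OF int(1) B(1)], rule B(2))
       (use ac T in \<open>auto simp: closed_segment_same_Im closed_segment_eq_real_ivl split: if_splits\<close>)
  have 2: "norm (contour_integral (linepath ?a3 ?a4) f) \<le> B * norm (?a4 - ?a3)"
    by (rule contour_integral_bound_linepath[OF int(3) B(1)], rule B(2))
       (use ac T in \<open>auto simp: closed_segment_same_Im closed_segment_eq_real_ivl split: if_splits\<close>)
  have n: "norm (?a2 - ?a1) = c - a" "norm (?a4 - ?a3) = c - a"
    using ac by (auto simp: cmod_def complex_diff)
  have "norm (contour_integral (vline c T) f - contour_integral (vline a T) f - contour_integral (rectpath ?a1 ?a3) f)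
     = norm (contour_integral (linepath ?a1 ?a2) f + contour_integral (linepath ?a3 ?a4) f)"
    unfolding eq rev by (subst norm_minus_cancel[symmetric]) (simp add: algebra_simps)
  also have "\<dots> \<le> B * (c - a) + B * (c - a)"
    using norm_triangle_le 1 2 unfolding n by (meson add_mono norm_triangle_ineq order_trans)
  finally show ?thesis by simp
qed

lemma norm_ge_abs_Im: "\<bar>Im s\<bar> \<ge> T \<Longrightarrow> norm s \<ge> T" "\<bar>Re s\<bar> \<ge> T \<Longrightarrow> norm s \<ge> T"
  using abs_Im_le_cmod abs_Re_le_cmod order_trans by blast+

lemma mult_Suc_nonzero: "Re s > 0 \<Longrightarrow> s * (s + 1) \<noteq> 0"
proof -
  assume "Re s > 0"
  then have "s \<noteq> 0" "s + 1 \<noteq> 0" by (auto simp: complex_eq_iff)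
  then show ?thesis by simp
qed

lemma perron_kernel_bound:
  fixes y :: real
  assumes "y > 0" "T > 0" "norm s \<ge> T" "norm (s + 1) \<ge> T" "y powr Re s \<le> Y"
  shows "norm (of_real y powr s / (s * (s + 1))) \<le> Y / T\<^sup>2"
proof -
  have "norm (of_real y powr s / (s * (s + 1))) = y powr Re s / (norm s * norm (s + 1))"
    using assms(1) by (simp add: norm_divide norm_mult norm_powr_real_powr)
  also have "\<dots> \<le> Y / (T * T)"
    by (rule frac_le) (use assms in \<open>auto intro!: mult_mono intro: order_trans[OF powr_ge_zero]\<close>)
  finally show ?thesis by (simp add: power2_eq_square)
qed

text \<open>For y \<ge> 1 the contour is closed to the left, around the poles 0 and -1 with residues
  1 and - 1 / y; for y < 1 it is closed to the right, where there is no pole. The quadratic decay of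
  1 / (s * (s + 1)) makes the three remaining sides O (1 / T).\<close>

lemma perron_kernel:
  fixes y c T :: real
  assumes y: "y > 0" and c: "c > 0" and T: "T \<ge> 1"
  shows "norm (contour_integral (vline c T) (\<lambda>s. of_real y powr s / (s * (s + 1)))
           - 2 * pi * \<i> * of_real (max 0 (1 - 1 / y))) \<le> (6 + 2 * c) * y powr c / T"
proof -
  define f :: "complex \<Rightarrow> complex" where "f = (\<lambda>s. of_real y powr s / (s * (s + 1)))"
  have hol: "(\<lambda>s. of_real y powr s) holomorphic_on A" for A
    using y by (auto intro!: holomorphic_intros simp: complex_nonpos_Reals_iff)
  show ?thesis
  proof (cases "y \<ge> 1")
    case True
    \<comment> \<open>Far enough to the left that both s and s + 1 have modulus at least T on the
      line Re s = a.\<close>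
    define a where "a = - T - 1"
    let ?R = "rectpath (Complex a (-T)) (Complex c T)"
    have P: "path_image ?R \<subseteq> UNIV - {0}" "path_image ?R \<subseteq> UNIV - {-1}"
      using T c by (auto simp: path_image_rectpath a_def)
    have nz: "s \<noteq> 0 \<and> s + 1 \<noteq> 0" if "s \<in> path_image ?R" for s
    proof -
      have "s \<noteq> 0" "s \<noteq> -1" using P that by auto
      moreover have "s = -1" if "s + 1 = 0" using that by (metis add_eq_0_iff2)
      ultimately show ?thesis by blast
    qed
    have box: "0 \<in> box (Complex a (-T)) (Complex c T)" "-1 \<in> box (Complex a (-T)) (Complex c T)"
      using T c by (auto simp: in_box_complex_iff a_def)
    \<comment> \<open>The partial fractions 1 / s - 1 / (s + 1) separate the two poles, so that
      Cauchy's formula applies to each.\<close>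
    have "((\<lambda>s. of_real y powr s / (s - 0)) has_contour_integral (2 * pi * \<i> * winding_number ?R 0 * of_real y powr 0)) ?R"
      by (rule Cauchy_integral_formula_convex_simple[OF convex_UNIV hol]) (use P in auto)
    moreover have "((\<lambda>s. of_real y powr s / (s - (-1))) has_contour_integral (2 * pi * \<i> * winding_number ?R (-1) * of_real y powr (-1))) ?R"
      by (rule Cauchy_integral_formula_convex_simple[OF convex_UNIV hol]) (use P in auto)
    ultimately have "((\<lambda>s. of_real y powr s / (s - 0) - of_real y powr s / (s - (-1))) has_contour_integral
        (2 * pi * \<i> * (1 - 1 / of_real y))) ?R"
      using has_contour_integral_diff winding_number_rectpath[OF box(1)] winding_number_rectpath[OF box(2)] y
      by (fastforce simp: algebra_simps powr_minus inverse_eq_divide)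
    then have "(f has_contour_integral (2 * pi * \<i> * (1 - 1 / of_real y))) ?R"
    proof (rule has_contour_integral_eq)
      fix s assume "s \<in> path_image ?R"
      then have "s \<noteq> 0" "s + 1 \<noteq> 0" by (auto dest: nz)
      then show "of_real y powr s / (s - 0) - of_real y powr s / (s - (-1)) = f s"
        by (simp add: f_def divide_simps) (simp add: algebra_simps)
    qed
    then have R: "contour_integral ?R f = 2 * pi * \<i> * of_real (max 0 (1 - 1 / y))"
      using True by (simp add: contour_integral_unique max_def)
    have cont: "continuous_on (path_image ?R) f"
      unfolding f_def by (intro continuous_intros holomorphic_on_imp_continuous_on[OF hol]) (auto dest: nz)
    have fb: "norm (f s) \<le> y powr c / T\<^sup>2" if "\<bar>Im s\<bar> \<ge> T \<or> Re s = a" "Re s \<le> c" for s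
      unfolding f_def using that y T True
      by (intro perron_kernel_bound powr_mono) (auto simp: a_def intro: norm_ge_abs_Im)
    have 1: "norm (contour_integral (vline c T) f - contour_integral (vline a T) f - contour_integral ?R f) \<le> 2 * (y powr c / T\<^sup>2) * (c - a)"
      by (rule vline_difference_le[OF cont]) (use T c fb in \<open>auto simp: a_def\<close>)
    have sub: "closed_segment (Complex a (- T)) (Complex a T) \<subseteq> path_image ?R"
      using T c by (auto simp: closed_segment_same_Re closed_segment_eq_real_ivl path_image_rectpath a_def)
    have "norm (contour_integral (vline a T) f) \<le> y powr c / T\<^sup>2 * norm (Complex a T - Complex a (-T))"
      by (rule contour_integral_bound_linepath[OF contour_integrable_continuous_linepath[OF continuous_on_subset[OF cont sub]]])
         (use fb T c in \<open>auto simp: closed_segment_same_Re a_def\<close>)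
    also have "norm (Complex a T - Complex a (-T)) = 2 * T" using T by (simp add: cmod_eq_Im complex_diff)
    finally have 2: "norm (contour_integral (vline a T) f) \<le> y powr c / T\<^sup>2 * (2 * T)" .
    have "norm (contour_integral (vline c T) f - contour_integral ?R f) \<le>
        norm (contour_integral (vline c T) f - contour_integral (vline a T) f - contour_integral ?R f) + norm (contour_integral (vline a T) f)"
      using norm_triangle_ineq[of "contour_integral (vline c T) f - contour_integral (vline a T) f - contour_integral ?R f"
        "contour_integral (vline a T) f"] by simp
    also have "\<dots> \<le> 2 * (y powr c / T\<^sup>2) * (c - a) + y powr c / T\<^sup>2 * (2 * T)" using 1 2 by simp
    also have "\<dots> = y powr c * ((4 * T + 2 * c + 2) / T\<^sup>2)" using T by (simp add: a_def field_simps)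
    also have "(4 * T + 2 * c + 2) / T\<^sup>2 \<le> (6 + 2 * c) * T / T\<^sup>2"
    proof (rule divide_right_mono)
      have "2 * c * 1 \<le> 2 * c * T" using c T by (intro mult_left_mono) auto
      then show "4 * T + 2 * c + 2 \<le> (6 + 2 * c) * T" using T by (simp add: algebra_simps)
    qed simp
    also have "(6 + 2 * c) * T / T\<^sup>2 = (6 + 2 * c) / T" using T by (simp add: power2_eq_square)
    finally have "norm (contour_integral (vline c T) f - contour_integral ?R f) \<le> y powr c * ((6 + 2 * c) / T)"
      by (simp add: mult_left_mono)
    then show ?thesis unfolding R by (simp only: f_def[symmetric]) (simp add: mult.commute)
  next
    case False
    define b where "b = c + T"
    let ?R = "rectpath (Complex c (-T)) (Complex b T)"
    have P: "path_image ?R \<subseteq> {s. Re s > 0}"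
      using T c by (auto simp: path_image_rectpath b_def)
    have holf: "f holomorphic_on {s. Re s > 0}"
      unfolding f_def by (intro holomorphic_intros hol) (use mult_Suc_nonzero in auto)
    have "(f has_contour_integral 0) ?R"
      by (rule Cauchy_theorem_convex_simple[OF holf convex_halfspace_Re_gt]) (use P in auto)
    then have R: "contour_integral ?R f = 0" by (rule contour_integral_unique)
    have cont: "continuous_on (path_image ?R) f"
      by (rule continuous_on_subset[OF holomorphic_on_imp_continuous_on[OF holf] P])
    have fb: "norm (f s) \<le> y powr c / T\<^sup>2" if "\<bar>Im s\<bar> \<ge> T \<or> Re s = b" "Re s \<ge> c" for s
      unfolding f_def using that y T False c
      by (intro perron_kernel_bound powr_mono') (auto simp: b_def intro: norm_ge_abs_Im)
    have 1: "norm (contour_integral (vline b T) f - contour_integral (vline c T) f - contour_integral ?R f) \<le> 2 * (y powr c / T\<^sup>2) * (b - c)"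
      by (rule vline_difference_le[OF cont]) (use T c fb in \<open>auto simp: b_def\<close>)
    have sub: "closed_segment (Complex b (- T)) (Complex b T) \<subseteq> path_image ?R"
      using T c by (auto simp: closed_segment_same_Re closed_segment_eq_real_ivl path_image_rectpath b_def)
    have "norm (contour_integral (vline b T) f) \<le> y powr c / T\<^sup>2 * norm (Complex b T - Complex b (-T))"
      by (rule contour_integral_bound_linepath[OF contour_integrable_continuous_linepath[OF continuous_on_subset[OF cont sub]]])
         (use fb T c in \<open>auto simp: closed_segment_same_Re b_def\<close>)
    also have "norm (Complex b T - Complex b (-T)) = 2 * T" using T by (simp add: cmod_eq_Im complex_diff)
    finally have 2: "norm (contour_integral (vline b T) f) \<le> y powr c / T\<^sup>2 * (2 * T)" .
    have "norm (contour_integral (vline c T) f) \<le>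
        norm (contour_integral (vline b T) f - contour_integral (vline c T) f - contour_integral ?R f) + norm (contour_integral (vline b T) f)"
      unfolding R using norm_triangle_ineq2[of "contour_integral (vline c T) f" "contour_integral (vline b T) f"]
      by (simp add: norm_minus_commute)
    also have "\<dots> \<le> 2 * (y powr c / T\<^sup>2) * (b - c) + y powr c / T\<^sup>2 * (2 * T)" using 1 2 by simp
    also have "\<dots> = y powr c * 4 / T" using T by (simp add: b_def field_simps power2_eq_square)
    also have "\<dots> \<le> y powr c * (6 + 2 * c) / T" using T c by (intro divide_right_mono mult_left_mono) auto
    finally show ?thesis using y False unfolding f_def by (simp add: max_def mult.commute)
  qed
qed

lemma of_real_powr_divide:
  assumes "x > 0" "m > 0"
  shows "of_real m powr (- s) * of_real x powr (s + 1) = (of_real x * of_real (x / m) powr s :: complex)"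
proof -
  have "of_real m powr (- s) = exp (- s * of_real (ln m))" "of_real x powr (s + 1) = exp ((s + 1) * of_real (ln x))"
    using assms by (simp_all add: powr_def Ln_of_real)
  then have "of_real m powr (- s) * of_real x powr (s + 1) = exp (of_real (ln x) + s * (of_real (ln x) - of_real (ln m)))"
    by (simp add: mult_exp_exp algebra_simps)
  also have "\<dots> = of_real x * exp (s * (of_real (ln x) - of_real (ln m)))"
    using assms by (simp add: exp_add exp_of_real)
  also have "exp (s * (of_real (ln x) - of_real (ln m))) = of_real (x / m) powr s"
    using assms by (simp add: powr_def Ln_of_real ln_div flip: of_real_divide)
  finally show ?thesis .
qed

lemma norm_of_real_powr: "x > 0 \<Longrightarrow> norm (of_real x powr s) = x powr Re s"
  by (simp add: norm_powr_real_powr)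

lemma norm_of_nat_Suc_powr: "norm (of_nat (Suc n) powr s :: complex) = real (Suc n) powr Re s"
  using norm_of_real_powr[of "real (Suc n)" s] by (simp del: of_nat_Suc)

lemma tendsto_of_bound_inverse:
  fixes f :: "real \<Rightarrow> complex"
  assumes "\<And>T. T \<ge> 1 \<Longrightarrow> norm (f T - l) \<le> K / T"
  shows "(f \<longlongrightarrow> l) at_top"
proof -
  have "((\<lambda>T. f T - l) \<longlongrightarrow> 0) at_top"
  proof (rule Lim_null_comparison)
    show "\<forall>\<^sub>F T in at_top. norm (f T - l) \<le> K / T"
      using eventually_ge_at_top[of 1] by eventually_elim (rule assms)
    show "((\<lambda>T. K / T) \<longlongrightarrow> 0) at_top"
      by (rule tendsto_divide_0[OF tendsto_const filterlim_at_top_imp_at_infinity[OF filterlim_ident]])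
  qed
  then show ?thesis by (simp add: LIM_zero_iff)
qed

text \<open>\<open>perron_kernel\<close> is applied to each term with y = x / n. Absolute
  convergence on Re s = c makes the errors sum to O (1 / T). The index n stands for the integer n +
  1, and the weights vanish from M on because x \<le> M.\<close>

lemma perron_limit:
  fixes a :: "nat \<Rightarrow> complex" and A :: "complex \<Rightarrow> complex" and c x :: real
  assumes c: "c > 0" and x: "x > 0"
    and summ: "summable (\<lambda>n. norm (a n) * real (Suc n) powr (- c))"
    and A: "\<And>s. Re s = c \<Longrightarrow> A s = (\<Sum>n. a n * of_nat (Suc n) powr (- s))"
    and M: "x \<le> real M"
  shows "((\<lambda>T. contour_integral (vline c T) (\<lambda>s. A s * of_real x powr (s + 1) / (s * (s + 1))))
            \<longlongrightarrow> 2 * pi * \<i> * (\<Sum>n<M. a n * of_real (max 0 (x - real (Suc n))))) at_top"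
proof -
  define k where "k = (\<lambda>n s. of_real (x / real (Suc n)) powr s / (s * (s + 1)) :: complex)"
  define f where "f = (\<lambda>n s. a n * of_real x * k n s)"
  define e where "e = (\<lambda>n. norm (a n) * x * (x / real (Suc n)) powr c)"
  have "e = (\<lambda>n. x powr (1 + c) * (norm (a n) * real (Suc n) powr (- c)))"
    using x by (auto simp: e_def powr_divide powr_add powr_minus field_simps fun_eq_iff)
  then have se: "summable e" using summable_mult[OF summ, of "x powr (1 + c)"] by simp
  have e0: "e n \<ge> 0" for n using x by (simp add: e_def)
  have f_eq: "a n * of_nat (Suc n) powr (- s) * of_real x powr (s + 1) / (s * (s + 1)) = f n s" for n s
    using of_real_powr_divide[OF x, of "real (Suc n)" s] unfolding f_def k_def
    by (simp add: mult.assoc del: of_nat_Suc)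
  define l where "l = (\<lambda>n. a n * of_real (max 0 (x - real (Suc n))))"
  have bound: "norm (contour_integral (vline c T) (\<lambda>s. A s * of_real x powr (s + 1) / (s * (s + 1)))
      - 2 * pi * \<i> * (\<Sum>n<M. l n)) \<le> ((6 + 2 * c) * suminf e) / T" if T: "T \<ge> 1" for T
  proof -
    have P: "path_image (vline c T) = {s. Re s = c \<and> \<bar>Im s\<bar> \<le> T}"
      using T by (intro path_image_vline) simp
    have nz: "s * (s + 1) \<noteq> 0" if "Re s = c" for s using mult_Suc_nonzero c that by simp
    have cont: "continuous_on (path_image (vline c T)) (k n)" for n
      unfolding P k_def using x nz by (intro continuous_intros) (auto simp: complex_nonpos_Reals_iff simp del: of_nat_Suc)
    then have kint: "k n contour_integrable_on vline c T" for n
      by (intro contour_integrable_continuous_linepath) simp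
    then have fint: "f n contour_integrable_on vline c T" for n
      unfolding f_def by (intro contour_integrable_lmul)
    have CIf: "contour_integral (vline c T) (f n) = a n * of_real x * contour_integral (vline c T) (k n)" for n
      unfolding f_def by (rule contour_integral_lmul[OF kint])
    have 1: "norm (contour_integral (vline c T) (f n) - 2 * pi * \<i> * l n) \<le> (6 + 2 * c) / T * e n" for n
    proof -
      have "x * max 0 (1 - 1 / (x / real (Suc n))) = max 0 (x - real (Suc n))"
        using x by (simp add: max_def field_simps)
      then have "l n = a n * of_real x * of_real (max 0 (1 - 1 / (x / real (Suc n))))"
        unfolding l_def by (metis mult.assoc of_real_mult)
      then have "contour_integral (vline c T) (f n) - 2 * pi * \<i> * l n = a n * of_real x *
         (contour_integral (vline c T) (k n) - 2 * pi * \<i> * of_real (max 0 (1 - 1 / (x / real (Suc n)))))"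
        unfolding CIf by (simp only: ring_distribs mult.assoc mult.left_commute)
      then have "norm (contour_integral (vline c T) (f n) - 2 * pi * \<i> * l n) = norm (a n) * x *
         norm (contour_integral (vline c T) (k n) - 2 * pi * \<i> * of_real (max 0 (1 - 1 / (x / real (Suc n)))))"
        using x by (simp only: norm_mult norm_of_real)
      also have "\<dots> \<le> norm (a n) * x * ((6 + 2 * c) * (x / real (Suc n)) powr c / T)"
        unfolding k_def using x c T by (intro mult_left_mono perron_kernel) auto
      finally show ?thesis by (simp add: e_def algebra_simps)
    qed
    have ul: "uniform_limit (path_image (vline c T)) (\<lambda>m s. \<Sum>n<m. f n s) (\<lambda>s. \<Sum>n. f n s) sequentially"
    proof (rule Weierstrass_m_test)
      show "summable (\<lambda>n. e n / c\<^sup>2)" using se by (rule summable_divide)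
      fix n s assume "s \<in> path_image (vline c T)"
      then have s: "Re s = c" using P by simp
      have "norm (k n s) \<le> (x / real (Suc n)) powr c / c\<^sup>2"
        unfolding k_def using x c s by (intro perron_kernel_bound) (auto intro!: norm_ge_abs_Im(2))
      then have "norm (a n) * x * norm (k n s) \<le> norm (a n) * x * ((x / real (Suc n)) powr c / c\<^sup>2)"
        using x by (intro mult_left_mono) auto
      then show "norm (f n s) \<le> e n / c\<^sup>2" using x by (simp add: f_def e_def norm_mult)
    qed
    have CIsum: "contour_integral (vline c T) (\<lambda>s. \<Sum>n<m. f n s) = (\<Sum>n<m. contour_integral (vline c T) (f n))" for m
      by (rule contour_integral_sum) (use fint in auto)
    have "(\<lambda>m. contour_integral (vline c T) (\<lambda>s. \<Sum>n<m. f n s)) \<longlonglongrightarrow> contour_integral (vline c T) (\<lambda>s. \<Sum>n. f n s)"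
    proof (rule contour_integral_uniform_limit(2)[OF _ ul])
      show "\<forall>\<^sub>F m in sequentially. (\<lambda>s. \<Sum>n<m. f n s) contour_integrable_on vline c T"
        by (intro always_eventually allI contour_integrable_sum) (use fint in auto)
    qed (auto simp: vector_derivative_linepath_at)
    moreover have "contour_integral (vline c T) (\<lambda>s. \<Sum>n. f n s) =
        contour_integral (vline c T) (\<lambda>s. A s * of_real x powr (s + 1) / (s * (s + 1)))"
    proof (rule contour_integral_eq)
      fix s assume s: "s \<in> path_image (vline c T)"
      then have s: "Re s = c" using P by simp
      have "summable (\<lambda>n. norm (a n * of_nat (Suc n) powr (- s)))"
        using summ s by (simp add: norm_mult norm_of_nat_Suc_powr del: of_nat_Suc)
      then have "summable (\<lambda>n. a n * of_nat (Suc n) powr (- s))" by (rule summable_norm_cancel)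
      from suminf_mult2[OF this, of "of_real x powr (s + 1) / (s * (s + 1))"]
      show "(\<Sum>n. f n s) = A s * of_real x powr (s + 1) / (s * (s + 1))"
        unfolding A[OF s] f_eq[symmetric] by (simp del: of_nat_Suc)
    qed
    ultimately have lim: "(\<lambda>m. \<Sum>n<m. contour_integral (vline c T) (f n)) \<longlonglongrightarrow>
       contour_integral (vline c T) (\<lambda>s. A s * of_real x powr (s + 1) / (s * (s + 1)))"
      unfolding CIsum by simp
    have "norm (contour_integral (vline c T) (\<lambda>s. A s * of_real x powr (s + 1) / (s * (s + 1))) - 2 * pi * \<i> * (\<Sum>n<M. l n))
       \<le> (6 + 2 * c) / T * suminf e"
    proof (rule tendsto_upperbound[OF tendsto_norm[OF tendsto_diff[OF lim tendsto_const]]])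
      show "\<forall>\<^sub>F m in sequentially. norm ((\<Sum>n<m. contour_integral (vline c T) (f n)) - 2 * pi * \<i> * (\<Sum>n<M. l n)) \<le> (6 + 2 * c) / T * suminf e"
        using eventually_ge_at_top[of M]
      proof eventually_elim
        case (elim m)
        have "(\<Sum>n<M. l n) = (\<Sum>n<m. l n)"
          by (rule sum.mono_neutral_left) (use elim M in \<open>auto simp: l_def max_def\<close>)
        then have "norm ((\<Sum>n<m. contour_integral (vline c T) (f n)) - 2 * pi * \<i> * (\<Sum>n<M. l n))
           = norm (\<Sum>n<m. contour_integral (vline c T) (f n) - 2 * pi * \<i> * l n)"
          by (simp only: sum_subtractf sum_distrib_left)
        also have "\<dots> \<le> (\<Sum>n<m. (6 + 2 * c) / T * e n)" by (rule sum_norm_le) (rule 1)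
        also have "\<dots> = (6 + 2 * c) / T * (\<Sum>n<m. e n)" by (rule sum_distrib_left[symmetric])
        also have "\<dots> \<le> (6 + 2 * c) / T * suminf e"
          using c T e0 by (intro mult_left_mono sum_le_suminf se) auto
        finally show ?case .
      qed
    qed simp
    then show ?thesis by simp
  qed
  then show ?thesis unfolding l_def by (rule tendsto_of_bound_inverse)
qed

text \<open>The kernel of the difference of the smoothed sums of a n * (x - n) at x + 1 and at x: for integral x
  this is the sharp sum over n \<le> x, and the kernel is still absolutely integrable.\<close>

definition perron_K :: "real \<Rightarrow> complex \<Rightarrow> complex" where
  "perron_K x s = (of_real (x + 1) powr (s + 1) - of_real x powr (s + 1)) / (s * (s + 1))"

lemma powr_step_le:
  fixes x :: real
  assumes x: "x > 0" and s: "Re s \<ge> 0"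
  shows "norm (of_real (x + 1) powr (s + 1) - of_real x powr (s + 1)) \<le> norm (s + 1) * (x + 1) powr Re s"
proof -
  have "norm (of_real (x + 1) powr (s + 1) - of_real x powr (s + 1)) \<le> (norm (s + 1) * (x + 1) powr Re s) * norm (x + 1 - x)"
  proof (rule differentiable_bound[of "{x..x+1}" _ "\<lambda>y h. h *\<^sub>R ((s + 1) * of_real y powr s)"])
    fix y assume y: "y \<in> {x..x+1}"
    then have "y > 0" using x by simp
    then have "((\<lambda>z. z powr (s + 1)) has_field_derivative ((s + 1) * of_real y powr (s + 1 - 1))) (at (of_real y))"
      by (intro has_field_derivative_powr) (auto simp: complex_nonpos_Reals_iff)
    from has_vector_derivative_real_field[OF this]
    show "((\<lambda>y. of_real y powr (s + 1)) has_derivative (\<lambda>h. h *\<^sub>R ((s + 1) * of_real y powr s))) (at y within {x..x+1})"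
      by (simp add: has_vector_derivative_def)
    show "onorm (\<lambda>h. h *\<^sub>R ((s + 1) * of_real y powr s)) \<le> norm (s + 1) * (x + 1) powr Re s"
    proof (rule onorm_bound)
      fix h
      have "norm ((s + 1) * of_real y powr s) \<le> norm (s + 1) * (x + 1) powr Re s"
        unfolding norm_mult norm_of_real_powr[OF \<open>y > 0\<close>] using y \<open>y > 0\<close> s by (intro mult_left_mono powr_mono2) auto
      then show "norm (h *\<^sub>R ((s + 1) * of_real y powr s)) \<le> norm (s + 1) * (x + 1) powr Re s * norm h"
        unfolding norm_scaleR real_norm_def mult.commute[of _ "\<bar>h\<bar>"] by (rule mult_left_mono) simp
    qed simp
  qed auto
  then show ?thesis by simp
qed

text \<open>The mean value inequality gives a bound of order x powr (Re s) / |s|, the triangle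
  inequality one of order x powr (Re s + 1) / |s| ^ 2. They cross at |s| = x + 1. Interpolating
  between them costs x powr e and buys the integrable decay |s| powr (- 1 - e).\<close>

lemma norm_perron_K_le:
  assumes x: "x > 0" and s: "Re s > 0" and e: "0 \<le> e" "e \<le> 1"
  shows "norm (perron_K x s) \<le> 2 * (x + 1) powr (Re s + e) * norm s powr (- 1 - e)"
proof -
  have nz: "s \<noteq> 0" "s + 1 \<noteq> 0" using mult_Suc_nonzero[OF s] by auto
  then have ns: "norm s > 0" "norm (s + 1) > 0" by auto
  have s1: "norm s \<le> norm (s + 1)"
    using s unfolding cmod_def by (intro real_sqrt_le_mono) (simp add: power2_eq_square algebra_simps)
  let ?D = "norm (of_real (x + 1) powr (s + 1) - of_real x powr (s + 1))"
  have K: "norm (perron_K x s) = ?D / (norm s * norm (s + 1))" by (simp add: perron_K_def norm_divide norm_mult)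
  show ?thesis
  proof (cases "norm s \<le> x + 1")
    case True
    have "norm (perron_K x s) \<le> norm (s + 1) * (x + 1) powr Re s / (norm s * norm (s + 1))"
      unfolding K using powr_step_le[OF x] s ns by (intro divide_right_mono) auto
    also have "\<dots> = (x + 1) powr Re s * norm s powr (-1)" using ns by (simp add: powr_minus field_simps)
    also have "\<dots> = (x + 1) powr Re s * (norm s powr e * norm s powr (- 1 - e))"
      using ns by (simp flip: powr_add)
    also have "\<dots> \<le> (x + 1) powr Re s * ((x + 1) powr e * norm s powr (- 1 - e))"
      using True e x by (intro mult_left_mono mult_right_mono powr_mono2) auto
    also have "\<dots> = 1 * ((x + 1) powr (Re s + e) * norm s powr (- 1 - e))" by (simp add: powr_add)
    also have "\<dots> \<le> 2 * ((x + 1) powr (Re s + e) * norm s powr (- 1 - e))"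
      by (rule mult_right_mono) auto
    finally show ?thesis by (simp add: mult.assoc)
  next
    case False
    have "?D \<le> norm (of_real (x + 1) powr (s + 1)) + norm (of_real x powr (s + 1))"
      by (rule norm_triangle_ineq4)
    also have "\<dots> = (x + 1) powr (Re s + 1) + x powr (Re s + 1)"
      using norm_of_real_powr[of "x + 1" "s + 1"] norm_of_real_powr[OF x, of "s + 1"] x by simp
    also have "\<dots> \<le> 2 * (x + 1) powr (Re s + 1)"
      using powr_mono2[of "Re s + 1" x "x + 1"] x s by simp
    finally have "norm (perron_K x s) \<le> 2 * (x + 1) powr (Re s + 1) / (norm s * norm s)"
      unfolding K using ns s1 by (intro frac_le mult_left_mono) auto
    also have "\<dots> = 2 * ((x + 1) powr (Re s + e) * (x + 1) powr (1 - e)) * norm s powr (- 2)"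
      using ns by (simp add: powr_minus powr_numeral power2_eq_square divide_inverse flip: powr_add)
    also have "\<dots> \<le> 2 * ((x + 1) powr (Re s + e) * norm s powr (1 - e)) * norm s powr (- 2)"
      using False e x by (intro mult_left_mono mult_right_mono powr_mono2) auto
    also have "\<dots> = 2 * (x + 1) powr (Re s + e) * (norm s powr (1 - e) * norm s powr (- 2))" by simp
    also have "norm s powr (1 - e) * norm s powr (- 2) = norm s powr (- 1 - e)" by (simp flip: powr_add)
    finally show ?thesis .
  qed
qed

section \<open>Integrals along vertical lines and the bound for sharp partial sums\<close>

lemma has_integral_line_decay:
  fixes \<sigma> d T :: real
  assumes "\<sigma> > 0" "d > 0" "T > 0"
  shows "((\<lambda>t. (\<sigma> + \<bar>t\<bar>) powr (- 1 - d)) has_integral (2 / d * (\<sigma> powr (- d) - (\<sigma> + T) powr (- d)))) {-T..T}"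
proof -
  have "((\<lambda>t. (\<sigma> + t) powr (- 1 - d)) has_integral (- ((\<sigma> + T) powr (- d) / d) - - ((\<sigma> + 0) powr (- d) / d))) {0..T}"
    using assms by (intro fundamental_theorem_of_calculus)
       (auto intro!: derivative_eq_intros simp: has_real_derivative_iff_has_vector_derivative[symmetric] powr_diff powr_minus divide_simps)
  then have 1: "((\<lambda>t. (\<sigma> + \<bar>t\<bar>) powr (- 1 - d)) has_integral (1 / d * (\<sigma> powr (- d) - (\<sigma> + T) powr (- d)))) {0..T}"
    by (rule has_integral_eq_rhs[OF has_integral_eq[rotated]]) (use assms in \<open>auto simp: field_simps\<close>)
  have "((\<lambda>t. (\<sigma> - t) powr (- 1 - d)) has_integral ((\<sigma> - 0) powr (- d) / d - (\<sigma> - (- T)) powr (- d) / d)) {-T..0}"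
    using assms by (intro fundamental_theorem_of_calculus)
       (auto intro!: derivative_eq_intros simp: has_real_derivative_iff_has_vector_derivative[symmetric] powr_diff powr_minus divide_simps)
  then have 2: "((\<lambda>t. (\<sigma> + \<bar>t\<bar>) powr (- 1 - d)) has_integral (1 / d * (\<sigma> powr (- d) - (\<sigma> + T) powr (- d)))) {-T..0}"
    by (rule has_integral_eq_rhs[OF has_integral_eq[rotated]]) (use assms in \<open>auto simp: field_simps\<close>)
  have "((\<lambda>t. (\<sigma> + \<bar>t\<bar>) powr (- 1 - d)) has_integral (1 / d * (\<sigma> powr (- d) - (\<sigma> + T) powr (- d)) + 1 / d * (\<sigma> powr (- d) - (\<sigma> + T) powr (- d)))) {-T..T}"
    by (rule has_integral_combine[OF _ _ 2 1]) (use assms in auto)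
  then show ?thesis by (simp add: algebra_simps)
qed

lemma vline_integral_bound:
  fixes \<sigma> d T B :: real
  assumes "\<sigma> > 0" "d > 0" "T > 0" "B \<ge> 0"
    and cont: "continuous_on (path_image (vline \<sigma> T)) f"
    and bnd: "\<And>s. Re s = \<sigma> \<Longrightarrow> norm (f s) \<le> B * norm s powr (- 1 - d)"
  shows "norm (contour_integral (vline \<sigma> T) f) \<le> B * (2 powr (1 + d) * (2 / d * \<sigma> powr (- d)))"
proof -
  define g where "g = (\<lambda>t. B * 2 powr (1 + d) * (\<sigma> + \<bar>t\<bar>) powr (- 1 - d))"
  have g: "(g has_integral (B * 2 powr (1 + d) * (2 / d * (\<sigma> powr (- d) - (\<sigma> + T) powr (- d))))) {-T..T}"
    unfolding g_def by (rule has_integral_mult_right[OF has_integral_line_decay]) (use assms in auto)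
  have "norm (contour_integral (vline \<sigma> T) f) = norm (integral {-T..T} (\<lambda>t. f (Complex \<sigma> t)))"
    by (subst contour_integral_linepath_same_Re[of _ \<sigma> _ "-T" T]) (use assms in \<open>auto simp: norm_mult\<close>)
  also have "\<dots> \<le> integral {-T..T} g"
  proof (rule integral_norm_bound_integral)
    have "continuous_on {-T..T} (\<lambda>t. f (Complex \<sigma> t))"
      by (rule continuous_on_compose2[OF cont])
         (use assms in \<open>auto intro!: continuous_intros simp: path_image_vline simp del: path_image_linepath\<close>)
    then show "(\<lambda>t. f (Complex \<sigma> t)) integrable_on {-T..T}" by (rule integrable_continuous_real)
    show "g integrable_on {-T..T}" using g by blast
    fix t
    \<comment> \<open>|Re s| + |Im s| \<le> 2 |s| replaces the modulus by an explicitly integrable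
      function; this is the origin of the factor 2 powr (1 + d).\<close>
    have "\<sigma> + \<bar>t\<bar> \<le> 2 * norm (Complex \<sigma> t)"
      using abs_Re_le_cmod[of "Complex \<sigma> t"] abs_Im_le_cmod[of "Complex \<sigma> t"] assms(1) by simp
    then have "norm (Complex \<sigma> t) powr (- 1 - d) \<le> ((\<sigma> + \<bar>t\<bar>) / 2) powr (- 1 - d)"
      using assms(1,2) by (intro powr_mono2') auto
    also have "\<dots> = 2 powr (1 + d) * (\<sigma> + \<bar>t\<bar>) powr (- 1 - d)"
      using assms(1) by (simp add: powr_divide powr_minus powr_add powr_diff field_simps)
    finally have "B * norm (Complex \<sigma> t) powr (- 1 - d) \<le> g t"
      unfolding g_def mult.assoc using assms(4) by (rule mult_left_mono)
    then show "norm (f (Complex \<sigma> t)) \<le> g t" using bnd[of "Complex \<sigma> t"] by simp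
  qed
  also have "\<dots> = B * 2 powr (1 + d) * (2 / d * (\<sigma> powr (- d) - (\<sigma> + T) powr (- d)))"
    using g by (rule integral_unique)
  also have "\<dots> \<le> B * 2 powr (1 + d) * (2 / d * \<sigma> powr (- d))"
    using assms by (intro mult_left_mono) auto
  finally show ?thesis by (simp add: mult.assoc)
qed

text \<open>The first factor replaces 1 + |s| by |s| for Re s \<ge> \<sigma>; the rest is the
  constant of \<open>vline_integral_bound\<close> with d = e / 2.\<close>

definition perron_const :: "real \<Rightarrow> real \<Rightarrow> real" where
  "perron_const \<sigma> e = (1 + 1 / \<sigma>) powr (e / 2) * (2 powr (1 + e / 2) * (4 / e * \<sigma> powr (- (e / 2))))"

lemma perron_const_nonneg: "e > 0 \<Longrightarrow> perron_const \<sigma> e \<ge> 0"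
  by (simp add: perron_const_def)

text \<open>The line of integration moves from c to \<sigma>. The exponent e is split in two: A may
  grow like |s| powr (e / 2) while the kernel decays like |s| powr (- 1 - e). Their product is still
  integrable along the line and vanishes on the horizontal sides as T grows. The price is the factor
  (N + 1) powr e. The case c = \<sigma> is allowed and serves for Dirichlet polynomials.\<close>

lemma perron_bound:
  fixes a :: "nat \<Rightarrow> complex" and A :: "complex \<Rightarrow> complex" and \<sigma>0 \<sigma> c e B :: real
  assumes \<sigma>: "0 < \<sigma>" "\<sigma> \<le> c" "\<sigma>0 < \<sigma>" and e: "0 < e" "e \<le> 1" and B: "B \<ge> 0"
    and summ: "summable (\<lambda>n. norm (a n) * real (Suc n) powr (- c))"
    and A: "\<And>s. Re s = c \<Longrightarrow> A s = (\<Sum>n. a n * of_nat (Suc n) powr (- s))"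
    and hol: "A holomorphic_on {s. Re s > \<sigma>0}"
    and bnd: "\<And>s. \<sigma> \<le> Re s \<Longrightarrow> Re s \<le> c \<Longrightarrow> norm (A s) \<le> B * (1 + norm s) powr (e / 2)"
    and N: "N \<ge> 1"
  shows "norm (\<Sum>n<N. a n) \<le> perron_const \<sigma> e * B * (real N + 1) powr (\<sigma> + e)"
proof -
  define f where "f = (\<lambda>s. A s * perron_K (real N) s)"
  define h where "h = (\<lambda>x s. A s * of_real x powr (s + 1) / (s * (s + 1)))"
  define U where "U = {s. Re s > max 0 \<sigma>0}"
  have U: "convex U" unfolding U_def by (rule convex_halfspace_Re_gt)
  have holh: "h x holomorphic_on U" if "x > 0" for x
    unfolding h_def U_def using that mult_Suc_nonzero
    by (intro holomorphic_intros holomorphic_on_subset[OF hol]) (auto simp: complex_nonpos_Reals_iff)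
  have f_eq: "f s = h (real N + 1) s - h (real N) s" for s
    unfolding f_def h_def perron_K_def by (simp add: diff_divide_distrib right_diff_distrib)
  then have f_eq': "f = (\<lambda>s. h (real N + 1) s - h (real N) s)" by auto
  have holf: "f holomorphic_on U" unfolding f_eq' using holh N by (intro holomorphic_intros) auto
  define Q where "Q = (\<lambda>b. 2 * B * (1 + 1 / \<sigma>) powr (e / 2) * (real N + 1) powr (b + e))"
  have Q0: "Q b \<ge> 0" for b using B by (simp add: Q_def)
  have fb: "norm (f s) \<le> Q b * norm s powr (- 1 - e / 2)" if s: "\<sigma> \<le> Re s" "Re s \<le> c" "Re s \<le> b" for s b
  proof -
    have ns: "\<sigma> \<le> norm s" using s(1) complex_Re_le_cmod order_trans by blast
    then have "1 + norm s \<le> (1 + 1 / \<sigma>) * norm s" using \<sigma>(1) by (simp add: field_simps)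
    then have "(1 + norm s) powr (e / 2) \<le> ((1 + 1 / \<sigma>) * norm s) powr (e / 2)"
      using e by (intro powr_mono2) auto
    also have "\<dots> = (1 + 1 / \<sigma>) powr (e / 2) * norm s powr (e / 2)" using \<sigma>(1) by (simp add: powr_mult)
    finally have 1: "norm (A s) \<le> B * ((1 + 1 / \<sigma>) powr (e / 2) * norm s powr (e / 2))"
      using bnd[OF s(1,2)] mult_left_mono[OF _ B] order_trans by blast
    have "norm (perron_K (real N) s) \<le> 2 * (real N + 1) powr (Re s + e) * norm s powr (- 1 - e)"
      by (rule norm_perron_K_le) (use N s \<sigma> e in auto)
    also have "\<dots> \<le> 2 * (real N + 1) powr (b + e) * norm s powr (- 1 - e)"
      using s by (intro mult_left_mono mult_right_mono powr_mono) auto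
    finally have "norm (f s) \<le> B * ((1 + 1 / \<sigma>) powr (e / 2) * norm s powr (e / 2)) * (2 * (real N + 1) powr (b + e) * norm s powr (- 1 - e))"
      unfolding f_def norm_mult using 1 B by (intro mult_mono) auto
    also have "\<dots> = Q b * (norm s powr (e / 2) * norm s powr (- 1 - e))" by (simp add: Q_def)
    also have "norm s powr (e / 2) * norm s powr (- 1 - e) = norm s powr (- 1 - e / 2)"
    proof -
      have "e / 2 + (- 1 - e) = - 1 - e / 2" by (simp add: field_simps)
      then show ?thesis by (metis powr_add)
    qed
    finally show ?thesis .
  qed
  have cont: "continuous_on (path_image (vline b T)) g" if "g holomorphic_on U" "\<sigma> \<le> b" "T \<ge> 0" for b T g
    by (rule continuous_on_subset[OF holomorphic_on_imp_continuous_on[OF that(1)]])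
       (use that(2,3) \<sigma> in \<open>auto simp: U_def path_image_vline simp del: path_image_linepath\<close>)
  have lim_h: "((\<lambda>T. contour_integral (vline c T) (h x)) \<longlongrightarrow> 2 * pi * \<i> * (\<Sum>n<N+1. a n * of_real (max 0 (x - real (Suc n))))) at_top"
    if "x > 0" "x \<le> real N + 1" for x
    unfolding h_def by (rule perron_limit) (use \<sigma> that summ A in auto)
  have "((\<lambda>T. contour_integral (vline c T) (h (real N + 1)) - contour_integral (vline c T) (h (real N)))
     \<longlongrightarrow> 2 * pi * \<i> * (\<Sum>n<N+1. a n * of_real (max 0 (real N + 1 - real (Suc n))))
       - 2 * pi * \<i> * (\<Sum>n<N+1. a n * of_real (max 0 (real N - real (Suc n))))) at_top"
    by (intro tendsto_diff lim_h) (use N in auto)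
  also have "2 * pi * \<i> * (\<Sum>n<N+1. a n * of_real (max 0 (real N + 1 - real (Suc n))))
       - 2 * pi * \<i> * (\<Sum>n<N+1. a n * of_real (max 0 (real N - real (Suc n))))
     = 2 * pi * \<i> * (\<Sum>n<N+1. a n * (of_real (max 0 (real N + 1 - real (Suc n))) - of_real (max 0 (real N - real (Suc n)))))"
    by (simp only: right_diff_distrib sum_subtractf)
  \<comment> \<open>The difference of the two weights is 1 for n < N and 0 for n = N, that is, the
    sharp cutoff at the integer N.\<close>
  also have "(\<Sum>n<N+1. a n * (of_real (max 0 (real N + 1 - real (Suc n))) - of_real (max 0 (real N - real (Suc n))))) = (\<Sum>n<N. a n)"
    by (rule sum.mono_neutral_cong_right) (auto simp: max_def)
  finally have "((\<lambda>T. contour_integral (vline c T) (h (real N + 1)) - contour_integral (vline c T) (h (real N)))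
     \<longlongrightarrow> 2 * pi * \<i> * (\<Sum>n<N. a n)) at_top" .
  moreover have "\<forall>\<^sub>F T in at_top. contour_integral (vline c T) (h (real N + 1)) - contour_integral (vline c T) (h (real N))
      = contour_integral (vline c T) f"
    using eventually_ge_at_top[of 0]
  proof eventually_elim
    case (elim T)
    have "h x contour_integrable_on vline c T" if "x > 0" for x
      using cont[OF holh[OF that] \<sigma>(2) elim] by (intro contour_integrable_continuous_linepath) simp
    then show ?case unfolding f_eq' using N by (simp add: contour_integral_diff)
  qed
  ultimately have lim: "((\<lambda>T. contour_integral (vline c T) f) \<longlongrightarrow> 2 * pi * \<i> * (\<Sum>n<N. a n)) at_top"
    by (rule Lim_transform_eventually)
  define C where "C = 2 powr (1 + e / 2) * (2 / (e / 2) * \<sigma> powr (- (e / 2)))"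
  have "norm (2 * pi * \<i> * (\<Sum>n<N. a n)) \<le> Q \<sigma> * C + 0"
  proof (rule tendsto_le[OF trivial_limit_at_top_linorder _ tendsto_norm[OF lim]])
    show "((\<lambda>T. Q \<sigma> * C + 2 * (Q c * T powr (- 1 - e / 2)) * (c - \<sigma>)) \<longlongrightarrow> Q \<sigma> * C + 0) at_top"
      using e by (intro tendsto_add tendsto_const tendsto_mult_left_zero tendsto_mult_right_zero tendsto_neg_powr filterlim_ident) auto
    show "\<forall>\<^sub>F T in at_top. norm (contour_integral (vline c T) f) \<le> Q \<sigma> * C + 2 * (Q c * T powr (- 1 - e / 2)) * (c - \<sigma>)"
      using eventually_ge_at_top[of 1]
    proof eventually_elim
      case (elim T)
      let ?R = "rectpath (Complex \<sigma> (-T)) (Complex c T)"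
      have P: "path_image ?R \<subseteq> U" using \<sigma> elim by (auto simp: path_image_rectpath U_def)
      have "(f has_contour_integral 0) ?R"
        by (rule Cauchy_theorem_convex_simple[OF holf U]) (use P in auto)
      then have R: "contour_integral ?R f = 0" by (rule contour_integral_unique)
      have "norm (contour_integral (vline c T) f - contour_integral (vline \<sigma> T) f - contour_integral ?R f)
          \<le> 2 * (Q c * T powr (- 1 - e / 2)) * (c - \<sigma>)"
      proof (rule vline_difference_le[OF continuous_on_subset[OF holomorphic_on_imp_continuous_on[OF holf] P]])
        fix s assume s: "\<bar>Im s\<bar> = T" "\<sigma> \<le> Re s" "Re s \<le> c"
        have "norm (f s) \<le> Q c * norm s powr (- 1 - e / 2)" using fb s by simp
        also have "\<dots> \<le> Q c * T powr (- 1 - e / 2)"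
          using s abs_Im_le_cmod[of s] elim e Q0 by (intro mult_left_mono powr_mono2') auto
        finally show "norm (f s) \<le> Q c * T powr (- 1 - e / 2)" .
      qed (use \<sigma> elim Q0 in auto)
      moreover have "norm (contour_integral (vline \<sigma> T) f) \<le> Q \<sigma> * C"
        unfolding C_def by (rule vline_integral_bound) (use \<sigma> e elim Q0 fb cont[OF holf] in auto)
      ultimately show ?case
        using norm_triangle_ineq2[of "contour_integral (vline c T) f" "contour_integral (vline \<sigma> T) f"] R by simp
    qed
  qed
  then have "2 * pi * norm (\<Sum>n<N. a n) \<le> Q \<sigma> * C" by (simp add: norm_mult)
  moreover have "2 * norm (\<Sum>n<N. a n) \<le> 2 * pi * norm (\<Sum>n<N. a n)"
    using pi_gt3 by (intro mult_right_mono) auto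
  ultimately have "norm (\<Sum>n<N. a n) \<le> Q \<sigma> * C / 2" by simp
  also have "\<dots> = perron_const \<sigma> e * B * (real N + 1) powr (\<sigma> + e)"
    by (simp add: Q_def C_def perron_const_def)
  finally show ?thesis .
qed

section \<open>Euler products\<close>

definition avoid :: "nat set \<Rightarrow> nat set" where
  "avoid Q = {n. n \<ge> 1 \<and> (\<forall>q\<in>Q. \<not> q dvd n)}"

lemma infsum_multiples:
  fixes f :: "nat \<Rightarrow> complex"
  assumes mult: "\<And>m n. f (m * n) = f m * f n" and p: "p > 0"
  shows "infsum f ((*) p ` A) = f p * infsum f A"
proof -
  have "inj_on ((*) p) A" using p by (auto intro: inj_onI)
  then have "infsum f ((*) p ` A) = infsum (\<lambda>n. f p * f n) A"
    by (subst infsum_reindex) (auto simp: o_def mult)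
  also have "\<dots> = f p * infsum f A" by (rule infsum_cmult_right')
  finally show ?thesis .
qed

text \<open>Admitting one more prime p to Q removes from \<open>avoid Q\<close> exactly p times
  \<open>avoid Q\<close> itself, and by complete multiplicativity the removed part sums to f p times
  the old sum.\<close>

lemma infsum_avoid:
  fixes f :: "nat \<Rightarrow> complex"
  assumes mult: "\<And>m n. f (m * n) = f m * f n" and summ: "f summable_on {1..}"
    and Q: "finite Q" "\<And>q. q \<in> Q \<Longrightarrow> prime q"
  shows "infsum f (avoid Q) = (\<Prod>q\<in>Q. 1 - f q) * infsum f {1..}"
  using Q
proof (induction Q rule: finite_induct)
  case empty
  have "avoid {} = {1..}" by (auto simp: avoid_def)
  then show ?case by simp
next
  case (insert p Q)
  have p: "prime p" using insert.prems by simp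
  have summ': "f summable_on A" if "A \<subseteq> avoid Q" for A
    using summ by (rule summable_on_subset_banach) (use that in \<open>auto simp: avoid_def\<close>)
  have split: "avoid Q = avoid (insert p Q) \<union> (*) p ` avoid Q"
  proof (intro equalityI subsetI)
    fix n assume n: "n \<in> avoid Q"
    show "n \<in> avoid (insert p Q) \<union> (*) p ` avoid Q"
    proof (cases "p dvd n")
      case True
      then obtain m where "n = p * m" by blast
      then show ?thesis using n by (auto simp: avoid_def intro!: imageI)
    qed (use n in \<open>auto simp: avoid_def\<close>)
  next
    fix n assume "n \<in> avoid (insert p Q) \<union> (*) p ` avoid Q"
    then show "n \<in> avoid Q"
    proof
      assume "n \<in> (*) p ` avoid Q"
      then obtain m where m: "n = p * m" "m \<in> avoid Q" by blast
      have "\<not> q dvd p * m" if "q \<in> Q" for q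
      proof -
        have "prime q" "q \<noteq> p" using that insert.hyps insert.prems by auto
        then have "\<not> q dvd p" using p primes_dvd_imp_eq by blast
        then show ?thesis using that m \<open>prime q\<close> by (auto simp: avoid_def prime_dvd_mult_iff)
      qed
      then show ?thesis using m prime_ge_1_nat[OF p] by (auto simp: avoid_def)
    qed (auto simp: avoid_def)
  qed
  have "infsum f (avoid Q) = infsum f (avoid (insert p Q)) + infsum f ((*) p ` avoid Q)"
  proof -
    have "avoid (insert p Q) \<inter> (*) p ` avoid Q = {}" by (auto simp: avoid_def)
    moreover have "avoid (insert p Q) \<subseteq> avoid Q" "(*) p ` avoid Q \<subseteq> avoid Q" using split by auto
    ultimately have "infsum f (avoid (insert p Q) \<union> (*) p ` avoid Q) = infsum f (avoid (insert p Q)) + infsum f ((*) p ` avoid Q)"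
      by (intro infsum_Un_disjoint summ')
    then show ?thesis by (simp only: split[symmetric])
  qed
  also have "infsum f ((*) p ` avoid Q) = f p * infsum f (avoid Q)"
    by (rule infsum_multiples[OF mult]) (use p prime_gt_0_nat in auto)
  finally have "infsum f (avoid (insert p Q)) = infsum f (avoid Q) - f p * infsum f (avoid Q)"
    by (metis add_diff_cancel_right')
  also have "\<dots> = (1 - f p) * infsum f (avoid Q)" by (simp add: left_diff_distrib)
  finally have "infsum f (avoid (insert p Q)) = (1 - f p) * infsum f (avoid Q)" .
  then show ?case using insert by simp
qed

lemma summable_on_Suc:
  fixes f :: "nat \<Rightarrow> 'a :: banach"
  assumes "summable (\<lambda>n. norm (f (Suc n)))"
  shows "f summable_on {1..}" "infsum f {1..} = (\<Sum>n. f (Suc n))"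
proof -
  have "(\<lambda>n. f (Suc n)) sums (\<Sum>n. f (Suc n))"
    by (rule summable_sums[OF summable_norm_cancel[OF assms]])
  from norm_summable_imp_has_sum[OF assms this]
  have "((\<lambda>n. f (Suc n)) has_sum (\<Sum>n. f (Suc n))) UNIV" .
  moreover have "bij_betw Suc UNIV {1..}" by (rule bij_betwI[where g="\<lambda>n. n - 1"]) auto
  ultimately have "(f has_sum (\<Sum>n. f (Suc n))) {1..}"
    using has_sum_reindex_bij_betw[of Suc UNIV "{1..}" f] by simp
  then show "f summable_on {1..}" "infsum f {1..} = (\<Sum>n. f (Suc n))"
    by (auto simp: summable_on_def infsumI)
qed

text \<open>The Euler product is obtained in logarithmic form: L times the exponential of minus the
  partial logarithm is the sum over integers without small prime factors, which tends to f 1 = 1.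
  The bound 1/2 keeps Ln (1 - f p) within a constant of f p.\<close>

lemma euler_product_log:
  fixes f :: "nat \<Rightarrow> complex"
  assumes one: "f 1 = 1" and mult: "\<And>m n. f (m * n) = f m * f n"
    and summ: "summable (\<lambda>n. norm (f (Suc n)))" and small: "\<And>p. prime p \<Longrightarrow> norm (f p) < 1/2"
  shows "(\<Sum>n. f (Suc n)) = exp (\<Sum>n. if prime (Suc n) then - Ln (1 - f (Suc n)) else 0)"
    and "summable (\<lambda>n. norm (if prime (Suc n) then - Ln (1 - f (Suc n)) else 0))"
proof -
  define e where "e = (\<lambda>n. if prime (Suc n) then - Ln (1 - f (Suc n)) else 0)"
  have "norm (e n) \<le> 2 * norm (f (Suc n))" for n
    using norm_Ln_le[of "- f (Suc n)"] small[of "Suc n"] by (auto simp: e_def)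
  then have se: "summable (\<lambda>n. norm (e n))"
    by (intro summable_comparison_test'[OF summable_mult[OF summ, of 2]]) auto
  then show "summable (\<lambda>n. norm (if prime (Suc n) then - Ln (1 - f (Suc n)) else 0))" by (simp only: e_def)
  define L where "L = infsum f {1..}"
  have fs: "f summable_on {1..}" and L: "L = (\<Sum>n. f (Suc n))"
    using summable_on_Suc[OF summ] by (simp_all add: L_def)
  have as: "(\<lambda>n. norm (f n)) summable_on {1..}" and
    ai: "infsum (\<lambda>n. norm (f n)) {1..} = (\<Sum>n. norm (f (Suc n)))"
    using summable_on_Suc[of "\<lambda>n. norm (f n)"] summ by simp_all
  define Q where "Q = (\<lambda>k::nat. {p. prime p \<and> p \<le> k})"
  have finQ: "finite (Q k)" for k by (rule finite_subset[of _ "{..k}"]) (auto simp: Q_def)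
  have prodQ: "(\<Prod>q\<in>Q k. 1 - f q) = exp (- (\<Sum>n<k. e n))" for k
  proof (induction k)
    case 0
    have "Q 0 = {}" by (auto simp: Q_def)
    then show ?case by simp
  next
    case (Suc k)
    show ?case
    proof (cases "prime (Suc k)")
      case True
      have "Q (Suc k) = insert (Suc k) (Q k)" using True by (auto simp: Q_def le_Suc_eq)
      then have "(\<Prod>q\<in>Q (Suc k). 1 - f q) = (1 - f (Suc k)) * (\<Prod>q\<in>Q k. 1 - f q)"
        using finQ by (simp add: Q_def)
      moreover have "1 - f (Suc k) \<noteq> 0" using small[OF True] by auto
      ultimately show ?thesis using True Suc by (simp add: e_def exp_diff exp_minus field_simps)
    next
      case False
      then have "Q (Suc k) = Q k" by (auto simp: Q_def le_Suc_eq)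
      then show ?thesis using False Suc by (simp add: e_def)
    qed
  qed
  have tail: "norm (exp (- (\<Sum>n<k. e n)) * L - 1) \<le> (\<Sum>n. norm (f (Suc n))) - (\<Sum>n<k. norm (f (Suc n)))" for k
  proof -
    \<comment> \<open>An integer other than 1 with no prime factor up to k exceeds k, so the
      remainder is dominated by a tail of the absolutely convergent series.\<close>
    have sub: "avoid (Q k) - {1} \<subseteq> {k<..}"
    proof
      fix n assume n: "n \<in> avoid (Q k) - {1}"
      then obtain p where p: "prime p" "p dvd n" using prime_factor_nat[of n] by auto
      have "\<not> p \<le> k" using n p by (auto simp: avoid_def Q_def)
      moreover have "p \<le> n" using p n by (auto simp: avoid_def dest: dvd_imp_le)
      ultimately show "n \<in> {k<..}" by simp
    qed
    have s1: "f summable_on avoid (Q k) - {1}" by (rule summable_on_subset_banach[OF fs]) (auto simp: avoid_def)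
    have "1 \<in> avoid (Q k)" by (auto simp: avoid_def Q_def)
    then have "avoid (Q k) = {1} \<union> (avoid (Q k) - {1})" by blast
    then have "infsum f (avoid (Q k)) = infsum f {1} + infsum f (avoid (Q k) - {1})"
      using infsum_Un_disjoint[of f "{1}" "avoid (Q k) - {1}"] s1 by (simp add: summable_on_finite)
    then have "exp (- (\<Sum>n<k. e n)) * L - 1 = infsum f (avoid (Q k) - {1})"
      using infsum_avoid[OF mult fs finQ, of k] prodQ[of k] one by (simp add: L_def Q_def algebra_simps)
    also have "norm \<dots> \<le> infsum (\<lambda>n. norm (f n)) (avoid (Q k) - {1})"
      by (rule norm_infsum_bound, rule summable_on_subset_banach[OF as]) (auto simp: avoid_def)
    also have "\<dots> \<le> infsum (\<lambda>n. norm (f n)) {k<..}"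
      by (rule infsum_mono2) (use sub in \<open>auto intro!: summable_on_subset_banach[OF as] simp: avoid_def\<close>)
    also have "\<dots> = infsum (\<lambda>n. norm (f n)) {1..} - infsum (\<lambda>n. norm (f n)) {1..k}"
    proof -
      have "{1..} = {1..k} \<union> {k<..}" by auto
      then have "infsum (\<lambda>n. norm (f n)) {1..} = infsum (\<lambda>n. norm (f n)) {1..k} + infsum (\<lambda>n. norm (f n)) {k<..}"
        by (metis (no_types, lifting) infsum_Un_disjoint summable_on_subset_banach[OF as] Un_upper1 Un_upper2 ivl_disj_int_one(6) ivl_disj_int(1)
            inf.commute disjoint_iff atLeastAtMost_iff greaterThan_iff linorder_not_less)
      then show ?thesis by simp
    qed
    also have "infsum (\<lambda>n. norm (f n)) {1..k} = (\<Sum>n<k. norm (f (Suc n)))"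
      by (simp add: sum.atLeast1_atMost_eq)
    finally show ?thesis using ai by simp
  qed
  have "(\<lambda>k. (\<Sum>n. norm (f (Suc n))) - (\<Sum>n<k. norm (f (Suc n)))) \<longlonglongrightarrow> (\<Sum>n. norm (f (Suc n))) - (\<Sum>n. norm (f (Suc n)))"
    by (intro tendsto_diff tendsto_const summable_LIMSEQ summ)
  then have "(\<lambda>k. exp (- (\<Sum>n<k. e n)) * L - 1) \<longlonglongrightarrow> 0"
    by (intro Lim_null_comparison[OF always_eventually[OF allI[OF tail]]]) simp
  then have "(\<lambda>k. exp (- (\<Sum>n<k. e n)) * L) \<longlonglongrightarrow> 1" by (simp add: LIM_zero_iff)
  moreover have "(\<lambda>k. exp (- (\<Sum>n<k. e n)) * L) \<longlonglongrightarrow> exp (- suminf e) * L"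
    by (intro tendsto_mult tendsto_exp tendsto_minus tendsto_const summable_LIMSEQ summable_norm_cancel[OF se])
  ultimately have "exp (- suminf e) * L = 1" using LIMSEQ_unique by blast
  then have "L = exp (suminf e)" by (simp add: exp_minus field_simps)
  then show "(\<Sum>n. f (Suc n)) = exp (\<Sum>n. if prime (Suc n) then - Ln (1 - f (Suc n)) else 0)"
    using L by (simp only: e_def)
qed

section \<open>Dirichlet series of completely multiplicative functions and their logarithms\<close>

lemma of_nat_powr_mult: "of_nat (m * n) powr s = (of_nat m powr s * of_nat n powr s :: complex)"
proof (cases "m = 0 \<or> n = 0")
  case False
  then have "ln (real (m * n)) = ln (real m) + ln (real n)" by (simp add: ln_mult)
  moreover have "of_nat j powr s = exp (s * of_real (ln (real j)))" if "j > 0" for j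
    using that Ln_of_real[of "real j"] by (simp add: powr_def)
  ultimately show ?thesis using False by (simp add: distrib_left exp_add del: of_nat_mult)
qed auto

text \<open>Wider than the Dirichlet characters: this class also contains their twists by n powr (-
  i t), which the proof of nonvanishing at 1 + i t uses.\<close>

definition unit_mult :: "(nat \<Rightarrow> complex) \<Rightarrow> bool" where
  "unit_mult g \<longleftrightarrow> g 1 = 1 \<and> (\<forall>m n. g (m * n) = g m * g n) \<and> (\<forall>n. norm (g n) \<le> 1)"

definition dser :: "(nat \<Rightarrow> complex) \<Rightarrow> complex \<Rightarrow> complex" where
  "dser g s = (\<Sum>n. g (Suc n) * of_nat (Suc n) powr (- s))"

definition dlog :: "(nat \<Rightarrow> complex) \<Rightarrow> complex \<Rightarrow> complex" where
  "dlog g s = (\<Sum>n. if prime (Suc n) then - Ln (1 - g (Suc n) * of_nat (Suc n) powr (- s)) else 0)"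

definition pser :: "(nat \<Rightarrow> complex) \<Rightarrow> complex \<Rightarrow> complex" where
  "pser g s = (\<Sum>n. (if prime (Suc n) then g (Suc n) else 0) * of_nat (Suc n) powr (- s))"

text \<open>The contribution of the prime powers p ^ j with j \<ge> 2 to log L. It converges
  absolutely already for Re s > 1/2, so there the continuation of log L yields that of the series
  over primes.\<close>

definition ptail :: "(nat \<Rightarrow> complex) \<Rightarrow> complex \<Rightarrow> complex" where
  "ptail g s = (\<Sum>n. if prime (Suc n) then - Ln (1 - g (Suc n) * of_nat (Suc n) powr (- s))
                        - g (Suc n) * of_nat (Suc n) powr (- s) else 0)"

lemma norm_dterm_le:
  "unit_mult g \<Longrightarrow> norm (g (Suc n) * of_nat (Suc n) powr (- s)) \<le> real (Suc n) powr (- Re s)"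
  using mult_right_mono[of "norm (g (Suc n))" 1 "real (Suc n) powr (- Re s)"]
  by (simp add: unit_mult_def norm_mult norm_of_nat_Suc_powr del: of_nat_Suc)

lemma norm_prime_term_le:
  assumes g: "unit_mult g" and p: "prime (Suc n)" and s: "Re s \<ge> \<sigma>" "\<sigma> > 0"
  shows "norm (g (Suc n) * of_nat (Suc n) powr (- s)) \<le> 2 powr (- \<sigma>)"
proof -
  have "real (Suc n) \<ge> 2" using prime_ge_2_nat[OF p] by simp
  then have "real (Suc n) powr (- Re s) \<le> 2 powr (- \<sigma>)"
    using s by (intro order_trans[OF powr_mono[of "- Re s" "- \<sigma>" "real (Suc n)"] powr_mono2']) auto
  then show ?thesis using norm_dterm_le[OF g] order_trans by blast
qed

lemma dser_summable:
  assumes "unit_mult g" "Re s > 1"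
  shows "summable (\<lambda>n. norm (g (Suc n) * of_nat (Suc n) powr (- s)))"
  by (rule summable_comparison_test'[OF summable_powr_Suc[of "- Re s"]])
     (use assms norm_dterm_le in auto)

lemma two_powr_less_half: "Re s > 1 \<Longrightarrow> 2 powr (- Re s) < 1 / 2"
  using powr_less_mono[of "- Re s" "- 1" 2] by (simp add: powr_minus)

lemma dser_eq_exp_dlog:
  assumes g: "unit_mult g" and s: "Re s > 1"
  shows "dser g s = exp (dlog g s)"
  unfolding dser_def dlog_def
proof (rule euler_product_log(1)[where f="\<lambda>n. g n * of_nat n powr (- s)"])
  show "summable (\<lambda>n. norm (g (Suc n) * of_nat (Suc n) powr (- s)))" by (rule dser_summable[OF assms])
  show "norm (g p * of_nat p powr (- s)) < 1 / 2" if "prime p" for p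
    using norm_prime_term_le[OF g, of "p - 1" "Re s" s] that two_powr_less_half[OF s] s prime_gt_0_nat[OF that]
    by simp
qed (use g of_nat_powr_mult in \<open>auto simp: unit_mult_def\<close>)

lemma Re_cball_ge: "z \<in> cball s d \<Longrightarrow> Re z \<ge> Re s - d"
  using abs_Re_le_cmod[of "s - z"] by (simp add: dist_norm)

lemma holomorphic_halfplane_suminf:
  fixes h :: "nat \<Rightarrow> complex \<Rightarrow> complex"
  assumes hol: "\<And>n. h n holomorphic_on {s. Re s > c}"
    and bnd: "\<And>\<sigma>. \<sigma> > c \<Longrightarrow> \<exists>M. summable M \<and> (\<forall>n z. Re z \<ge> \<sigma> \<longrightarrow> norm (h n z) \<le> M n)"
  shows "(\<lambda>s. \<Sum>n. h n s) holomorphic_on {s. Re s > c}"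
proof (rule holomorphic_on_suminf[OF open_halfspace_Re_gt hol])
  fix s assume s: "s \<in> {s. c < Re s}"
  define d where "d = (Re s - c) / 2"
  have d: "d > 0" "Re s - d > c" using s by (auto simp: d_def field_simps)
  obtain M where M: "summable M" "\<And>n z. Re z \<ge> Re s - d \<Longrightarrow> norm (h n z) \<le> M n" using bnd[OF d(2)] by blast
  have "cball s d \<subseteq> {s. c < Re s}" using Re_cball_ge d(2) by fastforce
  then show "\<exists>d M. 0 < d \<and> cball s d \<subseteq> {s. c < Re s} \<and> summable M \<and> (\<forall>n. \<forall>z\<in>cball s d. norm (h n z) \<le> M n)"
    using M Re_cball_ge d(1) by blast
qed

lemma norm_dlog_term_le:
  assumes g: "unit_mult g" and s: "Re s \<ge> \<sigma>" "\<sigma> > 1"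
  shows "norm (if prime (Suc n) then - Ln (1 - g (Suc n) * of_nat (Suc n) powr (- s)) else 0) \<le> 2 * real (Suc n) powr (- \<sigma>)"
proof (cases "prime (Suc n)")
  case True
  let ?z = "g (Suc n) * of_nat (Suc n) powr (- s)"
  have "norm ?z < 1/2"
    using norm_prime_term_le[OF g True, of "Re s" s] two_powr_less_half[of s] s by simp
  then have "norm (Ln (1 + - ?z)) \<le> 2 * norm ?z" using norm_Ln_le[of "- ?z"] by simp
  also have "\<dots> \<le> 2 * real (Suc n) powr (- Re s)" using norm_dterm_le[OF g] by simp
  also have "\<dots> \<le> 2 * real (Suc n) powr (- \<sigma>)" using s by (simp add: powr_mono)
  finally show ?thesis using True by simp
qed simp

lemma dterm_not_nonpos:
  assumes g: "unit_mult g" and p: "prime (Suc n)" and s: "Re s > 0"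
  shows "1 - g (Suc n) * of_nat (Suc n) powr (- s) \<notin> \<real>\<^sub>\<le>\<^sub>0"
proof -
  have "2 powr (- Re s) < (1 :: real)" using s by (simp add: powr_less_one)
  then have "norm (g (Suc n) * of_nat (Suc n) powr (- s)) < 1"
    using norm_prime_term_le[OF g p, of "Re s" s] s by simp
  then have "Re (g (Suc n) * of_nat (Suc n) powr (- s)) < 1" using complex_Re_le_cmod order_le_less_trans by blast
  then show ?thesis by (simp add: complex_nonpos_Reals_iff)
qed

lemma of_nat_powr_holomorphic [holomorphic_intros]:
  "(\<lambda>s. of_nat (Suc n) powr (- s)) holomorphic_on A"
proof -
  have "complex_of_nat (Suc n) \<noteq> 0" by (simp del: of_nat_Suc)
  then show ?thesis unfolding powr_def by (auto intro!: holomorphic_intros simp del: of_nat_Suc)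
qed

lemma dlog_term_holomorphic:
  assumes g: "unit_mult g" and A: "A \<subseteq> {s. Re s > 0}" and p: "prime (Suc n)"
  shows "(\<lambda>s. Ln (1 - g (Suc n) * of_nat (Suc n) powr (- s))) holomorphic_on A"
  by (intro holomorphic_intros) (use dterm_not_nonpos[OF g p] A in auto)

lemma dlog_holomorphic:
  assumes g: "unit_mult g" shows "dlog g holomorphic_on {s. Re s > 1}"
  unfolding dlog_def
proof (rule holomorphic_halfplane_suminf)
  fix n show "(\<lambda>s. if prime (Suc n) then - Ln (1 - g (Suc n) * of_nat (Suc n) powr (- s)) else 0) holomorphic_on {s. Re s > 1}"
    using dlog_term_holomorphic[OF g, of "{s. Re s > 1}" n, OF Collect_mono]
    by (cases "prime (Suc n)") (auto intro!: holomorphic_on_minus)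
next
  fix \<sigma> :: real assume "\<sigma> > 1"
  then show "\<exists>M. summable M \<and> (\<forall>n z. \<sigma> \<le> Re z \<longrightarrow>
       norm (if prime (Suc n) then - Ln (1 - g (Suc n) * of_nat (Suc n) powr (- z)) else 0) \<le> M n)"
    using norm_dlog_term_le[OF g, of \<sigma>]
    by (intro exI[of _ "\<lambda>n. 2 * real (Suc n) powr (- \<sigma>)"]) (auto intro!: summable_mult summable_powr_Suc simp del: of_nat_Suc)
qed

lemma norm_dlog_le:
  assumes g: "unit_mult g" and s: "Re s \<ge> 2"
  shows "norm (dlog g s) \<le> (\<Sum>n. 2 * real (Suc n) powr (- 2))"
  unfolding dlog_def
  by (rule norm_suminf_le, rule norm_dlog_term_le[OF g, of 2 s])
     (use s in \<open>auto intro!: summable_mult summable_powr_Suc simp del: of_nat_Suc\<close>)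

lemma norm_ptail_term_le:
  assumes g: "unit_mult g" and s: "Re s \<ge> \<sigma>" "\<sigma> > 1/2"
  shows "norm (if prime (Suc n) then - Ln (1 - g (Suc n) * of_nat (Suc n) powr (- s))
               - g (Suc n) * of_nat (Suc n) powr (- s) else 0) \<le> 4 * real (Suc n) powr (- 2 * \<sigma>)"
proof (cases "prime (Suc n)")
  case True
  let ?z = "g (Suc n) * of_nat (Suc n) powr (- s)"
  have "norm ?z \<le> 2 powr (- (1/2))"
    by (rule norm_prime_term_le[OF g True]) (use s in auto)
  also have "2 powr (- (1/2)) = 1 / sqrt 2" by (simp add: powr_minus powr_half_sqrt inverse_eq_divide)
  \<comment> \<open>Any bound below 1 would do; 3/4 leaves 1 - |z| \<ge> 1/4, whence the factor
    4.\<close>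
  also have "1 / sqrt 2 \<le> (3/4 :: real)"
    using real_le_rsqrt[of "4/3" 2] by (simp add: field_simps power2_eq_square)
  finally have z: "norm ?z \<le> 3/4" .
  have "norm (- Ln (1 - ?z) - ?z) = norm (Ln (1 + (- ?z)) - (- ?z))"
    by (subst norm_minus_cancel[symmetric]) (simp add: algebra_simps)
  also have "\<dots> \<le> norm ?z ^ 2 / (1 - norm ?z)" using Ln_approx_linear[of "- ?z"] z by simp
  also have "\<dots> \<le> norm ?z ^ 2 / (1/4)" using z by (intro divide_left_mono) auto
  also have "\<dots> = 4 * norm ?z ^ 2" by simp
  also have "\<dots> \<le> 4 * (real (Suc n) powr (- \<sigma>))\<^sup>2"
  proof -
    have "norm ?z \<le> real (Suc n) powr (- Re s)" by (rule norm_dterm_le[OF g])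
    also have "\<dots> \<le> real (Suc n) powr (- \<sigma>)" using s by (intro powr_mono) auto
    finally show ?thesis by (simp add: power_mono)
  qed
  also have "(real (Suc n) powr (- \<sigma>))\<^sup>2 = real (Suc n) powr (- 2 * \<sigma>)"
    by (simp add: power2_eq_square flip: powr_add)
  finally show ?thesis using True by simp
qed simp

lemma ptail_holomorphic:
  assumes g: "unit_mult g" shows "ptail g holomorphic_on {s. Re s > 1/2}"
  unfolding ptail_def
proof (rule holomorphic_halfplane_suminf)
  fix n show "(\<lambda>s. if prime (Suc n) then - Ln (1 - g (Suc n) * of_nat (Suc n) powr (- s))
      - g (Suc n) * of_nat (Suc n) powr (- s) else 0) holomorphic_on {s. Re s > 1/2}"
    using dlog_term_holomorphic[OF g, of "{s. Re s > 1/2}" n, OF Collect_mono]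
    by (cases "prime (Suc n)") (auto intro!: holomorphic_on_minus holomorphic_on_diff holomorphic_on_mult of_nat_powr_holomorphic simp del: of_nat_Suc)
next
  fix \<sigma> :: real assume "\<sigma> > 1/2"
  then show "\<exists>M. summable M \<and> (\<forall>n z. \<sigma> \<le> Re z \<longrightarrow>
       norm (if prime (Suc n) then - Ln (1 - g (Suc n) * of_nat (Suc n) powr (- z))
      - g (Suc n) * of_nat (Suc n) powr (- z) else 0) \<le> M n)"
    using norm_ptail_term_le[OF g, of \<sigma>]
    by (intro exI[of _ "\<lambda>n. 4 * real (Suc n) powr (- 2 * \<sigma>)"]) (auto intro!: summable_mult summable_powr_Suc simp del: of_nat_Suc)
qed

lemma norm_ptail_le:
  assumes g: "unit_mult g" and s: "Re s \<ge> \<sigma>" "\<sigma> > 1/2"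
  shows "norm (ptail g s) \<le> (\<Sum>n. 4 * real (Suc n) powr (- 2 * \<sigma>))"
  unfolding ptail_def
  by (rule norm_suminf_le, rule norm_ptail_term_le[OF g, of \<sigma> s])
     (use s in \<open>auto intro!: summable_mult summable_powr_Suc simp del: of_nat_Suc\<close>)

lemma dlog_eq_pser_ptail:
  assumes g: "unit_mult g" and s: "Re s > 1"
  shows "dlog g s = pser g s + ptail g s"
proof -
  have 1: "summable (\<lambda>n. (if prime (Suc n) then g (Suc n) else 0) * of_nat (Suc n) powr (- s))"
    by (rule summable_comparison_test'[OF dser_summable[OF g s]]) (auto simp: norm_mult)
  have 2: "summable (\<lambda>n. if prime (Suc n) then - Ln (1 - g (Suc n) * of_nat (Suc n) powr (- s))
               - g (Suc n) * of_nat (Suc n) powr (- s) else 0)"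
    by (rule summable_comparison_test'[OF summable_mult[OF summable_powr_Suc[of "- 2 * Re s"], of 4]])
       (use norm_ptail_term_le[OF g, of "Re s" s] s in auto)
  show ?thesis unfolding dlog_def pser_def ptail_def suminf_add[OF 1 2]
    by (rule suminf_cong) auto
qed

text \<open>Schwarz's lemma for \<open>g\<close>: the map h / (2 B - h) sends the half-plane Re h <
  B into the unit disc and fixes 0. Solving for h turns the bound on g into one on |h|.\<close>

lemma borel_caratheodory:
  assumes hol: "f holomorphic_on ball z0 R" and M: "\<And>w. w \<in> ball z0 R \<Longrightarrow> Re (f w) < M"
    and A: "norm (f z0) \<le> A" and z: "norm (z - z0) \<le> r" and r: "r < R"
  shows "norm (f z) \<le> A + 2 * (M + A) * r / (R - r)"
proof -
  have R: "R > 0" using z r norm_ge_zero[of "z - z0"] by linarith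
  have r0: "r \<ge> 0" using z norm_ge_zero order_trans by blast
  define B where "B = M + A"
  define h where "h = (\<lambda>w. f (z0 + of_real R * w) - f z0)"
  have in_ball: "z0 + of_real R * w \<in> ball z0 R" if "norm w < 1" for w
    using that R by (simp add: dist_norm norm_mult)
  have hB: "Re (h w) < B" if "norm w < 1" for w
    using M[OF in_ball[OF that]] A abs_Re_le_cmod[of "f z0"] unfolding h_def B_def by simp
  have B: "B > 0" using hB[of 0] by (simp add: h_def)
  have holh: "h holomorphic_on ball 0 1" unfolding h_def
    by (intro holomorphic_intros holomorphic_on_compose_gen[OF _ hol, unfolded o_def]) (use in_ball in auto)
  define g where "g = (\<lambda>w. h w / (of_real (2 * B) - h w))"
  have nz: "of_real (2 * B) - h w \<noteq> 0" if "norm w < 1" for w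
    using hB[OF that] B by (auto simp: complex_eq_iff)
  have "norm (g w) \<le> norm w" if w: "norm w < 1" for w
  proof (rule Schwarz_Lemma(1)[OF _ _ _ w])
    show "g holomorphic_on ball 0 1" unfolding g_def using nz by (intro holomorphic_intros holh) auto
    show "g 0 = 0" by (simp add: g_def h_def)
    fix w :: complex assume w: "norm w < 1"
    have "(Re (h w))\<^sup>2 < (2 * B - Re (h w))\<^sup>2"
    proof -
      have "(2 * B - Re (h w))\<^sup>2 - (Re (h w))\<^sup>2 = 4 * B * (B - Re (h w))" by (simp add: power2_eq_square algebra_simps)
      moreover have "4 * B * (B - Re (h w)) > 0" using B hB[OF w] by simp
      ultimately show ?thesis by simp
    qed
    then have "norm (h w) < norm (of_real (2 * B) - h w)" unfolding cmod_def by simp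
    then show "norm (g w) < 1" using nz[OF w] by (simp add: g_def norm_divide)
  qed
  moreover define w where "w = (z - z0) / of_real R"
  have nw: "norm w \<le> r / R" using z R by (simp add: w_def norm_divide divide_right_mono)
  have nw1: "norm w < 1" using nw r R by (simp add: order_le_less_trans)
  ultimately have gw: "norm (g w) \<le> r / R" using nw order_trans by blast
  have rR: "r / R < 1" using r R by simp
  have "h w = of_real (2 * B) * g w / (1 + g w)"
  proof -
    have "1 + g w \<noteq> 0" using gw rR by (metis add_eq_0_iff norm_minus_cancel norm_one not_le)
    moreover have "h w = g w * (of_real (2 * B) - h w)" using nz[OF nw1] by (simp add: g_def)
    ultimately show ?thesis by (simp add: field_simps)
  qed
  moreover have gB: "2 * B * norm (g w) \<le> 2 * B * (r / R)" using gw B by (intro mult_left_mono) auto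
  ultimately have "norm (h w) = 2 * B * norm (g w) / norm (1 + g w)" using B by (simp add: norm_mult norm_divide)
  also have "\<dots> \<le> 2 * B * (r / R) / (1 - r / R)"
  proof (rule frac_le)
    show "1 - r / R \<le> norm (1 + g w)" using norm_diff_ineq[of 1 "g w"] gw by simp
  qed (use gB B rR r0 R in auto)
  also have "\<dots> = 2 * B * r / (R - r)" using R r by (simp add: field_simps)
  finally have "norm (f z - f z0) \<le> 2 * B * r / (R - r)" using R by (simp add: h_def w_def)
  then show ?thesis using A norm_triangle_ineq2[of "f z" "f z0"] unfolding B_def by simp
qed

text \<open>A zero-free function on a half-plane has a holomorphic logarithm. For Re s > 1 it
  differs from \<open>dlog\<close> by a function u with exp u = 1, which has zero derivative and so
  is constant; that constant is subtracted.\<close>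

lemma dlog_continuation:
  assumes g: "unit_mult g" and hol: "\<Lambda> holomorphic_on {s. Re s > 1/2}"
    and eq: "\<And>s. Re s > 1 \<Longrightarrow> \<Lambda> s = dser g s" and nz: "\<And>s. Re s > 1/2 \<Longrightarrow> \<Lambda> s \<noteq> 0"
  obtains l where "l holomorphic_on {s. Re s > 1/2}" "\<And>s. Re s > 1/2 \<Longrightarrow> exp (l s) = \<Lambda> s"
    "\<And>s. Re s > 1 \<Longrightarrow> l s = dlog g s"
proof -
  have "simply_connected {s. Re s > 1/2}" by (intro convex_imp_simply_connected convex_halfspace_Re_gt)
  then obtain l0 where l0: "l0 holomorphic_on {s. Re s > 1/2}" "\<And>s. Re s > 1/2 \<Longrightarrow> \<Lambda> s = exp (l0 s)"
    using simply_connected_eq_holomorphic_log[OF open_halfspace_Re_gt, of "1/2"] hol nz by auto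
  define u where "u = (\<lambda>s. l0 s - dlog g s)"
  have holu: "u holomorphic_on {s. Re s > 1}" unfolding u_def
    by (intro holomorphic_intros dlog_holomorphic[OF g] holomorphic_on_subset[OF l0(1)]) auto
  have eu: "exp (u s) = 1" if "Re s > 1" for s
    using l0(2)[of s] eq[OF that] dser_eq_exp_dlog[OF g that] that by (simp add: u_def exp_diff)
  have "(u has_field_derivative 0) (at s)" if s: "Re s > 1" for s
  proof -
    have d: "(u has_field_derivative deriv u s) (at s)"
      by (rule holomorphic_derivI[OF holu open_halfspace_Re_gt]) (use s in auto)
    have "((\<lambda>s. exp (u s)) has_field_derivative exp (u s) * deriv u s) (at s)"
      using d by (auto intro!: derivative_eq_intros)
    moreover have "((\<lambda>s. exp (u s)) has_field_derivative 0) (at s)"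
      by (rule has_field_derivative_transform_within_open[OF DERIV_const open_halfspace_Re_gt[of 1]])
         (use s eu in auto)
    ultimately have "exp (u s) * deriv u s = 0" by (rule DERIV_unique)
    then show ?thesis using d by simp
  qed
  then have "\<exists>c. \<forall>s\<in>{s. Re s > 1}. u s = c"
    by (intro has_field_derivative_zero_constant convex_halfspace_Re_gt)
       (auto intro: has_field_derivative_at_within)
  then obtain c where c: "\<And>s. Re s > 1 \<Longrightarrow> u s = c" by auto
  have ec: "exp c = 1" using eu[of 2] c[of 2] by simp
  show ?thesis
    by (rule that[of "\<lambda>s. l0 s - c"])
       (use l0 c ec in \<open>auto intro!: holomorphic_intros simp: exp_diff u_def algebra_simps\<close>)
qed

section \<open>Nonvanishing on the line Re s = 1\<close>

text \<open>The condition is that f is completely monotone at 2, as a Dirichlet series with nonnegative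
  coefficients is.  By Taylor expansion at 2 it forces f (0) \<ge> f (2) as soon as f extends to a disc around
  2 that contains 0 (Landau's lemma).\<close>

definition cmon :: "(complex \<Rightarrow> complex) \<Rightarrow> bool" where
  "cmon f \<longleftrightarrow> f holomorphic_on ball 2 (1/2) \<and> (\<forall>j. (-1) ^ j * (deriv ^^ j) f 2 \<in> \<real>\<^sub>\<ge>\<^sub>0)"

text \<open>With l = ln n this is a single term c / n ^ s of a Dirichlet series, from which
  everything else is built by sums and limits.\<close>

lemma cmon_exponential:
  assumes "c \<ge> 0" "l \<ge> 0"
  shows "cmon (\<lambda>s. of_real c * exp (- of_real l * s))"
proof -
  have d: "(deriv ^^ j) (\<lambda>s :: complex. of_real c * exp (- of_real l * s)) = (\<lambda>s. (- of_real l) ^ j * (of_real c * exp (- of_real l * s)))" for j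
  proof (induction j)
    case (Suc j)
    have "deriv (\<lambda>s. (- of_real l) ^ j * (of_real c * exp (- of_real l * s))) s =
        (- of_real l) ^ Suc j * (of_real c * exp (- of_real l * s))" for s
      by (rule DERIV_imp_deriv) (auto intro!: derivative_eq_intros)
    then show ?case using Suc by auto
  qed simp
  have "(-1) ^ j * (deriv ^^ j) (\<lambda>s :: complex. of_real c * exp (- of_real l * s)) 2 = of_real (l ^ j * (c * exp (- l * 2)))" for j
    unfolding d by (simp add: exp_of_real[symmetric] power_mult_distrib[symmetric] mult.assoc[symmetric])
  then show ?thesis unfolding cmon_def
    using assms by (auto intro!: holomorphic_intros simp del: of_real_mult of_real_power)
qed

lemma cmon_add: "cmon f \<Longrightarrow> cmon g \<Longrightarrow> cmon (\<lambda>s. f s + g s)"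
  unfolding cmon_def by (auto intro!: holomorphic_intros simp: higher_deriv_add[of _ "ball 2 (1/2)"] distrib_left)

lemma cmon_cong:
  assumes f: "cmon f" and eq: "\<And>s. s \<in> ball 2 (1/2) \<Longrightarrow> f s = g s"
  shows "cmon g"
proof -
  have hol: "f holomorphic_on ball 2 (1/2)" "g holomorphic_on ball 2 (1/2)"
    using f holomorphic_transform[of f "ball 2 (1/2)" g] eq by (auto simp: cmon_def)
  have "(deriv ^^ j) f 2 = (deriv ^^ j) g 2" for j
    by (rule higher_deriv_transform_within_open[OF hol open_ball _ eq]) auto
  then show ?thesis using f hol(2) unfolding cmon_def by simp
qed

lemma cmon_0: "cmon (\<lambda>_. 0)"
  using cmon_exponential[of 0 0] by simp

lemma cmon_sum: "(\<And>i. i \<in> A \<Longrightarrow> cmon (f i)) \<Longrightarrow> cmon (\<lambda>s. \<Sum>i\<in>A. f i s)"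
  by (induction A rule: infinite_finite_induct) (auto intro: cmon_0 cmon_add)

lemma cmon_suminf:
  assumes f: "\<And>n. cmon (f n)" and M: "summable M" "\<And>n s. s \<in> ball 2 (1/2) \<Longrightarrow> norm (f n s) \<le> M n"
  shows "cmon (\<lambda>s. \<Sum>n. f n s)"
proof -
  define S where "S = (ball 2 (1/2) :: complex set)"
  have ul: "uniform_limit S (\<lambda>n s. \<Sum>i<n. f i s) (\<lambda>s. \<Sum>n. f n s) sequentially"
    by (rule Weierstrass_m_test[where M=M]) (use M in \<open>auto simp: S_def\<close>)
  have c: "cmon (\<lambda>s. \<Sum>i<n. f i s)" for n by (rule cmon_sum) (rule f)
  have "(\<lambda>s. \<Sum>n. f n s) holomorphic_on S"
  proof (rule holomorphic_uniform_sequence)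
    fix s assume "s \<in> S"
    then obtain d where "d > 0" "cball s d \<subseteq> S" by (metis S_def open_ball open_contains_cball)
    then show "\<exists>d>0. cball s d \<subseteq> S \<and> uniform_limit (cball s d) (\<lambda>n s. \<Sum>i<n. f i s) (\<lambda>s. \<Sum>n. f n s) sequentially"
      using uniform_limit_on_subset[OF ul] by blast
  qed (use c in \<open>auto simp: S_def cmon_def\<close>)
  moreover have "(-1) ^ j * (deriv ^^ j) (\<lambda>s. \<Sum>n. f n s) 2 \<in> \<real>\<^sub>\<ge>\<^sub>0" for j
  proof (rule closed_sequentially[OF closed_nonneg_Reals_complex])
    show "(-1) ^ j * (deriv ^^ j) (\<lambda>s. \<Sum>i<n. f i s) 2 \<in> \<real>\<^sub>\<ge>\<^sub>0" for n
      using c unfolding cmon_def by blast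
    show "(\<lambda>n. (-1) ^ j * (deriv ^^ j) (\<lambda>s. \<Sum>i<n. f i s) 2) \<longlonglongrightarrow> (-1) ^ j * (deriv ^^ j) (\<lambda>s. \<Sum>n. f n s) 2"
      by (intro tendsto_mult_left higher_deriv_complex_uniform_limit[OF ul])
         (use c in \<open>auto simp: S_def cmon_def\<close>)
  qed
  ultimately show ?thesis by (simp add: cmon_def S_def)
qed

text \<open>By F' = G' F and Leibniz' rule, each derivative of F is a combination, with binomial
  coefficients, of derivatives of G of positive order times lower derivatives of F; the signs
  multiply correctly.\<close>

lemma cmon_exp:
  assumes "cmon G"
  shows "cmon (\<lambda>s. exp (G s))"
proof -
  define S where "S = (ball 2 (1/2) :: complex set)"
  have holG: "G holomorphic_on S" and sgn: "\<And>j. (-1) ^ j * (deriv ^^ j) G 2 \<in> \<real>\<^sub>\<ge>\<^sub>0"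
    using assms by (auto simp: cmon_def S_def)
  have S: "open S" "2 \<in> S" by (auto simp: S_def)
  define F where "F = (\<lambda>s. exp (G s))"
  have holF: "F holomorphic_on S" unfolding F_def by (intro holomorphic_intros holG)
  have dF: "deriv F s = deriv G s * F s" if "s \<in> S" for s
    unfolding F_def using holomorphic_derivI[OF holG S(1) that]
    by (intro DERIV_imp_deriv) (auto intro!: derivative_eq_intros)
  have step: "(deriv ^^ Suc n) F 2 = (\<Sum>i = 0..n. of_nat (n choose i) * (deriv ^^ Suc i) G 2 * (deriv ^^ (n - i)) F 2)" for n
  proof -
    have "(deriv ^^ Suc n) F 2 = (deriv ^^ n) (deriv F) 2" by (simp add: funpow_Suc_right del: funpow.simps)
    also have "\<dots> = (deriv ^^ n) (\<lambda>s. deriv G s * F s) 2"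
      by (rule higher_deriv_transform_within_open[of _ S])
         (use holF holG S dF in \<open>auto intro!: holomorphic_intros holomorphic_deriv\<close>)
    also have "\<dots> = (\<Sum>i = 0..n. of_nat (n choose i) * (deriv ^^ i) (deriv G) 2 * (deriv ^^ (n - i)) F 2)"
      by (rule higher_deriv_mult[of _ S]) (use holF holG S in \<open>auto intro!: holomorphic_deriv\<close>)
    finally show ?thesis by (simp add: funpow_Suc_right del: funpow.simps)
  qed
  have "(-1) ^ n * (deriv ^^ n) F 2 \<in> \<real>\<^sub>\<ge>\<^sub>0" for n
  proof (induction n rule: less_induct)
    case (less n)
    show ?case
    proof (cases n)
      case 0
      have "G 2 \<in> \<real>\<^sub>\<ge>\<^sub>0" using sgn[of 0] by simp
      then have "G 2 = of_real (Re (G 2))" by (auto simp: complex_nonneg_Reals_iff complex_eq_iff)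
      then have "F 2 = of_real (exp (Re (G 2)))" unfolding F_def by (metis exp_of_real)
      then show ?thesis using 0 by (simp del: of_real_exp)
    next
      case (Suc m)
      have "(-1) ^ n * (deriv ^^ n) F 2 = (\<Sum>i = 0..m. of_nat (m choose i) *
          ((-1) ^ Suc i * (deriv ^^ Suc i) G 2) * ((-1) ^ (m - i) * (deriv ^^ (m - i)) F 2))"
        unfolding Suc step sum_distrib_left
      proof (rule sum.cong[OF refl])
        fix i assume "i \<in> {0..m}"
        then have "(-1) ^ Suc m = ((-1) ^ Suc i * (-1) ^ (m - i) :: complex)" by (simp flip: power_add)
        then show "(-1) ^ Suc m * (of_nat (m choose i) * (deriv ^^ Suc i) G 2 * (deriv ^^ (m - i)) F 2) =
          of_nat (m choose i) * ((-1) ^ Suc i * (deriv ^^ Suc i) G 2) * ((-1) ^ (m - i) * (deriv ^^ (m - i)) F 2)"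
          by (simp only: mult_ac)
      qed
      also have "\<dots> \<in> \<real>\<^sub>\<ge>\<^sub>0"
      proof -
        have *: "(\<And>i. i \<in> A \<Longrightarrow> h i \<in> \<real>\<^sub>\<ge>\<^sub>0) \<Longrightarrow> sum h A \<in> \<real>\<^sub>\<ge>\<^sub>0" for h :: "nat \<Rightarrow> complex" and A
          by (induction A rule: infinite_finite_induct) auto
        show ?thesis
          by (rule *, rule nonneg_Reals_mult_I[OF nonneg_Reals_mult_I[OF nonneg_Reals_of_nat_I sgn]], rule less)
             (use Suc in auto)
      qed
      finally show ?thesis .
    qed
  qed
  then show ?thesis using holF by (simp add: cmon_def F_def S_def)
qed

text \<open>The Taylor terms of F at 2, evaluated at 0, are all nonnegative, since the signs of (0 -
  2) ^ n match those of the derivatives, and the term of order zero is exp (G 2) \<noteq> 0. R > 2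
  puts 0 inside the disc.\<close>

lemma cmon_exp_landau:
  assumes G: "cmon G" and F: "F holomorphic_on ball 2 R" "R > 2"
    and eq: "\<And>s. s \<in> ball 2 (1/2) \<Longrightarrow> F s = exp (G s)"
  shows "F 0 \<noteq> 0"
proof
  assume F0: "F 0 = 0"
  have dF: "(deriv ^^ n) F 2 = (deriv ^^ n) (\<lambda>s. exp (G s)) 2" for n
    by (rule higher_deriv_transform_within_open[of _ "ball 2 (1/2)"])
       (use F G eq in \<open>auto intro!: holomorphic_intros holomorphic_on_subset[OF F(1)] simp: cmon_def\<close>)
  define t where "t = (\<lambda>n. (-1) ^ n * (deriv ^^ n) F 2 * of_real (2 ^ n / fact n))"
  have t: "t n \<in> \<real>\<^sub>\<ge>\<^sub>0" for n
  proof -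
    have "of_real (2 ^ n / fact n) \<in> (\<real>\<^sub>\<ge>\<^sub>0 :: complex set)" by (simp only: nonneg_Reals_of_real_iff) simp
    then show ?thesis
      using cmon_exp[OF G] unfolding t_def dF cmon_def by (meson nonneg_Reals_mult_I)
  qed
  have "(\<lambda>n. (deriv ^^ n) F 2 / fact n * (0 - 2) ^ n) sums F 0"
    by (rule holomorphic_power_series[OF F(1)]) (use F(2) in simp)
  moreover have "(deriv ^^ n) F 2 / fact n * (0 - 2) ^ n = t n" for n
    unfolding t_def by (simp add: power_minus[of 2 n])
  ultimately have "t sums 0" using F0 by simp
  then have "(\<lambda>n. Re (t n)) sums 0" using sums_Re by fastforce
  moreover have "Re (t n) \<ge> 0" for n using t[of n] by (simp add: complex_nonneg_Reals_iff)
  ultimately have "Re (t 0) \<le> 0" using sum_le_suminf[of "\<lambda>n. Re (t n)" "{0}"] by (auto simp: sums_iff)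
  then have "t 0 = 0" using t[of 0] by (auto simp: complex_nonneg_Reals_iff complex_eq_iff)
  then show False using dF[of 0] by (simp add: t_def)
qed

section \<open>Twists, conjugates and the combination with nonnegative coefficients\<close>

lemma unit_mult_dchar: "dirichlet_character k \<psi> \<Longrightarrow> unit_mult \<psi>"
  using dchar_1 dchar_mult norm_dchar_le_1 by (auto simp: unit_mult_def)

lemma unit_mult_twist:
  assumes "unit_mult g" shows "unit_mult (\<lambda>n. g n * of_nat n powr (- (\<i> * of_real t)))"
proof -
  have "norm (g n * of_nat n powr (- (\<i> * of_real t))) \<le> 1" for n
  proof (cases n)
    case (Suc m)
    then show ?thesis using norm_of_nat_Suc_powr[of m "- (\<i> * of_real t)"] assms
      by (simp add: norm_mult unit_mult_def del: of_nat_Suc)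
  qed simp
  then show ?thesis using assms unfolding unit_mult_def by (auto simp: of_nat_powr_mult simp del: of_nat_mult)
qed

lemma unit_mult_cnj: "unit_mult g \<Longrightarrow> unit_mult (\<lambda>n. cnj (g n))"
  by (auto simp: unit_mult_def)

lemma dser_twist: "dser (\<lambda>n. g n * of_nat n powr (- z)) s = dser g (s + z)"
proof -
  have "complex_of_nat (Suc n) powr (- (s + z)) = of_nat (Suc n) powr (- z) * of_nat (Suc n) powr (- s)" for n
    by (simp add: powr_def exp_add[symmetric] algebra_simps del: of_nat_Suc)
  then show ?thesis by (simp add: dser_def mult.assoc del: of_nat_Suc)
qed

lemma cnj_of_nat_powr: "cnj (of_nat n powr s) = of_nat n powr (cnj s)"
proof (cases "n = 0")
  case False
  then have "cnj (Ln (of_nat n)) = Ln (of_nat n)" using Ln_of_real[of "real n"] by simp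
  then show ?thesis using False by (simp add: powr_def exp_cnj)
qed simp

lemma dser_cnj:
  assumes g: "unit_mult g" and s: "Re s > 1"
  shows "dser (\<lambda>n. cnj (g n)) s = cnj (dser g (cnj s))"
proof -
  have "(\<lambda>n. g (Suc n) * of_nat (Suc n) powr (- cnj s)) sums dser g (cnj s)"
    unfolding dser_def by (rule summable_sums[OF summable_norm_cancel[OF dser_summable[OF g]]]) (use s in simp)
  then have "(\<lambda>n. cnj (g (Suc n) * of_nat (Suc n) powr (- cnj s))) sums cnj (dser g (cnj s))"
    by (simp only: sums_cnj)
  then show ?thesis unfolding dser_def
    by (simp add: sums_iff cnj_of_nat_powr del: of_nat_Suc)
qed

text \<open>The coefficient at p ^ m is 2 (g0 p ^ m + Re (g1 p ^ m)) / m, which is nonnegative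
  because |g1 p| = g0 p. The weight 2 on g0 is what balances g1 together with its conjugate.\<close>

lemma cmon_dlog_combination:
  assumes g0: "unit_mult g0" "\<And>n. g0 n \<in> \<real>\<^sub>\<ge>\<^sub>0" and g1: "unit_mult g1" "\<And>n. norm (g1 n) = Re (g0 n)"
  shows "cmon (\<lambda>s. 2 * dlog g0 s + dlog g1 s + dlog (\<lambda>n. cnj (g1 n)) s)"
proof -
  let ?g2 = "\<lambda>n. cnj (g1 n)"
  define e where "e = (\<lambda>g n s. if prime (Suc n) then - Ln (1 - g (Suc n) * of_nat (Suc n) powr (- s)) else (0::complex))"
  define t where "t = (\<lambda>n s. 2 * e g0 n s + e g1 n s + e ?g2 n s)"
  note U = g0(1) g1(1) unit_mult_cnj[OF g1(1)]
  have Reb: "Re s \<ge> 3/2" if "s \<in> ball 2 (1/2)" for s :: complex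
    using that abs_Re_le_cmod[of "2 - s"] by (simp add: dist_norm)
  have eb: "norm (e g n s) \<le> 2 * real (Suc n) powr (- (3/2))" if "s \<in> ball 2 (1/2)" "unit_mult g" for g n s
    unfolding e_def by (rule norm_dlog_term_le) (use that Reb in auto)
  have tb: "norm (t n s) \<le> 8 * real (Suc n) powr (- (3/2))" if s: "s \<in> ball 2 (1/2)" for n s
  proof -
    have "norm (t n s) \<le> 2 * norm (e g0 n s) + norm (e g1 n s) + norm (e ?g2 n s)"
      unfolding t_def by (intro norm_triangle_le add_mono order_refl) (auto simp: norm_mult)
    then show ?thesis using eb[OF s U(1), of n] eb[OF s U(2), of n] eb[OF s U(3), of n] by linarith
  qed
  have summ: "summable (\<lambda>n. 8 * real (Suc n) powr (- (3/2)))" by (intro summable_mult summable_powr_Suc) simp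
  have se: "summable (\<lambda>n. e g n s)" if "unit_mult g" "s \<in> ball 2 (1/2)" for g s
    by (rule summable_norm_cancel, rule summable_comparison_test'[OF summable_mult[OF summable_powr_Suc[of "- (3/2)"], of 2]])
       (use eb[OF that(2,1)] in auto)
  have cmt: "cmon (t n)" for n
  proof (cases "prime (Suc n)")
    case False
    then show ?thesis by (simp add: t_def e_def cmon_0)
  next
    case p: True
    \<comment> \<open>At m = 0 division by zero makes this 0, as in the logarithmic series, so both
      series may start at m = 0.\<close>
    define c where "c = (\<lambda>m::nat. (2 * Re (g0 (Suc n)) ^ m + 2 * Re (g1 (Suc n) ^ m)) / real m)"
    define u where "u = (\<lambda>m s. of_real (c m) * exp (- of_real (real m * ln (real (Suc n))) * s) :: complex)"
    have g0r: "g0 (Suc n) = of_real (Re (g0 (Suc n)))" "Re (g0 (Suc n)) \<ge> 0"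
      using g0(2)[of "Suc n"] by (auto simp: complex_nonneg_Reals_iff complex_eq_iff)
    have c0: "c m \<ge> 0" for m
    proof -
      have "\<bar>Re (g1 (Suc n) ^ m)\<bar> \<le> norm (g1 (Suc n)) ^ m" by (metis abs_Re_le_cmod norm_power)
      then show ?thesis unfolding c_def g1(2) by (intro divide_nonneg_nonneg) auto
    qed
    have cu: "cmon (u m)" for m unfolding u_def using c0 by (intro cmon_exponential) auto
    have z_pow: "(of_nat (Suc n) powr (- s)) ^ m = exp (- of_real (real m * ln (real (Suc n))) * s)" for s :: complex and m
    proof -
      have "of_nat (Suc n) powr (- s) = exp (- s * of_real (ln (real (Suc n))))"
        using Ln_of_real[of "real (Suc n)"] by (simp add: powr_def del: of_nat_Suc)
      then have "(of_nat (Suc n) powr (- s)) ^ m = exp (of_nat m * (- s * of_real (ln (real (Suc n)))))"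
        by (simp only: exp_of_nat_mult)
      then show ?thesis by (simp add: mult_ac del: of_nat_Suc)
    qed
    have sums: "(\<lambda>m. u m s) sums t n s" if s: "s \<in> ball 2 (1/2)" for s
    proof -
      let ?z = "of_nat (Suc n) powr (- s)"
      have "(\<lambda>m. (g (Suc n) * ?z) ^ m / of_nat m) sums e g n s" if "unit_mult g" for g
      proof -
        have "norm (g (Suc n) * ?z) \<le> 2 powr - (3/2)"
          by (rule norm_prime_term_le[OF that p]) (use Reb[OF s] in auto)
        also have "\<dots> < (1 :: real)" by (rule powr_less_one) auto
        finally have "norm (- (g (Suc n) * ?z)) < 1" by simp
        from sums_minus[OF Ln_series'[OF this]] show ?thesis using p by (simp add: e_def)
      qed
      from sums_add[OF sums_add[OF sums_mult[OF this[OF U(1)], of 2] this[OF U(2)]] this[OF U(3)]]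
      have "(\<lambda>m. 2 * ((g0 (Suc n) * ?z) ^ m / of_nat m) + (g1 (Suc n) * ?z) ^ m / of_nat m + (cnj (g1 (Suc n)) * ?z) ^ m / of_nat m) sums t n s"
        by (simp only: t_def)
      moreover have "2 * ((g0 (Suc n) * ?z) ^ m / of_nat m) + (g1 (Suc n) * ?z) ^ m / of_nat m + (cnj (g1 (Suc n)) * ?z) ^ m / of_nat m = u m s" for m
      proof -
        have "g1 (Suc n) ^ m + cnj (g1 (Suc n)) ^ m = of_real (2 * Re (g1 (Suc n) ^ m))"
          using complex_add_cnj[of "g1 (Suc n) ^ m"] by simp
        then have "of_real (c m) = (2 * g0 (Suc n) ^ m + (g1 (Suc n) ^ m + cnj (g1 (Suc n)) ^ m)) / of_nat m"
          using g0r(1) unfolding c_def by simp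
        then show ?thesis unfolding u_def z_pow[symmetric] power_mult_distrib by (simp add: add_divide_distrib algebra_simps)
      qed
      ultimately show ?thesis by simp
    qed
    have "norm (u m s) \<le> 4 * (1/2) ^ m" if s: "s \<in> ball 2 (1/2)" for m s
    proof -
      have nz: "norm (of_nat (Suc n) powr (- s)) \<le> 1/2"
      proof -
        have "norm (of_nat (Suc n) powr (- s)) = real (Suc n) powr (- Re s)" by (simp add: norm_of_nat_Suc_powr del: of_nat_Suc)
        also have "\<dots> \<le> real (Suc n) powr (-1)" using Reb[OF s] by (intro powr_mono) auto
        also have "\<dots> \<le> 1/2" using prime_ge_2_nat[OF p] by (simp add: powr_minus field_simps)
        finally show ?thesis .
      qed
      have "c m \<le> 4"
      proof (cases "m = 0")
        case False
        have 1: "Re (g0 (Suc n)) \<le> 1" using g0(1) complex_Re_le_cmod order_trans unfolding unit_mult_def by blast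
        then have "Re (g0 (Suc n)) ^ m \<le> 1" using g0r by (intro power_le_one) auto
        moreover have "Re (g1 (Suc n) ^ m) \<le> 1"
        proof -
          have "Re (g1 (Suc n) ^ m) \<le> norm (g1 (Suc n)) ^ m" by (metis complex_Re_le_cmod norm_power)
          also have "\<dots> \<le> 1" using 1 g1(2)[of "Suc n"] g0r(2) by (intro power_le_one) auto
          finally show ?thesis .
        qed
        ultimately have "c m \<le> 4 / real m" unfolding c_def by (intro divide_right_mono) auto
        also have "\<dots> \<le> 4" using False by (simp add: field_simps)
        finally show ?thesis .
      qed (simp add: c_def)
      then have "norm (u m s) \<le> 4 * norm (of_nat (Suc n) powr (- s)) ^ m"
        unfolding u_def z_pow[symmetric] using c0 by (simp add: norm_mult norm_power mult_right_mono del: of_nat_Suc)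
      also have "\<dots> \<le> 4 * (1/2) ^ m" using nz by (intro mult_left_mono power_mono) auto
      finally show ?thesis .
    qed
    then have c: "cmon (\<lambda>s. \<Sum>m. u m s)"
      by (intro cmon_suminf[OF cu, where M="\<lambda>m. 4 * (1/2) ^ m"]) (auto intro!: summable_mult summable_geometric)
    show ?thesis by (rule cmon_cong[OF c]) (use sums in \<open>simp add: sums_iff\<close>)
  qed
  have c: "cmon (\<lambda>s. \<Sum>n. t n s)" by (rule cmon_suminf[OF cmt summ tb])
  have eq: "(\<Sum>n. t n s) = 2 * dlog g0 s + dlog g1 s + dlog ?g2 s" if "s \<in> ball 2 (1/2)" for s
  proof -
    have "(\<Sum>n. t n s) = (\<Sum>n. 2 * e g0 n s + e g1 n s) + (\<Sum>n. e ?g2 n s)"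
      unfolding t_def by (rule suminf_add[symmetric]) (intro summable_add summable_mult se U that)+
    also have "(\<Sum>n. 2 * e g0 n s + e g1 n s) = (\<Sum>n. 2 * e g0 n s) + (\<Sum>n. e g1 n s)"
      by (rule suminf_add[symmetric]) (intro summable_mult se U that)+
    also have "(\<Sum>n. 2 * e g0 n s) = 2 * (\<Sum>n. e g0 n s)" by (rule suminf_mult[OF se[OF U(1) that]])
    finally show ?thesis by (simp only: e_def dlog_def)
  qed
  show ?thesis by (rule cmon_cong[OF c eq])
qed

section \<open>Zeta, the alternating series and the continuation of L\<close>

lemma unit_mult_1: "unit_mult (\<lambda>_. 1)"
  by (simp add: unit_mult_def)

lemma zeta_avoid:
  assumes s: "Re s > 1" and Q: "finite Q" "\<And>q. q \<in> Q \<Longrightarrow> prime q"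
  shows "infsum (\<lambda>n. of_nat n powr (- s)) (avoid Q) = (\<Prod>q\<in>Q. 1 - of_nat q powr (- s)) * dser (\<lambda>_. 1) s"
    and "(\<lambda>n. of_nat n powr (- s)) summable_on {1..}"
proof -
  have "summable (\<lambda>n. norm (of_nat (Suc n) powr (- s) :: complex))"
    using dser_summable[OF unit_mult_1 s] by (simp del: of_nat_Suc)
  note S = summable_on_Suc[OF this]
  then show "(\<lambda>n. of_nat n powr (- s)) summable_on {1..}" by simp
  show "infsum (\<lambda>n. of_nat n powr (- s)) (avoid Q) = (\<Prod>q\<in>Q. 1 - of_nat q powr (- s)) * dser (\<lambda>_. 1) s"
    using infsum_avoid[OF of_nat_powr_mult S(1) Q] S(2) by (simp add: dser_def del: of_nat_Suc)
qed

text \<open>The integers prime to k are those that avoid its prime factors. The finitely many Euler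
  factors split off here are the source of the zero at s = 0 that contradicts Landau's
  lemma.\<close>

lemma dser_principal:
  assumes s: "Re s > 1" and k: "k > 0"
  shows "dser (principal_char k) s = (\<Prod>p\<in>prime_factors k. 1 - of_nat p powr (- s)) * dser (\<lambda>_. 1) s"
proof -
  define f where "f = (\<lambda>n. principal_char k n * of_nat n powr (- s))"
  have U: "unit_mult (principal_char k)" using unit_mult_dchar[OF dchar_principal[OF k]] .
  have "infsum f {1..} = dser (principal_char k) s"
    using summable_on_Suc(2)[of f] dser_summable[OF U s] by (simp add: f_def dser_def)
  moreover have "infsum f {1..} = infsum (\<lambda>n. of_nat n powr (- s)) (avoid (prime_factors k))"
  proof (rule infsum_cong_neutral)
    have *: "coprime n k \<longleftrightarrow> (\<forall>p\<in>prime_factors k. \<not> p dvd n)" if "n \<ge> 1" for n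
    proof
      assume "coprime n k"
      then show "\<forall>p\<in>prime_factors k. \<not> p dvd n"
        by (metis coprime_common_divisor_nat in_prime_factors_iff not_prime_1)
    next
      assume a: "\<forall>p\<in>prime_factors k. \<not> p dvd n"
      show "coprime n k"
      proof (rule ccontr)
        assume "\<not> coprime n k"
        then obtain p where "prime p" "p dvd gcd n k" by (metis coprime_iff_gcd_eq_1 prime_factor_nat)
        then show False using a k by (auto simp: in_prime_factors_iff)
      qed
    qed
    fix n
    show "f n = 0" if "n \<in> {1..} - avoid (prime_factors k)"
      using that * by (auto simp: f_def principal_char_def avoid_def)
    show "f n = of_nat n powr (- s)" if "n \<in> {1..} \<inter> avoid (prime_factors k)"
      using that * by (auto simp: f_def principal_char_def avoid_def)
  qed (auto simp: avoid_def)
  ultimately show ?thesis using zeta_avoid(1)[OF s, of "prime_factors k"] by (simp add: in_prime_factors_iff)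
qed

text \<open>The coefficients 1, -1 have sum zero over a period, so the alternating series is entire
  by \<open>periodic_continuation\<close>. It serves as a multiple of zeta in which the pole is
  already cancelled; the even terms, taken twice, account for the factor 1 - 2 * 2 powr (-
  s).\<close>

lemma dirichlet_eta:
  obtains E where "E holomorphic_on UNIV"
    "\<And>s. Re s > 1 \<Longrightarrow> E s = (1 - 2 * 2 powr (- s)) * dser (\<lambda>_. 1) s"
proof -
  define a :: "nat \<Rightarrow> complex" where "a = (\<lambda>n. (-1) ^ n)"
  have "(\<Sum>n<2. a n) = 0" by (simp add: a_def numeral_2_eq_2)
  then obtain E where E: "E holomorphic_on UNIV"
    "\<And>s. Re s > 1 \<Longrightarrow> (\<lambda>n. a n / of_nat (Suc n) powr s) sums E s"
    using periodic_continuation[of 2 a] by (auto simp: a_def)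
  have "E s = (1 - 2 * 2 powr (- s)) * dser (\<lambda>_. 1) s" if s: "Re s > 1" for s
  proof -
    define f :: "nat \<Rightarrow> complex" where "f = (\<lambda>n. of_nat n powr (- s))"
    define b :: "nat \<Rightarrow> complex" where "b = (\<lambda>n. if even n then - f n else f n)"
    have 1: "a n / of_nat (Suc n) powr s = b (Suc n)" for n
      by (simp add: a_def b_def f_def powr_minus divide_inverse del: of_nat_Suc)
    have "summable (\<lambda>n. norm (b (Suc n)))"
      using dser_summable[OF unit_mult_1 s] by (simp add: b_def f_def if_distrib cong: if_cong del: of_nat_Suc)
    note B = summable_on_Suc[OF this]
    have "E s = infsum b {1..}" using E(2)[OF s] B(2) unfolding 1 by (simp add: sums_iff)
    also have "{1..} = avoid {2} \<union> (*) 2 ` {1..}"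
      by (auto simp: avoid_def elim!: dvdE)
    also have "infsum b (avoid {2} \<union> (*) 2 ` {1..}) = infsum b (avoid {2}) + infsum b ((*) 2 ` {1..})"
      by (intro infsum_Un_disjoint summable_on_subset_banach[OF B(1)]) (auto simp: avoid_def)
    also have "infsum b (avoid {2}) = infsum f (avoid {2})"
      by (rule infsum_cong) (auto simp: b_def avoid_def)
    also have "infsum b ((*) 2 ` {1..}) = infsum (\<lambda>n. - f n) ((*) 2 ` {1..})"
      by (rule infsum_cong) (auto simp: b_def)
    also have "\<dots> = - infsum f ((*) 2 ` {1..})" by (rule infsum_uminus)
    also have "infsum f ((*) 2 ` {1..}) = f 2 * infsum f {1..}"
      by (rule infsum_multiples) (auto simp: f_def of_nat_powr_mult simp del: of_nat_mult)
    also have "infsum f {1..} = dser (\<lambda>_. 1) s"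
      using zeta_avoid(1)[OF s, of "{}"] by (simp add: f_def avoid_def atLeast_def)
    also have "infsum f (avoid {2}) = (1 - f 2) * dser (\<lambda>_. 1) s"
      using zeta_avoid(1)[OF s, of "{2}"] by (simp add: f_def)
    finally show ?thesis by (simp add: f_def algebra_simps)
  qed
  then show ?thesis using that E(1) by blast
qed

lemma removable_quotient:
  assumes "g holomorphic_on S" "open S" "g a = 0"
  shows "(\<lambda>z. if z = a then deriv g a else g z / (z - a)) holomorphic_on S"
  by (rule pole_theorem_open_0[OF assms(1,2), where a=a]) (use assms(3) in auto)

lemma dchar_continuation:
  assumes "dirichlet_character k \<psi>" "\<psi> \<noteq> principal_char k"
  obtains \<Lambda> where "\<Lambda> holomorphic_on UNIV"
    "\<And>s. Re s > 1 \<Longrightarrow> (\<lambda>n. \<psi> (Suc n) / of_nat (Suc n) powr s) sums \<Lambda> s"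
    "\<And>s. Re s > 1 \<Longrightarrow> \<Lambda> s = dser \<psi> s"
    "\<And>s. Re s \<ge> 1/2 \<Longrightarrow> norm (\<Lambda> s) \<le> 2 * real k * norm s * (\<Sum>n. real (Suc n) powr (-3/2))"
proof -
  have k: "k > 0" using assms(1) by (simp add: dirichlet_character_def)
  \<comment> \<open>The series runs over the integers n + 1, the character sums over n from 0; the
    term \<psi> 0 is what separates them and turns the bound k into k + 1 \<le> 2 k.\<close>
  have shift: "(\<Sum>n<m. \<psi> (Suc n)) = (\<Sum>n<Suc m. \<psi> n) - \<psi> 0" for m by (subst sum.lessThan_Suc_shift) simp
  have "(\<Sum>n<k. \<psi> (Suc n)) = 0"
    using sum_dchar_period[OF assms] dchar_cong[OF assms(1), of k 0] unfolding shift by (simp add: cong_def)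
  moreover have "\<psi> (Suc (n + k)) = \<psi> (Suc n)" for n
    using mod_add_self2[of "Suc n" k] by (intro dchar_cong[OF assms(1)]) (simp add: cong_def)
  ultimately obtain \<Lambda> where \<Lambda>: "\<Lambda> holomorphic_on UNIV"
    "\<And>s. Re s > 1 \<Longrightarrow> (\<lambda>n. \<psi> (Suc n) / of_nat (Suc n) powr s) sums \<Lambda> s"
    using periodic_continuation[OF k, of "\<lambda>n. \<psi> (Suc n)"] by blast
  have b: "norm (\<Sum>n<m. \<psi> (Suc n)) \<le> 2 * real k" for m
  proof -
    have "norm (\<Sum>n<m. \<psi> (Suc n)) \<le> norm (\<Sum>n<Suc m. \<psi> n) + norm (\<psi> 0)"
      unfolding shift by (rule norm_triangle_ineq4)
    also have "\<dots> \<le> real k + 1" by (intro add_mono norm_sum_dchar_le[OF assms] norm_dchar_le_1[OF assms(1)])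
    finally show ?thesis using k by simp
  qed
  show ?thesis
  proof (rule that[OF \<Lambda>])
    show "\<Lambda> s = dser \<psi> s" if "Re s > 1" for s
      using \<Lambda>(2)[OF that] by (simp add: dser_def sums_iff powr_minus divide_inverse del: of_nat_Suc)
    show "norm (\<Lambda> s) \<le> 2 * real k * norm s * (\<Sum>n. real (Suc n) powr (-3/2))" if "Re s \<ge> 1/2" for s
      by (rule continuation_bound[OF \<Lambda> b that])
  qed
qed

lemma holomorphic_on_cnj_cnj:
  assumes "f holomorphic_on UNIV" shows "(\<lambda>s. cnj (f (cnj s))) holomorphic_on S"
proof -
  have "(cnj \<circ> f \<circ> cnj) field_differentiable at s" for s
    by (rule field_differentiable_cnj_cnj) (use assms in \<open>auto intro: holomorphic_on_imp_differentiable_at\<close>)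
  then show ?thesis unfolding holomorphic_on_def o_def using field_differentiable_at_within by blast
qed

text \<open>The solutions are 1 + 2 \<pi> i n / ln 2, with vertical spacing above 6; the disc of
  radius 5/2 used with Landau's lemma can meet only s = 1.\<close>

lemma two_powr_1_minus_eq_1:
  assumes "2 powr (1 - s) = (1 :: complex)" "\<bar>Im s\<bar> < 5/2"
  shows "s = 1"
proof -
  have "exp ((1 - s) * of_real (ln 2)) = 1" using assms(1) Ln_of_real[of 2] by (simp add: powr_def)
  then obtain n :: int where n: "Re ((1 - s) * of_real (ln 2)) = 0" "Im ((1 - s) * of_real (ln 2)) = of_int (2 * n) * pi"
    by (auto simp: exp_eq_1)
  then have Re: "Re s = 1" and Im: "- Im s * ln 2 = of_int (2 * n) * pi" by simp_all
  have "n = 0"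
  proof (rule ccontr)
    assume "n \<noteq> 0"
    then have "6 < \<bar>of_int (2 * n) * pi\<bar>"
    proof -
      have "2 * (1::real) \<le> \<bar>of_int (2 * n)\<bar>" using \<open>n \<noteq> 0\<close> by (simp flip: of_int_abs)
      then have "2 * 1 * 3 < \<bar>of_int (2 * n)\<bar> * pi" using pi_gt3 by (intro mult_le_less_imp_less) auto
      then show ?thesis by (simp add: abs_mult)
    qed
    moreover have "\<bar>- Im s * ln 2\<bar> \<le> 5/2 * 1"
      unfolding abs_mult using assms(2) ln_2_less_1 by (intro mult_mono) auto
    ultimately show False using Im by simp
  qed
  then show ?thesis using Re Im by (simp add: complex_eq_iff)
qed

text \<open>If L(1 + it) = 0, the zero cancels the double pole of F(s) = L(s, principal)^2 L(s + it) L(s - it, conjugate),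
  whose logarithm is completely monotone at 2.  The Euler factors at the primes dividing k make
  F(0) = 0, against Landau's lemma.\<close>

theorem dchar_nonzero_Re_1:
  assumes \<psi>: "dirichlet_character k \<psi>" "\<psi> \<noteq> principal_char k" and k: "k > 1"
    and \<Lambda>: "\<Lambda> holomorphic_on UNIV" "\<And>s. Re s > 1 \<Longrightarrow> \<Lambda> s = dser \<psi> s"
    and s0: "Re s0 = 1"
  shows "\<Lambda> s0 \<noteq> 0"
proof
  assume zero: "\<Lambda> s0 = 0"
  define t where "t = Im s0"
  have s0': "s0 = 1 + \<i> * of_real t" using s0 by (simp add: t_def complex_eq_iff)
  \<comment> \<open>The radius exceeds 2, so that 0 lies inside, and is small enough to keep out the
    zeros of \<open>w\<close> other than 1.\<close>
  define B :: "complex set" where "B = ball 2 (5/2)"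
  define g1 where "g1 = (\<lambda>n. \<psi> n * of_nat n powr (- (\<i> * of_real t)))"
  have U\<psi>: "unit_mult \<psi>" by (rule unit_mult_dchar[OF \<psi>(1)])
  have U1: "unit_mult g1" unfolding g1_def by (rule unit_mult_twist[OF U\<psi>])
  have U0: "unit_mult (principal_char k)" using unit_mult_dchar[OF dchar_principal] k by simp
  define L1 where "L1 = (\<lambda>s. \<Lambda> (s + \<i> * of_real t))"
  define L2 where "L2 = (\<lambda>s. cnj (L1 (cnj s)))"
  have hol1: "L1 holomorphic_on S" for S unfolding L1_def
    by (intro holomorphic_on_compose_gen[OF _ \<Lambda>(1), unfolded o_def] holomorphic_intros) auto
  have hol2: "L2 holomorphic_on S" for S unfolding L2_def by (rule holomorphic_on_cnj_cnj[OF hol1])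
  have L1: "L1 s = dser g1 s" if "Re s > 1" for s
    unfolding L1_def g1_def dser_twist using \<Lambda>(2) that by simp
  have L2: "L2 s = dser (\<lambda>n. cnj (g1 n)) s" if "Re s > 1" for s
    unfolding L2_def using dser_cnj[OF U1 that] L1[of "cnj s"] that by simp
  have z1: "L1 1 = 0" "L2 1 = 0" using zero by (simp_all add: L1_def L2_def s0')
  obtain E where E: "E holomorphic_on UNIV" "\<And>s. Re s > 1 \<Longrightarrow> E s = (1 - 2 * 2 powr (- s)) * dser (\<lambda>_. 1) s"
    using dirichlet_eta by blast
  \<comment> \<open>\<open>w\<close> is the factor between the alternating series \<open>E\<close>
    and zeta. Dividing it by s - 1 removes its only zero in B, so that \<open>v\<close> may stand in
    a denominator.\<close>
  define w :: "complex \<Rightarrow> complex" where "w = (\<lambda>s. 1 - 2 powr (1 - s))"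
  define v where "v = (\<lambda>s. if s = 1 then deriv w 1 else w s / (s - 1))"
  define q1 where "q1 = (\<lambda>s. if s = 1 then deriv L1 1 else L1 s / (s - 1))"
  define q2 where "q2 = (\<lambda>s. if s = 1 then deriv L2 1 else L2 s / (s - 1))"
  have holw: "w holomorphic_on B" unfolding w_def by (intro holomorphic_intros) auto
  have Bo: "open B" by (simp add: B_def)
  have holv: "v holomorphic_on B" unfolding v_def by (rule removable_quotient[OF holw Bo]) (simp add: w_def)
  have holq1: "q1 holomorphic_on B" unfolding q1_def by (rule removable_quotient[OF hol1 Bo z1(1)])
  have holq2: "q2 holomorphic_on B" unfolding q2_def by (rule removable_quotient[OF hol2 Bo z1(2)])
  have v0: "v s \<noteq> 0" if "s \<in> B" for s
  proof (cases "s = 1")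
    case True
    have "(w has_field_derivative (Ln 2)) (at 1)" unfolding w_def
      by (auto intro!: derivative_eq_intros simp: powr_def)
    then have "deriv w 1 = Ln 2" by (rule DERIV_imp_deriv)
    then show ?thesis using True by (simp add: v_def)
  next
    case False
    have "\<bar>Im s\<bar> < 5/2" using that abs_Im_le_cmod[of "2 - s"] by (simp add: B_def dist_norm)
    then have "w s \<noteq> 0" using two_powr_1_minus_eq_1[of s] False by (auto simp: w_def)
    then show ?thesis using False by (simp add: v_def)
  qed
  define Pk where "Pk = (\<lambda>s. \<Prod>p\<in>prime_factors k. 1 - of_nat p powr (- s) :: complex)"
  have "(\<lambda>s. of_nat p powr (- s)) holomorphic_on B" if "p \<in> prime_factors k" for p
    using that prime_gt_0_nat[of p] of_nat_powr_holomorphic[of "p - 1" B] by (simp add: in_prime_factors_iff)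
  then have holPk: "Pk holomorphic_on B" unfolding Pk_def
    by (intro holomorphic_on_prod holomorphic_on_diff holomorphic_on_const)
  \<comment> \<open>E * Pk / v is s - 1 times L of the principal character, and q1, q2 carry one
    factor 1 / (s - 1) each. Squaring the former makes all powers of s - 1 cancel.\<close>
  define F where "F = (\<lambda>s. (E s * Pk s / v s)\<^sup>2 * (q1 s * q2 s))"
  have "F holomorphic_on B" unfolding F_def
    by (intro holomorphic_intros holq1 holq2 holv holPk holomorphic_on_subset[OF E(1)]) (use v0 in auto)
  moreover have "F s = exp (2 * dlog (principal_char k) s + dlog g1 s + dlog (\<lambda>n. cnj (g1 n)) s)"
    if s: "s \<in> ball 2 (1/2)" for s
  proof -
    have Re: "Re s > 1" using that abs_Re_le_cmod[of "2 - s"] by (simp add: dist_norm)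
    then have s1: "s \<noteq> 1" by auto
    have sB: "s \<in> B" using s by (simp add: B_def)
    have "w s = 1 - 2 * 2 powr (- s)" by (simp add: w_def powr_diff powr_minus field_simps)
    then have "E s = v s * (s - 1) * dser (\<lambda>_. 1) s" using E(2)[OF Re] s1 by (simp add: v_def)
    then have "E s * Pk s / v s = (s - 1) * dser (principal_char k) s"
      using v0[OF sB] dser_principal[OF Re, of k] k by (simp add: Pk_def)
    then have "F s = ((s - 1) * dser (principal_char k) s)\<^sup>2 * (q1 s * q2 s)" by (simp add: F_def)
    also have "\<dots> = dser (principal_char k) s ^ 2 * (L1 s * L2 s)"
      using s1 by (simp add: q1_def q2_def power2_eq_square)
    also have "\<dots> = exp (dlog (principal_char k) s) ^ 2 * (exp (dlog g1 s) * exp (dlog (\<lambda>n. cnj (g1 n)) s))"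
      using L1[OF Re] L2[OF Re] dser_eq_exp_dlog[OF U0 Re] dser_eq_exp_dlog[OF U1 Re]
        dser_eq_exp_dlog[OF unit_mult_cnj[OF U1] Re] by simp
    also have "\<dots> = exp (2 * dlog (principal_char k) s + dlog g1 s + dlog (\<lambda>n. cnj (g1 n)) s)"
      by (simp add: exp_add exp_double mult.assoc)
    finally show ?thesis .
  qed
  moreover have "cmon (\<lambda>s. 2 * dlog (principal_char k) s + dlog g1 s + dlog (\<lambda>n. cnj (g1 n)) s)"
  proof (rule cmon_dlog_combination[OF U0 _ U1])
    show "principal_char k n \<in> \<real>\<^sub>\<ge>\<^sub>0" for n by (simp add: principal_char_def)
    show "norm (g1 n) = Re (principal_char k n)" for n
    proof (cases "coprime n k")
      case True
      then have "n > 0" using k by (cases n) auto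
      then have "norm (of_nat n powr (- (\<i> * of_real t)) :: complex) = 1"
        using norm_of_nat_Suc_powr[of "n - 1" "- (\<i> * of_real t)"] by simp
      then show ?thesis using norm_dchar[OF \<psi>(1) True] True by (simp add: g1_def norm_mult principal_char_def)
    next
      case False
      then show ?thesis using dchar_eq_0_iff[OF \<psi>(1)] by (simp add: g1_def principal_char_def)
    qed
  qed
  ultimately have "F 0 \<noteq> 0" unfolding B_def by (intro cmon_exp_landau[where R="5/2"]) auto
  moreover have "Pk 0 = 0"
  proof -
    obtain p where p: "prime p" "p dvd k" using prime_factor_nat[of k] k by auto
    then have "p \<in> prime_factors k" using k by (simp add: in_prime_factors_iff)
    moreover have "1 - of_nat p powr (- 0 :: complex) = (0 :: complex)" using p(1) prime_gt_0_nat by simp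
    ultimately show ?thesis unfolding Pk_def by (meson finite_set_mset prod_zero)
  qed
  then have "F 0 = 0" by (simp add: F_def)
  ultimately show False by simp
qed

section \<open>Prime sums under GRH\<close>

text \<open>This transfers \<open>GRH\<close> from the function chosen by \<open>SOME\<close> to the
  continuation constructed here. The point 1 is left out because the chosen function is arbitrary
  there.\<close>

lemma dirichlet_L_eq:
  assumes \<Lambda>: "\<Lambda> holomorphic_on UNIV"
    "\<And>s. Re s > 1 \<Longrightarrow> (\<lambda>n. \<psi> (Suc n) / of_nat (Suc n) powr s) sums \<Lambda> s"
    and s: "s \<noteq> 1"
  shows "dirichlet_L \<psi> s = \<Lambda> s"
proof -
  have "\<exists>f. f holomorphic_on (- {1}) \<and> (\<forall>s. Re s > 1 \<longrightarrow> (\<lambda>n. \<psi> (Suc n) / of_nat (Suc n) powr s) sums f s)"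
    using holomorphic_on_subset[OF \<Lambda>(1), of "- {1}"] \<Lambda>(2) by blast
  from someI_ex[OF this] have D: "dirichlet_L \<psi> holomorphic_on (- {1})"
    "\<And>s. Re s > 1 \<Longrightarrow> (\<lambda>n. \<psi> (Suc n) / of_nat (Suc n) powr s) sums dirichlet_L \<psi> s"
    unfolding dirichlet_L_def[symmetric] by blast+
  show ?thesis
  proof (rule analytic_continuation_open[where s="{s. Re s > 1}" and s'="- {1}" and f="dirichlet_L \<psi>" and g=\<Lambda> and z=s])
    show "connected (- {1 :: complex})" by (rule connected_punctured_universe) simp
    show "{s. 1 < Re s} \<noteq> {}" by (auto intro!: exI[of _ 2])
    show "dirichlet_L \<psi> z = \<Lambda> z" if "z \<in> {s. 1 < Re s}" for z
      using sums_unique2[OF D(2) \<Lambda>(2)] that by simp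
  qed (use D \<Lambda> s holomorphic_on_subset[OF \<Lambda>(1)] in \<open>auto intro: open_halfspace_Re_gt\<close>)
qed

text \<open>To the right of 1 the Euler product excludes zeros, on the line Re s = 1 it is Landau's
  lemma, and only to the left of 1 is \<open>GRH\<close> invoked.\<close>

lemma GRH_nonzero:
  assumes GRH and \<psi>: "dirichlet_character k \<psi>" "\<psi> \<noteq> principal_char k" and k: "k > 1"
    and \<Lambda>: "\<Lambda> holomorphic_on UNIV"
    "\<And>s. Re s > 1 \<Longrightarrow> (\<lambda>n. \<psi> (Suc n) / of_nat (Suc n) powr s) sums \<Lambda> s"
    "\<And>s. Re s > 1 \<Longrightarrow> \<Lambda> s = dser \<psi> s"
    and s: "Re s > 1/2"
  shows "\<Lambda> s \<noteq> 0"
proof -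
  consider "Re s > 1" | "Re s = 1" | "Re s < 1" by linarith
  then show ?thesis
  proof cases
    case 1
    then show ?thesis using \<Lambda>(3) dser_eq_exp_dlog[OF unit_mult_dchar[OF \<psi>(1)]] by simp
  next
    case 2
    show ?thesis using dchar_nonzero_Re_1[OF \<psi> k \<Lambda>(1) \<Lambda>(3) 2] by simp
  next
    case 3
    then have "dirichlet_L \<psi> s = \<Lambda> s" by (intro dirichlet_L_eq[OF \<Lambda>(1,2)]) auto
    then show ?thesis using \<open>GRH\<close> \<psi>(1) s 3 unfolding GRH_def by force
  qed
qed

text \<open>Because exp 1 \<le> 3 \<le> k. It lets additive constants be absorbed into the factor ln
  k.\<close>

lemma ln_nat_ge_1:
  assumes "k > 2" shows "ln (real k) \<ge> 1"
proof -
  have "exp 1 \<le> real k" using assms exp_le by linarith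
  then show ?thesis using assms by (subst ln_ge_iff) auto
qed

text \<open>Borel-Caratheodory is used on discs centred at 2 + i Im s. The outer radius 3/2 - e/2
  stays to the right of 1/2, where Re (log L) = ln |L| is bounded by a logarithm of k |s|; the inner
  radius 3/2 - e reaches the line Re s = 1/2 + e. The logarithm of |s| is weakened to (1 + |s|) powr
  e, the form that \<open>perron_bound\<close> accepts.\<close>

theorem prime_series_bound:
  assumes GRH and e: "0 < e" "e < 1/2"
  shows "\<exists>C\<ge>0. \<forall>k \<psi>. k > 2 \<and> dirichlet_character k \<psi> \<and> \<psi> \<noteq> principal_char k \<longrightarrow>
    (\<exists>P. P holomorphic_on {s. Re s > 1/2} \<and> (\<forall>s. Re s > 1 \<longrightarrow> P s = pser \<psi> s) \<and>
       (\<forall>s. Re s \<ge> 1/2 + e \<longrightarrow> norm (P s) \<le> C * ln (real k) * (1 + norm s) powr e))"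
proof -
  define S where "S = (\<Sum>n. real (Suc n) powr (-3/2))"
  define A where "A = (\<Sum>n. 2 * real (Suc n) powr (- 2))"
  define H where "H = (\<Sum>n. 4 * real (Suc n) powr (- 2 * (1/2 + e)))"
  \<comment> \<open>\<open>D\<close> bounds the logarithm of the bound for L by a multiple of ln k *
    (1 + |s|) powr e: 3 collects 1 for ln k and 2 for ln 4, and 1 / e comes from ln t \<le> t powr e
    / e. In \<open>C\<close>, the factor 6 / e bounds 2 r / (R - r) for r \<le> 3/2 and R - r = e /
    2.\<close>
  define D where "D = \<bar>ln (2 * S)\<bar> + 3 + 1 / e"
  define C where "C = A + 6 * (D + A) / e + H"
  have sumS: "summable (\<lambda>n. real (Suc n) powr (-3/2))" by (rule summable_powr_Suc) simp
  have S1: "S \<ge> 1"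
    using sum_le_suminf[OF sumS, of "{0}"] by (simp add: S_def)
  have A0: "A \<ge> 0" unfolding A_def by (intro suminf_nonneg summable_mult summable_powr_Suc) auto
  have H0: "H \<ge> 0" unfolding H_def by (intro suminf_nonneg summable_mult summable_powr_Suc) (use e in auto)
  have D0: "D \<ge> 0" using e by (simp add: D_def)
  have C0: "C \<ge> 0" unfolding C_def using A0 H0 D0 e by simp
  show ?thesis
  proof (rule exI[of _ C], intro conjI C0 allI impI)
    fix k \<psi> assume "k > 2 \<and> dirichlet_character k \<psi> \<and> \<psi> \<noteq> principal_char k"
    then have k: "k > 2" and \<psi>: "dirichlet_character k \<psi>" "\<psi> \<noteq> principal_char k" by auto
    have U: "unit_mult \<psi>" by (rule unit_mult_dchar[OF \<psi>(1)])
    have k1: "k > 1" using k by simp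
    obtain \<Lambda> where \<Lambda>: "\<Lambda> holomorphic_on UNIV"
      "\<And>s. Re s > 1 \<Longrightarrow> (\<lambda>n. \<psi> (Suc n) / of_nat (Suc n) powr s) sums \<Lambda> s"
      "\<And>s. Re s > 1 \<Longrightarrow> \<Lambda> s = dser \<psi> s"
      "\<And>s. Re s \<ge> 1/2 \<Longrightarrow> norm (\<Lambda> s) \<le> 2 * real k * norm s * S"
      using dchar_continuation[OF \<psi>] unfolding S_def by blast
    obtain l where l: "l holomorphic_on {s. Re s > 1/2}" "\<And>s. Re s > 1/2 \<Longrightarrow> exp (l s) = \<Lambda> s"
      "\<And>s. Re s > 1 \<Longrightarrow> l s = dlog \<psi> s"
      using dlog_continuation[OF U holomorphic_on_subset[OF \<Lambda>(1)] \<Lambda>(3) GRH_nonzero[OF \<open>GRH\<close> \<psi> k1 \<Lambda>(1-3)]] by blast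
    define P where "P = (\<lambda>s. l s - ptail \<psi> s)"
    have "norm (P s) \<le> C * ln (real k) * (1 + norm s) powr e" if s: "Re s \<ge> 1/2 + e" for s
    proof -
      define Y where "Y = (1 + norm s) powr e"
      define L where "L = ln (real k)"
      have L1: "L \<ge> 1" unfolding L_def by (rule ln_nat_ge_1[OF k])
      have Y1: "Y \<ge> 1" unfolding Y_def using e by (intro ge_one_powr_ge_zero) auto
      have LY: "1 \<le> L * Y" "L \<le> L * Y" "Y \<le> L * Y"
        using L1 Y1 mult_mono[of 1 L 1 Y] mult_left_mono[of 1 Y L] mult_right_mono[of 1 L Y] by auto
      have lb: "norm (l s) \<le> A + 6 * (D * (L * Y) + A) / e"
      proof (cases "Re s \<ge> 2")
        case True
        then have "norm (l s) \<le> A" using l(3)[of s] norm_dlog_le[OF U True] by (simp add: A_def)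
        then show ?thesis using A0 D0 LY e by (simp add: add_increasing2)
      next
        case False
        define z0 where "z0 = Complex 2 (Im s)"
        define M where "M = ln (2 * real k * S * (norm s + 4))"
        have sz0: "norm (s - z0) \<le> 3/2 - e" using s False by (simp add: z0_def cmod_eq_Re)
        have "norm (l s) \<le> A + 2 * (M + A) * (3/2 - e) / ((3/2 - e/2) - (3/2 - e))"
        proof (rule borel_caratheodory[where f=l and ?z0.0=z0 and R="3/2 - e/2" and r="3/2 - e" and M=M and A=A and z=s])
          have sub: "ball z0 (3/2 - e/2) \<subseteq> {s. Re s > 1/2}"
          proof
            fix w assume "w \<in> ball z0 (3/2 - e/2)"
            then have "\<bar>Re (z0 - w)\<bar> < 3/2 - e/2" using abs_Re_le_cmod[of "z0 - w"] by (simp add: dist_norm)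
            then have "2 - Re w < 3/2 - e/2" by (simp add: z0_def)
            then have "Re w > 1/2" using e by (simp add: field_simps)
            then show "w \<in> {s. Re s > 1/2}" by simp
          qed
          then show "l holomorphic_on ball z0 (3/2 - e/2)" by (rule holomorphic_on_subset[OF l(1)])
          show "Re (l w) < M" if w: "w \<in> ball z0 (3/2 - e/2)" for w
          proof -
            have Rw: "Re w > 1/2" using sub w by blast
            have "norm w \<le> norm s + norm (z0 - s) + norm (w - z0)"
              using norm_triangle_ineq[of "s" "z0 - s"] norm_triangle_ineq[of z0 "w - z0"] by simp
            also have "\<dots> < norm s + 4" using sz0 w e by (simp add: dist_norm norm_minus_commute)
            finally have nw: "norm w < norm s + 4" .
            have "exp (Re (l w)) = norm (\<Lambda> w)" using l(2)[OF Rw] by (metis norm_exp_eq_Re)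
            also have "\<dots> \<le> 2 * real k * norm w * S" using \<Lambda>(4)[of w] Rw by simp
            also have "\<dots> = (2 * real k * S) * norm w" by simp
            also have "\<dots> < (2 * real k * S) * (norm s + 4)"
              using nw k S1 by (intro mult_strict_left_mono) auto
            finally have less: "exp (Re (l w)) < 2 * real k * S * (norm s + 4)" .
            have "ln (exp (Re (l w))) < ln (2 * real k * S * (norm s + 4))"
              by (subst ln_less_cancel_iff) (use less exp_gt_zero[of "Re (l w)"] in linarith)+
            then show ?thesis by (simp add: M_def)
          qed
          show "norm (l z0) \<le> A" using l(3)[of z0] norm_dlog_le[OF U, of z0] by (simp add: A_def z0_def)
        qed (use sz0 e in auto)
        also have "2 * (M + A) * (3/2 - e) / ((3/2 - e/2) - (3/2 - e)) \<le> 6 * (D * (L * Y) + A) / e"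
        proof -
          have "M = ln (2 * S) + L + ln (norm s + 4)"
          proof -
            have "norm s + 4 > 0" by (simp add: add_nonneg_pos)
            then have "ln ((2 * S) * real k * (norm s + 4)) = ln ((2 * S) * real k) + ln (norm s + 4)"
              using k S1 by (intro ln_mult_pos) auto
            also have "ln ((2 * S) * real k) = ln (2 * S) + L" unfolding L_def using k S1 by (intro ln_mult_pos) auto
            finally show ?thesis by (simp add: M_def mult_ac)
          qed
          moreover have "ln (norm s + 4) \<le> 2 + Y / e"
          proof -
            have "ln (norm s + 4) \<le> ln (4 * (1 + norm s))" by (subst ln_le_cancel_iff) (auto simp: add_nonneg_pos add_pos_nonneg)
            also have "\<dots> = ln 4 + ln (1 + norm s)" by (intro ln_mult_pos) (auto intro: add_pos_nonneg)
            also have "ln 4 \<le> (2::real)" using ln_2_less_1 ln_realpow[of 2 2] by simp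
            also have "ln (1 + norm s) \<le> Y / e" unfolding Y_def by (rule ln_powr_bound) (use e in auto)
            finally show ?thesis by simp
          qed
          ultimately have "M \<le> \<bar>ln (2 * S)\<bar> * 1 + L + (2 * 1 + Y * (1 / e))" by simp
          also have "\<dots> \<le> \<bar>ln (2 * S)\<bar> * (L * Y) + L * Y + (2 * (L * Y) + (L * Y) * (1 / e))"
            using LY e by (intro add_mono mult_left_mono mult_right_mono) auto
          also have "\<dots> = D * (L * Y)" by (simp add: D_def algebra_simps)
          finally have MD: "M \<le> D * (L * Y)" .
          have DA: "D * (L * Y) + A \<ge> 0" using D0 LY(1) A0 by simp
          have "2 * (M + A) * (3/2 - e) / ((3/2 - e/2) - (3/2 - e)) = 2 * (M + A) * (3/2 - e) / (e/2)" by simp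
          also have "\<dots> \<le> 2 * (D * (L * Y) + A) * (3/2) / (e/2)"
          proof (rule divide_right_mono)
            have "2 * (M + A) * (3/2 - e) \<le> 2 * (D * (L * Y) + A) * (3/2 - e)" using MD e by (intro mult_right_mono) auto
            also have "\<dots> \<le> 2 * (D * (L * Y) + A) * (3/2)" using DA e by (intro mult_left_mono) auto
            finally show "2 * (M + A) * (3/2 - e) \<le> 2 * (D * (L * Y) + A) * (3/2)" .
          qed (use e in simp)
          also have "2 * (D * (L * Y) + A) * (3/2) / (e/2) = 6 * (D * (L * Y) + A) / e" using e by (simp add: field_simps)
          finally show ?thesis .
        qed
        finally show ?thesis by simp
      qed
      have "norm (ptail \<psi> s) \<le> H" unfolding H_def by (rule norm_ptail_le[OF U]) (use s e in auto)
      then have "norm (P s) \<le> A + 6 * (D * (L * Y) + A) / e + H"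
        unfolding P_def using lb norm_triangle_ineq4[of "l s" "ptail \<psi> s"] by linarith
      also have "\<dots> \<le> A * (L * Y) + 6 * (D * (L * Y) + A * (L * Y)) / e + H * (L * Y)"
        using A0 H0 LY(1) e mult_left_mono[OF LY(1) A0] mult_left_mono[OF LY(1) H0]
        by (intro add_mono divide_right_mono) auto
      also have "\<dots> = C * L * Y" using e by (simp add: C_def field_simps)
      finally show ?thesis by (simp add: L_def Y_def)
    qed
    moreover have "P s = pser \<psi> s" if "Re s > 1" for s
      using dlog_eq_pser_ptail[OF U that] l(3)[OF that] by (simp add: P_def)
    moreover have "P holomorphic_on {s. Re s > 1/2}" unfolding P_def by (intro holomorphic_intros l(1) ptail_holomorphic[OF U])
    ultimately show "\<exists>P. P holomorphic_on {s. Re s > 1/2} \<and> (\<forall>s. Re s > 1 \<longrightarrow> P s = pser \<psi> s) \<and>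
       (\<forall>s. Re s \<ge> 1/2 + e \<longrightarrow> norm (P s) \<le> C * ln (real k) * (1 + norm s) powr e)" by blast
  qed
qed

text \<open>Perron's formula applied to the shifted function P (s + w). The shift is there for two
  uses: s = 0 with \<sigma> = 1/2 + e gives the plain sum over primes, and Re s = 1/2 + e with
  \<sigma> = e gives the prime polynomials that enter the rough sums.\<close>

theorem prime_sum_bound:
  assumes GRH and e: "0 < e" "e < 1/2" and \<sigma>: "0 < \<sigma>" "\<sigma> \<le> 2"
  shows "\<exists>C\<ge>0. \<forall>k \<psi> s N. k > 2 \<and> dirichlet_character k \<psi> \<and> \<psi> \<noteq> principal_char k \<and>
      Re s \<ge> 0 \<and> Re s + \<sigma> \<ge> 1/2 + e \<longrightarrow>
      norm (\<Sum>n<N. (if prime (Suc n) then \<psi> (Suc n) else 0) * of_nat (Suc n) powr (- s))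
        \<le> C * ln (real k) * (1 + norm s) powr e * (real N + 1) powr (\<sigma> + 2 * e)"
proof -
  obtain C where C: "C \<ge> 0" and bnd: "\<And>k \<psi>. k > 2 \<Longrightarrow> dirichlet_character k \<psi> \<Longrightarrow> \<psi> \<noteq> principal_char k \<Longrightarrow>
    \<exists>P. P holomorphic_on {s. Re s > 1/2} \<and> (\<forall>s. Re s > 1 \<longrightarrow> P s = pser \<psi> s) \<and>
       (\<forall>s. Re s \<ge> 1/2 + e \<longrightarrow> norm (P s) \<le> C * ln (real k) * (1 + norm s) powr e)"
    using prime_series_bound[OF assms(1) e] by blast
  \<comment> \<open>The exponent given to \<open>perron_bound\<close> is 2 * e, since it admits
    growth with only half of its exponent and P grows with exponent e.\<close>
  define K where "K = perron_const \<sigma> (2 * e) * C"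
  have K0: "K \<ge> 0" unfolding K_def using C perron_const_nonneg[of "2 * e"] e by simp
  show ?thesis
  proof (rule exI[of _ K], intro conjI K0 allI impI)
    fix k \<psi> s N
    assume "k > 2 \<and> dirichlet_character k \<psi> \<and> \<psi> \<noteq> principal_char k \<and> Re s \<ge> 0 \<and> Re s + \<sigma> \<ge> 1/2 + e"
    then have k: "k > 2" and \<psi>: "dirichlet_character k \<psi>" "\<psi> \<noteq> principal_char k" and s: "Re s \<ge> 0" "Re s + \<sigma> \<ge> 1/2 + e" by auto
    have U: "unit_mult \<psi>" by (rule unit_mult_dchar[OF \<psi>(1)])
    have L: "ln (real k) \<ge> 1" by (rule ln_nat_ge_1[OF k])
    obtain P where P: "P holomorphic_on {s. Re s > 1/2}" "\<And>s. Re s > 1 \<Longrightarrow> P s = pser \<psi> s"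
      "\<And>s. Re s \<ge> 1/2 + e \<Longrightarrow> norm (P s) \<le> C * ln (real k) * (1 + norm s) powr e"
      using bnd[OF k \<psi>] by blast
    define a where "a = (\<lambda>n. (if prime (Suc n) then \<psi> (Suc n) else 0) * of_nat (Suc n) powr (- s))"
    define B where "B = C * ln (real k) * (1 + norm s) powr e"
    have B0: "B \<ge> 0" unfolding B_def using C L by simp
    show "norm (\<Sum>n<N. (if prime (Suc n) then \<psi> (Suc n) else 0) * of_nat (Suc n) powr (- s))
        \<le> K * ln (real k) * (1 + norm s) powr e * (real N + 1) powr (\<sigma> + 2 * e)"
    proof (cases "N = 0")
      case True
      then show ?thesis using K0 L by simp
    next
      case False
      have "norm (\<Sum>n<N. a n) \<le> perron_const \<sigma> (2 * e) * B * (real N + 1) powr (\<sigma> + 2 * e)"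
      proof -
        have na: "norm (a n) \<le> 1" for n
        proof -
          have "norm (a n) \<le> norm (\<psi> (Suc n) * of_nat (Suc n) powr (- s))" by (simp add: a_def norm_mult)
          also have "\<dots> \<le> real (Suc n) powr (- Re s)" by (rule norm_dterm_le[OF U])
          also have "\<dots> \<le> 1" using powr_mono[of "- Re s" 0 "real (Suc n)"] s by simp
          finally show ?thesis .
        qed
        have 1: "summable (\<lambda>n. norm (a n) * real (Suc n) powr (- 2))"
          by (rule summable_comparison_test'[OF summable_powr_Suc[of "-2"]])
             (use na in \<open>auto intro!: mult_left_le_one_le\<close>)
        have 2: "P (s + w) = (\<Sum>n. a n * of_nat (Suc n) powr (- w))" if "Re w = 2" for w
        proof -
          have "P (s + w) = pser \<psi> (s + w)" using that s by (intro P(2)) simp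
          moreover have "complex_of_nat (Suc n) powr (- (s + w)) = of_nat (Suc n) powr (- s) * of_nat (Suc n) powr (- w)" for n
            by (simp add: powr_def exp_add[symmetric] algebra_simps del: of_nat_Suc)
          ultimately show ?thesis by (simp add: pser_def a_def mult.assoc del: of_nat_Suc)
        qed
        have 3: "(\<lambda>w. P (s + w)) holomorphic_on {w. Re w > 1/2 - Re s}"
          by (rule holomorphic_on_compose_gen[OF _ P(1), unfolded o_def]) (auto intro!: holomorphic_intros)
        have 4: "norm (P (s + w)) \<le> B * (1 + norm w) powr (2 * e / 2)" if "\<sigma> \<le> Re w" for w
        proof -
          have "norm (P (s + w)) \<le> C * ln (real k) * (1 + norm (s + w)) powr e"
            using that s by (intro P(3)) simp
          also have "(1 + norm (s + w)) powr e \<le> ((1 + norm s) * (1 + norm w)) powr e"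
          proof (rule powr_mono2)
            have "0 \<le> norm s * norm w" by simp
            then show "1 + norm (s + w) \<le> (1 + norm s) * (1 + norm w)"
              unfolding distrib_left distrib_right using norm_triangle_ineq[of s w] by linarith
          qed (use e in auto)
          also have "\<dots> = (1 + norm s) powr e * (1 + norm w) powr e" by (simp add: powr_mult)
          finally show ?thesis using C L by (simp add: B_def mult.assoc mult_left_mono)
        qed
        show ?thesis
          by (rule perron_bound[where c=2 and A="\<lambda>w. P (s + w)" and ?\<sigma>0.0="1/2 - Re s", OF \<sigma> _ _ _ B0 1 2 3 4])
             (use e s False in auto)
      qed
      then show ?thesis by (simp add: a_def K_def B_def mult.assoc)
    qed
  qed
qed

section \<open>Rough integers\<close>

text \<open>The sum of a completely multiplicative g over this set is the complete homogeneous
  polynomial of degree r in the values g p. The condition u \<ge> 1 keeps out 0, whose factorisation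
  is also the empty multiset.\<close>

definition prime_products :: "nat set \<Rightarrow> nat \<Rightarrow> nat set" where
  "prime_products P r = {u. u \<ge> 1 \<and> prime_factors u \<subseteq> P \<and> size (prime_factorization u) = r}"

lemma prime_products_mult:
  assumes "p \<in> P" "prime p" "w \<in> prime_products P r"
  shows "p * w \<in> prime_products P (Suc r)"
  using assms prime_gt_0_nat[of p]
  by (auto simp: prime_products_def prime_factorization_mult prime_factorization_prime Suc_le_eq)

lemma prime_products_0: "prime_products P 0 = {1}"
  by (auto simp: prime_products_def prime_factorization_empty_iff)

lemma prime_products_dvd:
  assumes "p \<in> P" "prime p" "p * w \<in> prime_products P (Suc r)"
  shows "w \<in> prime_products P r"
proof -
  have "w \<noteq> 0" using assms(3) by (auto simp: prime_products_def)
  then show ?thesis using assms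
    by (auto simp: prime_products_def prime_factorization_mult prime_factorization_prime)
qed

lemma finite_prime_products:
  assumes "finite P" shows "finite (prime_products P r)"
proof (induction r)
  case (Suc r)
  have "prime_products P (Suc r) \<subseteq> (\<Union>p\<in>P. (*) p ` prime_products P r)"
  proof
    fix u assume u: "u \<in> prime_products P (Suc r)"
    then have "prime_factorization u \<noteq> {#}" by (auto simp: prime_products_def)
    then obtain p where p: "p \<in> prime_factors u" by blast
    then have "p dvd u" "prime p" by (auto simp: in_prime_factors_iff)
    then obtain w where w: "u = p * w" by blast
    have "p \<in> P" using p u by (auto simp: prime_products_def)
    then show "u \<in> (\<Union>p\<in>P. (*) p ` prime_products P r)"
      using prime_products_dvd[OF _ \<open>prime p\<close>] u w by blast
  qed
  then show ?case by (rule finite_subset) (use assms Suc in auto)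
qed (simp add: prime_products_0)

lemma prime_products_power:
  assumes p: "p \<in> P" "prime p" and j: "j \<le> r"
  shows "bij_betw ((*) (p ^ j)) (prime_products P (r - j)) {u \<in> prime_products P r. p ^ j dvd u}"
  using j
proof (induction j)
  case 0
  have "{u \<in> prime_products P r. p ^ 0 dvd u} = prime_products P r" by auto
  then show ?case by (simp add: bij_betw_def)
next
  case (Suc j)
  have inj: "inj_on ((*) (p ^ Suc j)) A" for A
    using prime_gt_0_nat[OF p(2)] by (auto intro!: inj_onI)
  have "(*) (p ^ Suc j) ` prime_products P (r - Suc j) = {u \<in> prime_products P r. p ^ Suc j dvd u}"
  proof (intro equalityI subsetI)
    fix u assume "u \<in> (*) (p ^ Suc j) ` prime_products P (r - Suc j)"
    then obtain w where w: "u = p ^ j * (p * w)" "w \<in> prime_products P (r - Suc j)" by (auto simp: mult_ac)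
    have "p * w \<in> prime_products P (r - j)"
      using prime_products_mult[OF p w(2)] Suc.prems by (simp add: Suc_diff_Suc)
    then have "u \<in> prime_products P r" using Suc unfolding w(1) bij_betw_def by auto
    then show "u \<in> {u \<in> prime_products P r. p ^ Suc j dvd u}" using w(1) by auto
  next
    fix u assume u: "u \<in> {u \<in> prime_products P r. p ^ Suc j dvd u}"
    then have "p ^ j dvd u" by (metis (no_types, lifting) dvd_mult_right mem_Collect_eq power_Suc)
    then have "u \<in> (*) (p ^ j) ` prime_products P (r - j)" using u Suc unfolding bij_betw_def by auto
    then obtain v where v: "u = p ^ j * v" "v \<in> prime_products P (r - j)" by blast
    have "p ^ j * p dvd p ^ j * v" using u v(1) by (simp add: mult.commute)
    then have "p dvd v" using prime_gt_0_nat[OF p(2)] by simp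
    then obtain w where w: "v = p * w" by blast
    have "w \<in> prime_products P (r - Suc j)"
      using prime_products_dvd[OF p, of w "r - Suc j"] v(2) Suc.prems unfolding w by (simp add: Suc_diff_Suc)
    then show "u \<in> (*) (p ^ Suc j) ` prime_products P (r - Suc j)"
      using v(1) w by (auto simp: mult_ac)
  qed
  then show ?case using inj by (simp add: bij_betw_def)
qed

text \<open>Newton's identity between complete homogeneous and power sums of the variables g p, proved by
  counting the pairs (p, j) with p ^ j dividing u.\<close>

lemma prime_products_newton:
  fixes g :: "nat \<Rightarrow> complex"
  assumes P: "finite P" "\<And>p. p \<in> P \<Longrightarrow> prime p" and mult: "\<And>m n. g (m * n) = g m * g n"
  shows "of_nat r * sum g (prime_products P r) =
     (\<Sum>j\<in>{1..r}. (\<Sum>p\<in>P. g (p ^ j)) * sum g (prime_products P (r - j)))"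
proof -
  let ?U = "prime_products P"
  \<comment> \<open>The multiplicity of p in u is the number of j \<ge> 1 for which p ^ j divides u,
    and the multiplicities add up to r.\<close>
  have count: "r = (\<Sum>p\<in>P. card {j\<in>{1..r}. p ^ j dvd u})" if u: "u \<in> ?U r" for u
  proof -
    have u0: "u \<noteq> 0" using u by (auto simp: prime_products_def)
    have "card {j\<in>{1..r}. p ^ j dvd u} = count (prime_factorization u) p" if "p \<in> P" for p
    proof -
      have p: "prime p" using P that by blast
      have "count (prime_factorization u) p \<le> r"
        using u count_le_size[of "prime_factorization u" p] by (simp add: prime_products_def)
      then have le: "multiplicity p u \<le> r" using p by (simp add: count_prime_factorization_prime)
      have dvd: "p ^ j dvd u \<longleftrightarrow> j \<le> multiplicity p u" for j
        using p u0 by (intro power_dvd_iff_le_multiplicity) (auto simp: not_prime_unit)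
      have "{j\<in>{1..r}. p ^ j dvd u} = {1..multiplicity p u}" unfolding dvd using le by auto
      then show ?thesis using p by (simp add: count_prime_factorization_prime)
    qed
    then have "(\<Sum>p\<in>P. card {j\<in>{1..r}. p ^ j dvd u}) = (\<Sum>p\<in>P. count (prime_factorization u) p)" by simp
    also have "\<dots> = (\<Sum>p\<in>prime_factors u. count (prime_factorization u) p)"
      by (rule sum.mono_neutral_right) (use P(1) u in \<open>auto simp: prime_products_def not_in_iff\<close>)
    also have "\<dots> = r" using u by (simp add: prime_products_def size_multiset_overloaded_eq)
    finally show ?thesis by simp
  qed
  have "of_nat r * sum g (?U r) = (\<Sum>u\<in>?U r. of_nat (\<Sum>p\<in>P. card {j\<in>{1..r}. p ^ j dvd u}) * g u)"
    unfolding sum_distrib_left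
  proof (rule sum.cong[OF refl])
    fix u assume "u \<in> ?U r"
    from arg_cong[OF count[OF this], of "\<lambda>n. of_nat n * g u"]
    show "of_nat r * g u = of_nat (\<Sum>p\<in>P. card {j\<in>{1..r}. p ^ j dvd u}) * g u" .
  qed
  also have "\<dots> = (\<Sum>u\<in>?U r. \<Sum>p\<in>P. \<Sum>j\<in>{1..r}. if p ^ j dvd u then g u else 0)"
  proof (intro sum.cong refl)
    fix u
    have "of_nat (card {j\<in>{1..r}. p ^ j dvd u}) * g u = (\<Sum>j\<in>{1..r}. if p ^ j dvd u then g u else 0)" for p
      by (simp add: sum.If_cases Int_def)
    then show "of_nat (\<Sum>p\<in>P. card {j\<in>{1..r}. p ^ j dvd u}) * g u = (\<Sum>p\<in>P. \<Sum>j\<in>{1..r}. if p ^ j dvd u then g u else 0)"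
      by (simp add: sum_distrib_right)
  qed
  also have "\<dots> = (\<Sum>p\<in>P. \<Sum>u\<in>?U r. \<Sum>j\<in>{1..r}. if p ^ j dvd u then g u else 0)" by (rule sum.swap)
  also have "\<dots> = (\<Sum>p\<in>P. \<Sum>j\<in>{1..r}. \<Sum>u\<in>?U r. if p ^ j dvd u then g u else 0)"
    by (intro sum.cong refl sum.swap)
  also have "\<dots> = (\<Sum>p\<in>P. \<Sum>j\<in>{1..r}. g (p ^ j) * sum g (?U (r - j)))"
  proof (intro sum.cong refl)
    fix p j assume pj: "p \<in> P" "j \<in> {1..r}"
    have "(\<Sum>u\<in>?U r. if p ^ j dvd u then g u else 0) = sum g {u \<in> ?U r. p ^ j dvd u}"
      by (rule sum.inter_filter[symmetric]) (rule finite_prime_products[OF P(1)])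
    also have "\<dots> = (\<Sum>w\<in>?U (r - j). g (p ^ j * w))"
      using sum.reindex_bij_betw[OF prime_products_power[of p P j r], of g] pj P by simp
    finally show "(\<Sum>u\<in>?U r. if p ^ j dvd u then g u else 0) = g (p ^ j) * sum g (?U (r - j))"
      by (simp add: mult sum_distrib_left)
  qed
  also have "\<dots> = (\<Sum>j\<in>{1..r}. \<Sum>p\<in>P. g (p ^ j) * sum g (?U (r - j)))" by (rule sum.swap)
  finally show ?thesis by (simp add: sum_distrib_right)
qed

text \<open>In Newton's identity each of the r terms is at most B * B ^ (r - j) \<le> B ^ r, and the
  factor r on the left cancels their number, so no constant accumulates in the induction.\<close>

lemma norm_prime_products_le:
  fixes g :: "nat \<Rightarrow> complex"
  assumes P: "finite P" "\<And>p. p \<in> P \<Longrightarrow> prime p" and mult: "\<And>m n. g (m * n) = g m * g n" "g 1 = 1"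
    and B: "B \<ge> 1" "\<And>j. j \<ge> 1 \<Longrightarrow> norm (\<Sum>p\<in>P. g (p ^ j)) \<le> B"
  shows "norm (sum g (prime_products P r)) \<le> B ^ r"
proof (induction r rule: less_induct)
  case (less r)
  show ?case
  proof (cases "r = 0")
    case False
    have "real r * norm (sum g (prime_products P r)) = norm (of_nat r * sum g (prime_products P r))"
      by (simp add: norm_mult)
    also have "\<dots> \<le> (\<Sum>j\<in>{1..r}. B ^ r)"
    proof (subst prime_products_newton[where g=g and P=P], rule P(1), rule P(2), assumption, rule mult(1), rule sum_norm_le)
      fix j assume j: "j \<in> {1..r}"
      have "norm ((\<Sum>p\<in>P. g (p ^ j)) * sum g (prime_products P (r - j))) \<le> B * B ^ (r - j)"
        unfolding norm_mult by (rule mult_mono) (use j B less in auto)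
      also have "\<dots> = B ^ Suc (r - j)" by simp
      also have "\<dots> \<le> B ^ r" using B(1) j by (intro power_increasing) auto
      finally show "norm ((\<Sum>p\<in>P. g (p ^ j)) * sum g (prime_products P (r - j))) \<le> B ^ r" .
    qed
    also have "\<dots> = real r * B ^ r" by simp
    finally show ?thesis using False by simp
  qed (use mult(2) in \<open>simp add: prime_products_0\<close>)
qed

lemma power_size_le_prod_mset:
  fixes A :: "nat multiset"
  shows "(\<And>p. p \<in># A \<Longrightarrow> m \<le> p) \<Longrightarrow> m ^ size A \<le> prod_mset A"
  by (induction A) (auto intro!: mult_mono)

text \<open>A product of R + 1 or more primes above M is at least (M + 1) ^ (R + 1), which exceeds
  N.\<close>

lemma rough_size_le:
  fixes u N M R :: nat
  assumes u: "1 \<le> u" "u \<le> N" "\<And>p. prime p \<Longrightarrow> p dvd u \<Longrightarrow> p > M" and N: "N < (M + 1) ^ (R + 1)"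
  shows "size (prime_factorization u) \<le> R"
proof (rule ccontr)
  assume "\<not> size (prime_factorization u) \<le> R"
  then have "(M + 1) ^ (R + 1) \<le> (M + 1) ^ size (prime_factorization u)" using power_increasing[of "R + 1" "size (prime_factorization u)" "M + 1"] by simp
  also have "\<dots> \<le> prod_mset (prime_factorization u)"
    by (rule power_size_le_prod_mset) (use u in \<open>auto simp: in_prime_factors_iff Suc_le_eq\<close>)
  also have "\<dots> = u" using u by (simp add: prod_mset_prime_factorization_nat)
  finally show False using u N by simp
qed

lemma bij_betw_Suc: "bij_betw Suc {n. Suc n \<in> V} (V - {0})"
  by (rule bij_betwI[where g="\<lambda>n. n - 1"]) auto

text \<open>M < p \<le> N is the range of the admissible primes. The hypothesis N < (M + 1) ^ (R +
  1) bounds the degree in these primes by R, and a power sum with j \<ge> 2 on the line Re s = 1/2 +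
  e is dominated by a convergent series. Each homogeneous part is then at most the R-th power of the
  bound for a single prime polynomial.\<close>

theorem rough_sum_bound:
  fixes R :: nat
  assumes GRH and e: "0 < e" "e < 1/2" and R: "R \<ge> 1" "2 * e * real R \<le> 1"
  shows "\<exists>C\<ge>0. \<forall>k \<psi> (N :: nat) (M :: nat). k > 2 \<and> dirichlet_character k \<psi> \<and> \<psi> \<noteq> principal_char k \<and>
      M \<le> N \<and> 1 \<le> N \<and> N < (M + 1) ^ (R + 1) \<longrightarrow>
      norm (\<Sum>u | 1 \<le> u \<and> u \<le> N \<and> (\<forall>p. prime p \<longrightarrow> p dvd u \<longrightarrow> M < p). \<psi> u)
        \<le> C * ln (real k) ^ R * (real N + 1) powr (1/2 + e + 5 * e * real R)"
proof -
  define \<sigma> where "\<sigma> = 1/2 + e"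
  have \<sigma>0: "\<sigma> > 0" using e by (simp add: \<sigma>_def)
  obtain C1 where C1: "C1 \<ge> 0" and C1b: "\<And>k \<psi> s N. k > 2 \<Longrightarrow> dirichlet_character k \<psi> \<Longrightarrow> \<psi> \<noteq> principal_char k \<Longrightarrow>
      Re s = \<sigma> \<Longrightarrow>
      norm (\<Sum>n<N. (if prime (Suc n) then \<psi> (Suc n) else 0) * of_nat (Suc n) powr (- s))
        \<le> C1 * ln (real k) * (1 + norm s) powr e * (real N + 1) powr (e + 2 * e)"
    using prime_sum_bound[OF \<open>GRH\<close> e, of e] e unfolding \<sigma>_def by fastforce
  define Z where "Z = (\<Sum>n. real (Suc n) powr (- (1 + 2 * e)))"
  have sumZ: "summable (\<lambda>n. real (Suc n) powr (- (1 + 2 * e)))" by (rule summable_powr_Suc) (use e in simp)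
  have Z0: "Z \<ge> 0" unfolding Z_def by (intro suminf_nonneg sumZ) simp
  \<comment> \<open>2 * C1 is for the primes in (M, N], a difference of two initial sums; Z is for
    the power sums with j \<ge> 2; the 1 ensures K \<ge> 1.\<close>
  define K where "K = 2 * C1 + Z + 1"
  have K1: "K \<ge> 1" using C1 Z0 by (simp add: K_def)
  define C where "C = perron_const \<sigma> (2 * e * real R) * (real R + 1) * K ^ R"
  have eR: "0 < 2 * e * real R" using e R by simp
  have C0: "C \<ge> 0" unfolding C_def using K1 perron_const_nonneg[OF eR, of \<sigma>] by simp
  show ?thesis
  proof (rule exI[of _ C], intro conjI C0 allI impI)
    fix k \<psi> and N M :: nat
    assume "k > 2 \<and> dirichlet_character k \<psi> \<and> \<psi> \<noteq> principal_char k \<and> M \<le> N \<and> 1 \<le> N \<and> N < (M + 1) ^ (R + 1)"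
    then have k: "k > 2" and \<psi>: "dirichlet_character k \<psi>" "\<psi> \<noteq> principal_char k" and MN: "M \<le> N" "1 \<le> N"
      and NR: "N < (M + 1) ^ (R + 1)" by auto
    define P where "P = {p. prime p \<and> M < p \<and> p \<le> N}"
    have finP: "finite P" by (rule finite_subset[of _ "{..N}"]) (auto simp: P_def)
    have primeP: "prime p" if "p \<in> P" for p using that by (simp add: P_def)
    define L where "L = ln (real k)"
    have L1: "L \<ge> 1" unfolding L_def by (rule ln_nat_ge_1[OF k])
    define X where "X = (real N + 1) powr (e + 2 * e)"
    have X1: "X \<ge> 1" unfolding X_def using e by (intro ge_one_powr_ge_zero) auto
    define g where "g = (\<lambda>s u. \<psi> u * of_nat u powr (- s) :: complex)"
    have U: "unit_mult \<psi>" by (rule unit_mult_dchar[OF \<psi>(1)])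
    have g_mult: "g s (m * n) = g s m * g s n" for s m n
      unfolding g_def of_nat_powr_mult dchar_mult[OF \<psi>(1)] by simp
    have g_1: "g s 1 = 1" for s using U by (simp add: g_def unit_mult_def)
    have power_sum: "norm (\<Sum>p\<in>P. g s (p ^ j)) \<le> K * L * X * (1 + norm s) powr e" if s: "Re s = \<sigma>" and j: "j \<ge> 1" for s j
    proof -
      define Y where "Y = (1 + norm s) powr e"
      have Y1: "Y \<ge> 1" unfolding Y_def using e by (intro ge_one_powr_ge_zero) auto
      have "1 * 1 \<le> L * X" using L1 X1 by (intro mult_mono) auto
      then have "1 * 1 \<le> L * X * Y" using Y1 by (intro mult_mono) auto
      then have LXY: "1 \<le> L * X * Y" by simp
      have "norm (\<Sum>p\<in>P. g s (p ^ j)) \<le> (2 * C1) * (L * X * Y) + Z * (L * X * Y)"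
      proof (cases "j = 1")
        case True
        define b where "b = (\<lambda>n. (if prime (Suc n) then \<psi> (Suc n) else 0) * of_nat (Suc n) powr (- s))"
        have b: "norm (\<Sum>n<m. b n) \<le> C1 * (L * X * Y)" if "m \<le> N" for m
        proof -
          have "norm (\<Sum>n<m. b n) \<le> C1 * ln (real k) * (1 + norm s) powr e * (real m + 1) powr (e + 2 * e)"
            unfolding b_def by (rule C1b[OF k \<psi> s])
          also have "\<dots> \<le> C1 * ln (real k) * (1 + norm s) powr e * X"
            unfolding X_def using that e C1 L1 L_def by (intro mult_left_mono powr_mono2) auto
          finally show ?thesis by (simp add: L_def Y_def mult_ac)
        qed
        have "(\<Sum>p\<in>P. g s p) = (\<Sum>p\<in>Suc ` {M..<N}. if prime p then g s p else 0)"
          by (rule sum.mono_neutral_cong_left) (auto simp: P_def image_Suc_atLeastLessThan)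
        also have "\<dots> = (\<Sum>n\<in>{M..<N}. b n)"
          by (subst sum.reindex) (auto simp: b_def g_def intro!: sum.cong)
        also have "\<dots> = (\<Sum>n<N. b n) - (\<Sum>n<M. b n)"
          using MN(1) sum.atLeastLessThan_concat[of 0 M N b] by (simp add: atLeast0LessThan algebra_simps)
        finally have "norm (\<Sum>p\<in>P. g s p) \<le> norm (\<Sum>n<N. b n) + norm (\<Sum>n<M. b n)"
          by (metis norm_triangle_ineq4)
        also have "\<dots> \<le> (2 * C1) * (L * X * Y)" using b[of N] b[OF MN(1)] by simp
        also have "\<dots> \<le> (2 * C1) * (L * X * Y) + Z * (L * X * Y)" using Z0 LXY by simp
        finally show ?thesis using True by simp
      next
        case False
        have "norm (\<Sum>p\<in>P. g s (p ^ j)) \<le> (\<Sum>p\<in>P. real p powr (- (1 + 2 * e)))"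
        proof (rule sum_norm_le)
          fix p assume p: "p \<in> P"
          then obtain n where n: "p = Suc n" using prime_gt_0_nat[OF primeP[OF p]] by (cases p) auto
          have gp: "norm (g s p) \<le> real p powr (- \<sigma>)" using norm_dterm_le[OF U, of n s] s by (simp add: g_def n del: of_nat_Suc)
          have le1: "real p powr (- \<sigma>) \<le> 1" using powr_mono[of "- \<sigma>" 0 "real p"] \<sigma>0 n by simp
          have "g s (p ^ j) = g s p ^ j" by (induction j) (use g_1 in \<open>auto simp: g_mult\<close>)
          then have "norm (g s (p ^ j)) = norm (g s p) ^ j" by (simp add: norm_power)
          also have "\<dots> \<le> (real p powr (- \<sigma>)) ^ j" using gp by (intro power_mono) auto
          also have "\<dots> \<le> (real p powr (- \<sigma>)) ^ 2" using le1 j False by (intro power_decreasing) auto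
          also have "\<dots> = real p powr (- \<sigma> + - \<sigma>)" by (simp only: power2_eq_square powr_add)
          also have "- \<sigma> + - \<sigma> = - (1 + 2 * e)" by (simp add: \<sigma>_def)
          finally show "norm (g s (p ^ j)) \<le> real p powr (- (1 + 2 * e))" .
        qed
        also have "\<dots> = (\<Sum>n\<in>{n. Suc n \<in> P}. real (Suc n) powr (- (1 + 2 * e)))"
        proof -
          have "P - {0} = P" by (auto dest: primeP)
          then show ?thesis
            using sum.reindex_bij_betw[OF bij_betw_Suc[of P], of "\<lambda>p. real p powr (- (1 + 2 * e))"] by simp
        qed
        also have "\<dots> \<le> Z" unfolding Z_def
          by (rule sum_le_suminf[OF sumZ]) (auto intro: finite_subset[of _ "{..N}"] simp: P_def)
        also have "Z * 1 \<le> Z * (L * X * Y)" using Z0 LXY by (intro mult_left_mono)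
        also have "\<dots> \<le> (2 * C1) * (L * X * Y) + Z * (L * X * Y)" using C1 LXY by simp
        finally show ?thesis by simp
      qed
      also have "\<dots> \<le> K * (L * X * Y)" using LXY by (simp add: K_def algebra_simps)
      finally show ?thesis by (simp add: Y_def mult_ac)
    qed
    \<comment> \<open>\<open>V\<close> also contains integers beyond N. They are kept so that the
      polynomial over \<open>V\<close> is a polynomial in power sums; the cutoff at N is made by
      Perron's formula.\<close>
    define V where "V = (\<Union>r\<in>{..R}. prime_products P r)"
    have finV: "finite V" unfolding V_def using finite_prime_products[OF finP] by simp
    have V0: "0 \<notin> V" by (auto simp: V_def prime_products_def)
    define a where "a = (\<lambda>n. if Suc n \<in> V then \<psi> (Suc n) else 0)"
    define A where "A = (\<lambda>s. \<Sum>u\<in>V. g s u)"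
    define F where "F = {n. Suc n \<in> V}"
    have bijF: "bij_betw Suc F V" using bij_betw_Suc[of V] V0 by (simp add: F_def)
    have finF: "finite F" using bij_betw_finite[OF bijF] finV by simp
    define B where "B = (real R + 1) * (K * L * X) ^ R"
    have B0: "B \<ge> 0" unfolding B_def using K1 L1 X1 by simp
    have "norm (\<Sum>n<N. a n) \<le> perron_const \<sigma> (2 * e * real R) * B * (real N + 1) powr (\<sigma> + 2 * e * real R)"
    proof -
      have 1: "summable (\<lambda>n. norm (a n) * real (Suc n) powr (- \<sigma>))"
        by (rule summable_finite[OF finF]) (auto simp: a_def F_def)
      have 2: "A s = (\<Sum>n. a n * of_nat (Suc n) powr (- s))" for s
      proof -
        have "(\<Sum>n. a n * of_nat (Suc n) powr (- s)) = (\<Sum>n\<in>F. a n * of_nat (Suc n) powr (- s))"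
          by (rule suminf_finite[OF finF]) (auto simp: a_def F_def)
        also have "\<dots> = (\<Sum>n\<in>F. g s (Suc n))" by (rule sum.cong) (auto simp: a_def F_def g_def)
        also have "\<dots> = A s" unfolding A_def by (rule sum.reindex_bij_betw[OF bijF])
        finally show ?thesis by simp
      qed
      have "(\<lambda>s. g s u) holomorphic_on {s. Re s > 0}" if "u \<in> V" for u
        using that V0 of_nat_powr_holomorphic[of "u - 1"] unfolding g_def by (cases u) (auto intro!: holomorphic_intros)
      then have 3: "A holomorphic_on {s. Re s > 0}" unfolding A_def by (intro holomorphic_on_sum)
      have 4: "norm (A s) \<le> B * (1 + norm s) powr (2 * e * real R / 2)" if "\<sigma> \<le> Re s" "Re s \<le> \<sigma>" for s
      proof -
        have s: "Re s = \<sigma>" using that by simp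
        define b where "b = K * L * X * (1 + norm s) powr e"
        have "1 * 1 \<le> K * L" using K1 L1 by (intro mult_mono) auto
        then have "1 * 1 \<le> K * L * X" using X1 by (intro mult_mono) auto
        moreover have "(1 + norm s) powr e \<ge> 1" using e by (intro ge_one_powr_ge_zero) auto
        ultimately have "1 * 1 \<le> b" unfolding b_def by (intro mult_mono) auto
        then have b1: "b \<ge> 1" by simp
        have "A s = (\<Sum>r\<le>R. sum (g s) (prime_products P r))" unfolding A_def V_def
          by (rule sum.UNION_disjoint) (use finite_prime_products[OF finP] in \<open>auto simp: prime_products_def\<close>)
        also have "norm \<dots> \<le> (\<Sum>r\<le>R. b ^ R)"
        proof (rule sum_norm_le)
          fix r assume r: "r \<in> {..R}"
          have "norm (sum (g s) (prime_products P r)) \<le> b ^ r"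
            by (rule norm_prime_products_le[OF finP primeP g_mult g_1 b1]) (use power_sum[OF s] in \<open>auto simp: b_def\<close>)
          also have "\<dots> \<le> b ^ R" using b1 r by (intro power_increasing) auto
          finally show "norm (sum (g s) (prime_products P r)) \<le> b ^ R" .
        qed
        also have "\<dots> = (real R + 1) * b ^ R" by simp
        also have "b ^ R = (K * L * X) ^ R * ((1 + norm s) powr e) ^ R" by (simp add: b_def power_mult_distrib)
        also have "((1 + norm s) powr e) ^ R = (1 + norm s) powr (2 * e * real R / 2)"
        proof -
          have "1 + norm s > 0" by (simp add: add_pos_nonneg)
          then show ?thesis by (simp add: powr_realpow[symmetric] powr_powr)
        qed
        finally show ?thesis by (simp add: B_def mult.assoc)
      qed
      show ?thesis
        by (rule perron_bound[where c=\<sigma> and A=A and ?\<sigma>0.0=0, OF \<sigma>0 _ _ _ _ B0 1 2 3 4]) (use \<sigma>0 eR R MN in auto)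
    qed
    also have "\<dots> = C * L ^ R * (X ^ R * (real N + 1) powr (\<sigma> + 2 * e * real R))"
      by (simp add: B_def C_def power_mult_distrib mult_ac)
    \<comment> \<open>The exponent is made up of 1/2 + e from the line, 3 e R from the R prime
      polynomials and 2 e R from Perron's formula.\<close>
    also have "X ^ R * (real N + 1) powr (\<sigma> + 2 * e * real R) = (real N + 1) powr (1/2 + e + 5 * e * real R)"
    proof -
      have "X ^ R = (real N + 1) powr ((e + 2 * e) * real R)"
        unfolding X_def by (simp add: powr_realpow[symmetric] powr_powr)
      then show ?thesis by (simp add: \<sigma>_def powr_add[symmetric] algebra_simps)
    qed
    also have "(\<Sum>n<N. a n) = (\<Sum>u | 1 \<le> u \<and> u \<le> N \<and> (\<forall>p. prime p \<longrightarrow> p dvd u \<longrightarrow> M < p). \<psi> u)"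
    proof -
      have V_iff: "u \<in> V \<longleftrightarrow> (\<forall>p. prime p \<longrightarrow> p dvd u \<longrightarrow> M < p)" if u: "1 \<le> u" "u \<le> N" for u
      proof
        assume "u \<in> V"
        then have "prime_factors u \<subseteq> P" by (auto simp: V_def prime_products_def)
        then show "\<forall>p. prime p \<longrightarrow> p dvd u \<longrightarrow> M < p" using u by (auto simp: P_def in_prime_factors_iff)
      next
        assume a: "\<forall>p. prime p \<longrightarrow> p dvd u \<longrightarrow> M < p"
        have "size (prime_factorization u) \<le> R" by (rule rough_size_le[OF u _ NR]) (use a in auto)
        moreover have "prime_factors u \<subseteq> P" using a u by (auto simp: P_def in_prime_factors_iff intro: order_trans[OF dvd_imp_le])
        ultimately show "u \<in> V" using u by (auto simp: V_def prime_products_def)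
      qed
      have "(\<Sum>n<N. a n) = (\<Sum>u\<in>{1..N}. if u \<in> V then \<psi> u else 0)"
        by (simp add: a_def sum.atLeast1_atMost_eq)
      also have "\<dots> = (\<Sum>u\<in>{u\<in>{1..N}. u \<in> V}. \<psi> u)" by (rule sum.inter_filter[symmetric]) simp
      also have "{u\<in>{1..N}. u \<in> V} = {u. 1 \<le> u \<and> u \<le> N \<and> (\<forall>p. prime p \<longrightarrow> p dvd u \<longrightarrow> M < p)}"
        using V_iff by auto
      finally show ?thesis .
    qed
    finally show "norm (\<Sum>u | 1 \<le> u \<and> u \<le> N \<and> (\<forall>p. prime p \<longrightarrow> p dvd u \<longrightarrow> M < p). \<psi> u)
        \<le> C * ln (real k) ^ R * (real N + 1) powr (1/2 + e + 5 * e * real R)" by (simp add: L_def)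
  qed
qed

section \<open>Counting with characters\<close>

lemma card_dchars: "k > 1 \<Longrightarrow> card {\<psi>. dirichlet_character k \<psi>} = totient k"
proof -
  assume k: "k > 1"
  let ?X = "{\<psi>. dirichlet_character k \<psi>}"
  have "of_nat (card ?X) = (\<Sum>\<psi>\<in>?X. \<psi> (Suc 0) :: complex)"
    by (simp add: dchar_1)
  also have "\<dots> = of_nat (totient k)" using sum_dchars[of k "Suc 0"] k by simp
  finally show ?thesis by (simp only: of_nat_eq_iff)
qed

text \<open>The congruence is detected by averaging \<psi> (b u v) over all characters, where b is
  inverse to a modulo k. The principal character gives the main term. The others number at most
  \<open>totient k\<close> and contribute at most X each, so after division by
  \<open>totient k\<close> the error is X.\<close>

lemma card_product_congruence:
  fixes U V :: "nat set" and a :: int and X :: real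
  assumes k: "k > 1" and a: "coprime a (int k)" and fin: "finite U" "finite V"
    and X: "\<And>\<psi>. dirichlet_character k \<psi> \<Longrightarrow> \<psi> \<noteq> principal_char k \<Longrightarrow> norm ((\<Sum>u\<in>U. \<psi> u) * (\<Sum>v\<in>V. \<psi> v)) \<le> X"
    and X0: "X \<ge> 0"
  shows "\<bar>real (card {(u, v). u \<in> U \<and> v \<in> V \<and> [int u * int v = a] (mod int k)})
     - real (card {v\<in>V. coprime v k}) / real (totient k) * real (card {u\<in>U. coprime u k})\<bar> \<le> X"
proof -
  \<comment> \<open>Characters live on natural numbers, so the integer a is replaced by its residue.
    Below, \<psi> b for an inverse b plays the part of the conjugate of \<psi> a'.\<close>
  define a' where "a' = nat (a mod int k)"
  have a': "[int a' = a] (mod int k)" using k by (simp add: a'_def cong_def)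
  have "coprime (int a') (int k)" by (rule cong_imp_coprime[OF cong_sym[OF a'] a])
  then have ca: "coprime a' k" by simp
  obtain b where "[a' * b = Suc 0] (mod k)" using cong_solve_coprime_nat[OF ca] by blast
  then have b: "[a' * b = 1] (mod k)" by simp
  have "coprime (a' * b) k" by (rule cong_imp_coprime[OF cong_sym[OF b]]) simp
  then have cb: "coprime b k" by simp
  define Y where "Y = {\<psi>. dirichlet_character k \<psi>}"
  define \<phi> where "\<phi> = totient k"
  have \<phi>0: "\<phi> > 0" using k by (simp add: \<phi>_def)
  define S where "S = (\<lambda>\<psi> :: nat \<Rightarrow> complex. \<Sum>u\<in>U. \<psi> u)"
  define T where "T = (\<lambda>\<psi> :: nat \<Rightarrow> complex. \<Sum>v\<in>V. \<psi> v)"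
  define J where "J = {(u, v). u \<in> U \<and> v \<in> V \<and> [int u * int v = a] (mod int k)}"
  have ind: "(\<Sum>\<psi>\<in>Y. \<psi> b * \<psi> u * \<psi> v) = (if [int u * int v = a] (mod int k) then of_nat \<phi> else 0)" for u v
  proof (cases "coprime (u * v) k")
    case True
    have "[int u * int v = a] (mod int k) \<longleftrightarrow> [u * v = a'] (mod k)"
    proof -
      have "[int u * int v = a] (mod int k) \<longleftrightarrow> [int (u * v) = int a'] (mod int k)"
        using a' by (simp add: cong_def)
      then show ?thesis by (simp only: cong_int_iff)
    qed
    also have "\<dots> \<longleftrightarrow> [b * (u * v) = b * a'] (mod k)" using cong_mult_lcancel_nat[OF cb] by simp
    also have "\<dots> \<longleftrightarrow> [b * (u * v) = 1] (mod k)" using b by (simp add: cong_def mult.commute)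
    finally have iff: "[int u * int v = a] (mod int k) \<longleftrightarrow> [b * (u * v) = 1] (mod k)" .
    have "(\<Sum>\<psi>\<in>Y. \<psi> b * \<psi> u * \<psi> v) = (\<Sum>\<psi>\<in>Y. \<psi> (b * (u * v)))"
      by (rule sum.cong) (auto simp: Y_def dchar_mult mult.assoc)
    also have "\<dots> = (if [b * (u * v) = 1] (mod k) then of_nat \<phi> else 0)"
      unfolding Y_def \<phi>_def by (rule sum_dchars[OF k]) (use cb True in simp)
    finally show ?thesis using iff by simp
  next
    case False
    then have "(\<Sum>\<psi>\<in>Y. \<psi> b * \<psi> u * \<psi> v) = 0"
      using dchar_eq_0_iff by (intro sum.neutral) (auto simp: Y_def)
    moreover have "\<not> [int u * int v = a] (mod int k)"
    proof
      assume "[int u * int v = a] (mod int k)"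
      then have "coprime (int u * int v) (int k)" by (intro cong_imp_coprime[OF cong_sym a])
      then have "coprime (int (u * v)) (int k)" by simp
      then show False using False by (simp only: coprime_int_iff)
    qed
    ultimately show ?thesis by simp
  qed
  have "of_nat \<phi> * of_nat (card J) = (\<Sum>(u, v)\<in>U \<times> V. if [int u * int v = a] (mod int k) then of_nat \<phi> else (0::complex))"
  proof -
    have "J = {w \<in> U \<times> V. case w of (u, v) \<Rightarrow> [int u * int v = a] (mod int k)}" by (auto simp: J_def)
    then have "(\<Sum>w\<in>J. of_nat \<phi>) = (\<Sum>w\<in>U \<times> V. if (case w of (u, v) \<Rightarrow> [int u * int v = a] (mod int k)) then of_nat \<phi> else (0::complex))"
      by (simp only: sum.inter_filter[OF finite_cartesian_product[OF fin]])
    also have "\<dots> = (\<Sum>(u, v)\<in>U \<times> V. if [int u * int v = a] (mod int k) then of_nat \<phi> else (0::complex))"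
      by (rule sum.cong) auto
    finally show ?thesis by (simp add: mult.commute)
  qed
  also have "\<dots> = (\<Sum>(u, v)\<in>U \<times> V. \<Sum>\<psi>\<in>Y. \<psi> b * \<psi> u * \<psi> v)" by (simp only: ind)
  also have "\<dots> = (\<Sum>u\<in>U. \<Sum>v\<in>V. \<Sum>\<psi>\<in>Y. \<psi> b * \<psi> u * \<psi> v)" by (rule sum.cartesian_product[symmetric])
  also have "\<dots> = (\<Sum>\<psi>\<in>Y. \<psi> b * (S \<psi> * T \<psi>))"
  proof -
    have "(\<Sum>u\<in>U. \<Sum>v\<in>V. \<Sum>\<psi>\<in>Y. \<psi> b * \<psi> u * \<psi> v) = (\<Sum>u\<in>U. \<Sum>\<psi>\<in>Y. \<Sum>v\<in>V. \<psi> b * \<psi> u * \<psi> v)"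
      by (intro sum.cong refl sum.swap)
    also have "\<dots> = (\<Sum>\<psi>\<in>Y. \<Sum>u\<in>U. \<Sum>v\<in>V. \<psi> b * \<psi> u * \<psi> v)" by (rule sum.swap)
    also have "\<dots> = (\<Sum>\<psi>\<in>Y. \<psi> b * (S \<psi> * T \<psi>))"
    proof (rule sum.cong[OF refl])
      fix \<psi> :: "nat \<Rightarrow> complex"
      have "S \<psi> * T \<psi> = (\<Sum>u\<in>U. \<Sum>v\<in>V. \<psi> u * \<psi> v)" unfolding S_def T_def by (rule sum_product)
      then show "(\<Sum>u\<in>U. \<Sum>v\<in>V. \<psi> b * \<psi> u * \<psi> v) = \<psi> b * (S \<psi> * T \<psi>)"
        by (simp only: sum_distrib_left mult.assoc)
    qed
    finally show ?thesis .
  qed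
  also have "\<dots> = principal_char k b * (S (principal_char k) * T (principal_char k)) + (\<Sum>\<psi>\<in>Y - {principal_char k}. \<psi> b * (S \<psi> * T \<psi>))"
    by (rule sum.remove) (use dchar_principal k finite_dchars in \<open>auto simp: Y_def\<close>)
  also have "principal_char k b = 1" using cb by (simp add: principal_char_def)
  also have "S (principal_char k) = of_nat (card {u\<in>U. coprime u k})"
    using fin by (simp add: S_def principal_char_def sum.If_cases Int_def)
  also have "T (principal_char k) = of_nat (card {v\<in>V. coprime v k})"
    using fin by (simp add: T_def principal_char_def sum.If_cases Int_def)
  finally have E: "of_nat \<phi> * of_nat (card J) = 1 * (of_nat (card {u\<in>U. coprime u k}) * of_nat (card {v\<in>V. coprime v k}))
     + (\<Sum>\<psi>\<in>Y - {principal_char k}. \<psi> b * (S \<psi> * T \<psi>))" .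
  have "\<bar>real \<phi> * real (card J) - real (card {u\<in>U. coprime u k}) * real (card {v\<in>V. coprime v k})\<bar>
     = norm (of_nat \<phi> * of_nat (card J) - of_nat (card {u\<in>U. coprime u k}) * of_nat (card {v\<in>V. coprime v k}) :: complex)"
  proof -
    have "of_nat \<phi> * of_nat (card J) - of_nat (card {u\<in>U. coprime u k}) * of_nat (card {v\<in>V. coprime v k})
      = complex_of_real (real \<phi> * real (card J) - real (card {u\<in>U. coprime u k}) * real (card {v\<in>V. coprime v k}))"
      by simp
    then show ?thesis by (simp only: norm_of_real)
  qed
  also have "\<dots> \<le> (\<Sum>\<psi>\<in>Y - {principal_char k}. X)"
    unfolding E mult_1 add_diff_cancel_left'
  proof (rule sum_norm_le)
    fix \<psi> assume "\<psi> \<in> Y - {principal_char k}"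
    then have \<psi>: "dirichlet_character k \<psi>" "\<psi> \<noteq> principal_char k" by (auto simp: Y_def)
    have "norm (\<psi> b * (S \<psi> * T \<psi>)) \<le> 1 * norm (S \<psi> * T \<psi>)"
      unfolding norm_mult[of "\<psi> b"] by (intro mult_right_mono norm_dchar_le_1[OF \<psi>(1)]) simp
    also have "\<dots> \<le> X" using X[OF \<psi>] by (simp add: S_def T_def)
    finally show "norm (\<psi> b * (S \<psi> * T \<psi>)) \<le> X" .
  qed
  also have "\<dots> \<le> real \<phi> * X"
  proof -
    have "card (Y - {principal_char k}) \<le> card Y" by (rule card_mono) (use finite_dchars in \<open>auto simp: Y_def\<close>)
    then have "card (Y - {principal_char k}) \<le> \<phi>" using card_dchars[OF k] by (simp add: Y_def \<phi>_def)
    then show ?thesis using X0 by (simp add: mult_right_mono)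
  qed
  finally have le: "\<bar>real \<phi> * real (card J) - real (card {u\<in>U. coprime u k}) * real (card {v\<in>V. coprime v k})\<bar> \<le> real \<phi> * X" .
  have "real (card J) - real (card {v\<in>V. coprime v k}) / real \<phi> * real (card {u\<in>U. coprime u k})
     = (real \<phi> * real (card J) - real (card {u\<in>U. coprime u k}) * real (card {v\<in>V. coprime v k})) / real \<phi>"
    using \<phi>0 by (simp add: field_simps)
  then have "\<bar>real (card J) - real (card {v\<in>V. coprime v k}) / real \<phi> * real (card {u\<in>U. coprime u k})\<bar>
     = \<bar>real \<phi> * real (card J) - real (card {u\<in>U. coprime u k}) * real (card {v\<in>V. coprime v k})\<bar> / real \<phi>"
    by (simp add: abs_divide)
  also have "\<dots> \<le> X" using le \<phi>0 by (simp add: field_simps)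
  finally show ?thesis by (simp add: J_def \<phi>_def)
qed

text \<open>The i-th smallest element is at least i + 1, so the product is at least the telescoping
  product of i / (i + 1). The induction adds the largest element last.\<close>

lemma prod_1_minus_inverse_ge:
  fixes A :: "nat set"
  assumes "finite A" "\<And>p. p \<in> A \<Longrightarrow> p \<ge> 2"
  shows "(\<Prod>p\<in>A. 1 - 1 / real p) \<ge> 1 / real (card A + 1)"
  using assms
proof (induction A rule: finite_linorder_max_induct)
  case (insert b A)
  have "A \<subseteq> {2..<b}" using insert.hyps insert.prems by auto
  then have "card A \<le> b - 2" using card_mono[of "{2..<b}" A] by simp
  moreover have "b \<ge> 2" using insert.prems by simp
  ultimately have b: "real b \<ge> real (card A) + 2" by linarith
  have "b \<notin> A" using insert.hyps by auto
  have "1 / real (card (insert b A) + 1) = (1 - 1 / (real (card A) + 2)) * (1 / real (card A + 1))"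
    using \<open>b \<notin> A\<close> insert.hyps by (simp add: field_simps)
  also have "\<dots> \<le> (1 - 1 / real b) * (\<Prod>p\<in>A. 1 - 1 / real p)"
  proof (rule mult_mono)
    show "1 - 1 / (real (card A) + 2) \<le> 1 - 1 / real b" using b by (simp add: frac_le)
    show "1 / real (card A + 1) \<le> (\<Prod>p\<in>A. 1 - 1 / real p)" using insert by auto
  qed (use \<open>b \<ge> 2\<close> in auto)
  also have "\<dots> = (\<Prod>p\<in>insert b A. 1 - 1 / real p)" using \<open>b \<notin> A\<close> insert.hyps by simp
  finally show ?case .
qed simp

lemma card_prime_factors_le: "k > 0 \<Longrightarrow> real (card (prime_factors k)) \<le> log 2 (real k)" for k :: nat
proof -
  assume k: "k > 0"
  have "2 ^ card (prime_factors k) \<le> (2::nat) ^ size (prime_factorization k)"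
  proof (intro power_increasing)
    have "card (set_mset M) \<le> size M" for M :: "nat multiset"
      by (induction M) (auto simp: card_insert_if le_SucI)
    then show "card (prime_factors k) \<le> size (prime_factorization k)" .
  qed simp
  also have "\<dots> \<le> prod_mset (prime_factorization k)"
    by (rule power_size_le_prod_mset) (auto simp: in_prime_factors_iff prime_ge_2_nat)
  also have "\<dots> = k" using k by (simp add: prod_mset_prime_factorization_nat)
  finally have "real (2 ^ card (prime_factors k)) \<le> real k" by (simp only: of_nat_le_iff)
  then show ?thesis using k by (simp add: le_log_iff powr_realpow)
qed

text \<open>At most log 2 k primes divide k, so the preceding product bounds k /
  \<open>totient k\<close> by a logarithm; a loss of this size is harmless.\<close>

lemma totient_lower_bound:
  fixes k :: nat assumes k: "k > 0"
  shows "real k \<le> real (totient k) * (1 + log 2 (real k))"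
proof -
  have "real k * (1 / (1 + log 2 (real k))) \<le> real k * (1 / real (card (prime_factors k) + 1))"
    using card_prime_factors_le[OF k] by (intro mult_left_mono frac_le) auto
  also have "\<dots> \<le> real k * (\<Prod>p\<in>prime_factors k. 1 - 1 / real p)"
    by (intro mult_left_mono prod_1_minus_inverse_ge) (auto simp: in_prime_factors_iff prime_ge_2_nat)
  also have "\<dots> = real (totient k)" by (rule totient_formula2[symmetric])
  finally have "real k / (1 + log 2 (real k)) \<le> real (totient k)" by simp
  moreover have "1 + log 2 (real k) > 0" using k by (simp add: add_pos_nonneg zero_le_log_cancel_iff)
  ultimately show ?thesis by (simp add: pos_divide_le_eq)
qed

text \<open>A prime common to u and k is at least z by roughness, so it has at most x / z multiples
  up to x, and k has at most log 2 k prime factors.\<close>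

lemma card_noncoprime_rough_le:
  fixes x z :: real
  assumes k: "k > 0" and z: "z > 0" and x: "x \<ge> 0"
    and U: "\<And>u. u \<in> U \<Longrightarrow> 1 \<le> u \<and> real u \<le> x \<and> (\<forall>p. prime p \<longrightarrow> p dvd u \<longrightarrow> z \<le> real p)"
  shows "real (card {u\<in>U. \<not> coprime u k}) \<le> log 2 (real k) * (x / z)"
proof -
  define N where "N = nat \<lfloor>x\<rfloor>"
  define Q where "Q = {p \<in> prime_factors k. z \<le> real p}"
  have finQ: "finite Q" by (simp add: Q_def)
  define m where "m = (\<lambda>p. (*) p ` {1..N div p})"
  have sub: "{u\<in>U. \<not> coprime u k} \<subseteq> (\<Union>p\<in>Q. m p)"
  proof
    fix u assume u: "u \<in> {u\<in>U. \<not> coprime u k}"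
    then obtain p where p: "prime p" "p dvd gcd u k" by (metis (no_types, lifting) coprime_iff_gcd_eq_1 mem_Collect_eq prime_factor_nat)
    then have "p \<in> Q" using U[of u] u k by (auto simp: Q_def in_prime_factors_iff)
    obtain w where w: "u = p * w" using p by auto
    have "u \<le> N" "1 \<le> u" using U[of u] u by (auto simp: N_def le_nat_floor)
    then have "w \<in> {1..N div p}" using w p(1) prime_gt_0_nat[of p] by (auto simp: less_eq_div_iff_mult_less_eq mult.commute)
    then show "u \<in> (\<Union>p\<in>Q. m p)" using \<open>p \<in> Q\<close> w by (intro UN_I[of p]) (auto simp: m_def)
  qed
  have "card {u\<in>U. \<not> coprime u k} \<le> card (\<Union>p\<in>Q. m p)" by (rule card_mono[OF _ sub]) (use finQ in \<open>auto simp: m_def\<close>)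
  also have "\<dots> \<le> (\<Sum>p\<in>Q. card (m p))" by (rule card_UN_le[OF finQ])
  finally have "real (card {u\<in>U. \<not> coprime u k}) \<le> (\<Sum>p\<in>Q. real (card (m p)))" by (simp flip: of_nat_sum)
  also have "\<dots> \<le> (\<Sum>p\<in>Q. x / z)"
  proof (rule sum_mono)
    fix p assume p: "p \<in> Q"
    have "card (m p) \<le> N div p" unfolding m_def using card_image_le[of "{1..N div p}" "(*) p"] by simp
    then have "card (m p) * p \<le> N div p * p" by simp
    also have "\<dots> \<le> N" by (rule div_times_less_eq_dividend)
    finally have "real (card (m p)) * real p \<le> real N" by (simp flip: of_nat_mult)
    moreover have "p > 0" using p prime_gt_0_nat by (auto simp: Q_def in_prime_factors_iff)
    ultimately have "real (card (m p)) \<le> real N / real p" by (simp add: pos_le_divide_eq)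
    also have "\<dots> \<le> x / z" using p z x by (intro frac_le) (auto simp: N_def Q_def)
    finally show "real (card (m p)) \<le> x / z" .
  qed
  also have "\<dots> = real (card Q) * (x / z)" by simp
  also have "\<dots> \<le> log 2 (real k) * (x / z)"
  proof (rule mult_right_mono)
    have "card Q \<le> card (prime_factors k)" unfolding Q_def by (rule card_mono) auto
    then show "real (card Q) \<le> log 2 (real k)" using card_prime_factors_le[OF k] by simp
  qed (use x z in auto)
  finally show ?thesis .
qed

lemma le_P_minus_iff:
  assumes "u \<ge> 2"
  shows "ereal z \<le> P_minus u \<longleftrightarrow> (\<forall>p. prime p \<longrightarrow> p dvd u \<longrightarrow> z \<le> real p)"
proof -
  have ne: "prime_factors u \<noteq> {}" using assms by (auto simp: prime_factorization_empty_iff)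
  have "z \<le> real (Min (prime_factors u)) \<longleftrightarrow> (\<forall>p\<in>prime_factors u. z \<le> real p)"
  proof
    assume z: "z \<le> real (Min (prime_factors u))"
    show "\<forall>p\<in>prime_factors u. z \<le> real p"
    proof
      fix p assume "p \<in> prime_factors u"
      then have "Min (prime_factors u) \<le> p" by simp
      then show "z \<le> real p" using z by linarith
    qed
  qed (use Min_in[OF _ ne] in auto)
  then show ?thesis using assms by (auto simp: P_minus_def in_prime_factors_iff)
qed

text \<open>The quantifier over k stands inside the eventuality: k is bounded by a fixed power of x,
  so one threshold for x serves all moduli.\<close>

lemma eventually_log_le_powr:
  fixes c \<theta> d :: real
  assumes "c > 0" "d > 0"
  shows "\<forall>\<^sub>F x in at_top. \<forall>k::nat. k > 2 \<and> real k \<le> c * x powr \<theta> \<longrightarrow> 1 + log 2 (real k) \<le> x powr d"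
proof -
  have "((\<lambda>x. (1 + log 2 c + \<theta> * log 2 x) / x powr d) \<longlongrightarrow> 0) at_top"
    using assms(2) by real_asymp
  then have "\<forall>\<^sub>F x in at_top. (1 + log 2 c + \<theta> * log 2 x) / x powr d < 1"
    by (rule order_tendstoD) simp
  then show ?thesis using eventually_gt_at_top[of 0]
  proof eventually_elim
    case (elim x)
    show ?case
    proof (intro allI impI)
      fix k :: nat assume k: "k > 2 \<and> real k \<le> c * x powr \<theta>"
      then have "log 2 (real k) \<le> log 2 (c * x powr \<theta>)" using assms(1) elim by (subst log_le_cancel_iff) auto
      also have "\<dots> = log 2 c + \<theta> * log 2 x" using assms(1) elim by (simp add: log_mult log_powr)
      finally show "1 + log 2 (real k) \<le> x powr d" using elim by (simp add: pos_divide_less_eq)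
    qed
  qed
qed

lemma card_primes_le: "y \<ge> 0 \<Longrightarrow> finite {v::nat. prime v \<and> real v \<le> y}"
  "y \<ge> 0 \<Longrightarrow> real (card (primes_coprime_upto k y)) \<le> y"
proof -
  assume y: "y \<ge> 0"
  have sub: "{v::nat. prime v \<and> real v \<le> y} \<subseteq> {1..nat \<lfloor>y\<rfloor>}"
    by (auto simp: le_nat_floor prime_gt_0_nat Suc_le_eq)
  then show "finite {v::nat. prime v \<and> real v \<le> y}" by (rule finite_subset) simp
  have "card (primes_coprime_upto k y) \<le> card {1..nat \<lfloor>y\<rfloor>}"
    by (rule card_mono) (use sub in \<open>auto simp: primes_coprime_upto_def\<close>)
  then show "real (card (primes_coprime_upto k y)) \<le> y" using y by simp linarith
qed

section \<open>Choice of the parameters and the final estimate\<close>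

theorem theorem2p2:
  fixes \<theta>1 \<theta>2 \<beta> :: real
  assumes "GRH"
    and "\<theta>1 > 0" and "\<theta>2 > 0"
    and "\<theta>2 < min ((1 + \<theta>1) / 2) ((2 + 3 * \<theta>1) / 5)"
    and "0 < \<beta>" and "\<beta> \<le> 1 / 2"
    and "\<beta> < 1 + 2 * (\<theta>1 - \<theta>2)"
  shows "\<exists>\<epsilon>0 > 0. \<forall>\<epsilon>. 0 < \<epsilon> \<and> \<epsilon> < \<epsilon>0 \<longrightarrow>
    (\<forall>c1 > 0. \<forall>c2 > 0. \<exists>(C :: real) (\<eta> :: real \<Rightarrow> real).
       (\<eta> \<longlongrightarrow> 0) at_top \<and>
       (\<forall>\<^sub>F x in at_top. \<forall>(k :: nat) (a :: int).
          k > 2 \<and> c1 * x powr \<theta>2 \<le> real k \<and> real k \<le> c2 * x powr \<theta>2 \<and> coprime a (int k) \<longrightarrow>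
          \<bar>real (N_count k a x (x powr \<theta>1) (x powr \<beta>))
             - real (card (primes_coprime_upto k (x powr \<theta>1))) / real (totient k)
                 * real (rough_count x (x powr \<beta>))\<bar>
          \<le> C * (x powr (1 - \<epsilon> + \<eta> x) * x powr \<theta>1 / real k)))"
proof -
  \<comment> \<open>The margin: 1 + \<theta>1 - \<theta>2, the exponent of x y / k, equals (1 +
    \<theta>1) / 2 + \<kappa>.\<close>
  define \<kappa> where "\<kappa> = 1/2 + \<theta>1 / 2 - \<theta>2"
  have \<kappa>: "\<kappa> > 0" using assms(4) by (simp add: \<kappa>_def)
  \<comment> \<open>With \<beta> R \<ge> 1, a product of R + 1 primes that are at least x powr
    \<beta> exceeds x.\<close>
  define R where "R = nat \<lceil>1 / \<beta>\<rceil>"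
  have "1 / \<beta> \<ge> 2" using assms(5,6) by (simp add: field_simps)
  then have R: "R \<ge> 2" "real R \<ge> 1 / \<beta>" unfolding R_def by linarith+
  have R\<beta>: "\<beta> * real R \<ge> 1" using R(2) assms(5) by (simp add: field_simps)
  \<comment> \<open>The total coefficient of e in p + \<theta>1 * q, the exponent of the product of
    the two character sums. Hence the choice of e, whose other bound provides 2 e R \<le> 1 for
    \<open>rough_sum_bound\<close>.\<close>
  define W where "W = 1 + 5 * real R + 3 * \<theta>1"
  have W: "W > 0" using assms(2) by (simp add: W_def)
  define e where "e = min (1 / (4 * real R)) (\<kappa> / (8 * W))"
  have e: "0 < e" "2 * e * real R \<le> 1" "e * W \<le> \<kappa> / 8" "e < 1/2"
  proof -
    have e1: "e \<le> 1 / (4 * real R)" and e2: "e \<le> \<kappa> / (8 * W)" by (auto simp: e_def)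
    show "0 < e" using R \<kappa> W by (simp add: e_def)
    show "2 * e * real R \<le> 1" using e1 R by (simp add: field_simps)
    show "e * W \<le> \<kappa> / 8" using e2 W by (simp add: field_simps)
    have "1 / (4 * real R) \<le> 1 / 8" using R by (intro divide_left_mono) auto
    then show "e < 1/2" using e1 by simp
  qed
  \<comment> \<open>A logarithm of k costs x powr d. The character sums carry R + 1 of them, paid
    from \<kappa>; the correction of the main term carries two, paid from \<beta>.\<close>
  define d where "d = min (\<beta> / 4) (\<kappa> / (8 * (real R + 1)))"
  have d: "d > 0" "2 * d \<le> \<beta> / 2" "d * (real R + 1) \<le> \<kappa> / 8"
  proof -
    show "d > 0" using assms(5) \<kappa> by (simp add: d_def)
    have "d \<le> \<beta> / 4" unfolding d_def by (rule min.cobounded1)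
    then show "2 * d \<le> \<beta> / 2" by simp
    have "d \<le> \<kappa> / (8 * (real R + 1))" by (simp add: d_def)
    then show "d * (real R + 1) \<le> \<kappa> / 8" by (simp add: field_simps)
  qed
  \<comment> \<open>\<beta> / 2 is what the correction of the main term leaves of its saving x powr
    \<beta>; \<kappa> / 2 is less than the 3 \<kappa> / 4 left after the losses in e and d.\<close>
  define \<epsilon>0 where "\<epsilon>0 = min (\<beta> / 2) (\<kappa> / 2)"
  have \<epsilon>0: "\<epsilon>0 > 0" using assms(5) \<kappa> by (simp add: \<epsilon>0_def)
  define p where "p = 1/2 + e + 5 * e * real R"
  define q where "q = 1/2 + e + 2 * e"
  have pq: "p > 0" "q > 0" unfolding p_def q_def using e by (auto intro!: add_pos_nonneg)
  have half: "0 < 1/2 + e" "1/2 + e \<le> 2" using e by auto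
  obtain C2 where C2: "C2 \<ge> 0" and T_bound: "\<And>k \<psi> N. k > 2 \<Longrightarrow> dirichlet_character k \<psi> \<Longrightarrow> \<psi> \<noteq> principal_char k \<Longrightarrow>
      norm (\<Sum>n<N. if prime (Suc n) then \<psi> (Suc n) else 0) \<le> C2 * ln (real k) * (real N + 1) powr q"
  proof -
    obtain C where C: "C \<ge> 0" "\<And>k \<psi> s N. k > 2 \<Longrightarrow> dirichlet_character k \<psi> \<Longrightarrow> \<psi> \<noteq> principal_char k \<Longrightarrow>
      Re s \<ge> 0 \<Longrightarrow> Re s + (1/2 + e) \<ge> 1/2 + e \<Longrightarrow>
      norm (\<Sum>n<N. (if prime (Suc n) then \<psi> (Suc n) else 0) * of_nat (Suc n) powr (- s))
        \<le> C * ln (real k) * (1 + norm s) powr e * (real N + 1) powr (1/2 + e + 2 * e)"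
      using prime_sum_bound[OF assms(1) e(1,4) half] by blast
    show ?thesis
    proof (rule that[OF C(1)])
      fix k \<psi> N assume k: "k > 2" "dirichlet_character k \<psi>" "\<psi> \<noteq> principal_char k"
      show "norm (\<Sum>n<N. if prime (Suc n) then \<psi> (Suc n) else 0) \<le> C * ln (real k) * (real N + 1) powr q"
        using C(2)[OF k, of 0 N] by (simp add: q_def del: of_nat_Suc)
    qed
  qed
  have R1: "R \<ge> 1" using R by simp
  obtain C3 where C3: "C3 \<ge> 0" and S_bound: "\<And>k \<psi> N M. k > 2 \<Longrightarrow> dirichlet_character k \<psi> \<Longrightarrow> \<psi> \<noteq> principal_char k \<Longrightarrow>
      M \<le> N \<Longrightarrow> 1 \<le> N \<Longrightarrow> N < (M + 1) ^ (R + 1) \<Longrightarrow>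
      norm (\<Sum>u | 1 \<le> u \<and> u \<le> N \<and> (\<forall>p. prime p \<longrightarrow> p dvd u \<longrightarrow> M < p). \<psi> u) \<le> C3 * ln (real k) ^ R * (real N + 1) powr p"
    using rough_sum_bound[OF assms(1) e(1,4) R1 e(2)] unfolding p_def by blast
  define K where "K = (C3 + 1) * C2 * (2 powr p * 2 powr q)"
  have K0: "K \<ge> 0" using C2 C3 by (simp add: K_def)
  have main: "\<forall>\<^sub>F x in at_top. \<forall>(k :: nat) (a :: int).
          k > 2 \<and> c1 * x powr \<theta>2 \<le> real k \<and> real k \<le> c2 * x powr \<theta>2 \<and> coprime a (int k) \<longrightarrow>
          \<bar>real (N_count k a x (x powr \<theta>1) (x powr \<beta>))
             - real (card (primes_coprime_upto k (x powr \<theta>1))) / real (totient k)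
                 * real (rough_count x (x powr \<beta>))\<bar>
          \<le> (K * c2 + 1) * (x powr (1 - \<epsilon> + 0) * x powr \<theta>1 / real k)"
    if \<epsilon>: "0 < \<epsilon>" "\<epsilon> < \<epsilon>0" and c: "c1 > 0" "c2 > 0" for \<epsilon> c1 c2 :: real
    using eventually_log_le_powr[OF c(2) d(1), of \<theta>2] eventually_gt_at_top[of 2]
  proof eventually_elim
    case (elim x)
    then have x: "x > 2" by simp
    define y where "y = x powr \<theta>1"
    define z where "z = x powr \<beta>"
    have y1: "y \<ge> 1" unfolding y_def using x assms(2) by (intro ge_one_powr_ge_zero) auto
    have z0: "z > 0" unfolding z_def using x by simp
    have zx: "z \<le> x" unfolding z_def using powr_mono[of \<beta> 1 x] x assms(6) by simp
    define N where "N = nat \<lfloor>x\<rfloor>"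
    \<comment> \<open>With this rounding M < v is equivalent to z \<le> v for natural numbers v,
      whether or not z is an integer.\<close>
    define M where "M = nat \<lceil>z\<rceil> - 1"
    have N: "real N \<le> x" "N \<ge> 1" "x < real N + 1" using x unfolding N_def by linarith+
    have le_N: "u \<le> N \<longleftrightarrow> real u \<le> x" for u using x unfolding N_def by (simp add: le_nat_floor le_nat_iff le_floor_iff)
    have M: "real M < z" "z \<le> real M + 1" using z0 unfolding M_def by linarith+
    have less_M: "M < v \<longleftrightarrow> z \<le> real v" for v using z0 unfolding M_def by linarith
    have MN: "M \<le> N" using le_N[of M] M(1) zx by simp
    have NR: "N < (M + 1) ^ (R + 1)"
    proof -
      have "real N \<le> x powr 1" using N x by simp
      also have "\<dots> < x powr (\<beta> * real (R + 1))" using x R\<beta> assms(5) by (intro powr_less_mono) (auto simp: algebra_simps)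
      also have "\<dots> = z ^ (R + 1)"
        using powr_realpow[OF z0, of "R + 1"] by (simp only: z_def powr_powr)
      also have "\<dots> \<le> (real M + 1) ^ (R + 1)" using M z0 by (intro power_mono) auto
      also have "\<dots> = real ((M + 1) ^ (R + 1))" by (simp only: of_nat_power of_nat_add of_nat_1)
      finally have "real N < real ((M + 1) ^ (R + 1))" .
      then show ?thesis by (simp only: of_nat_less_iff)
    qed
    define U where "U = {u::nat. 2 \<le> u \<and> real u \<le> x \<and> ereal z \<le> P_minus u}"
    define V where "V = {v::nat. prime v \<and> real v \<le> y}"
    have finU: "finite U" by (rule finite_subset[of _ "{..N}"]) (auto simp: U_def le_N)
    have finV: "finite V" unfolding V_def by (rule card_primes_le) (use y1 in simp)
    show ?case
    proof (intro allI impI)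
      fix k :: nat and a :: int
      assume "k > 2 \<and> c1 * x powr \<theta>2 \<le> real k \<and> real k \<le> c2 * x powr \<theta>2 \<and> coprime a (int k)"
      then have k: "k > 2" and kx: "real k \<le> c2 * x powr \<theta>2" and a: "coprime a (int k)" by auto
      have k1: "k > 1" "k > 0" using k by simp_all
      define l where "l = log 2 (real k)"
      have l: "1 + l \<le> x powr d" "l \<ge> 0" using elim k kx by (auto simp: l_def)
      define L where "L = ln (real k)"
      have L1: "L \<ge> 1" unfolding L_def by (rule ln_nat_ge_1[OF k])
      have "L \<le> l" using ln_2_less_1 L1 by (simp add: l_def L_def log_def pos_le_divide_eq mult_left_le)
      then have L: "L \<le> x powr d" using l by simp
      \<comment> \<open>C3 + 1 instead of C3 accounts for u = 1, which belongs to the rough sum but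
        not to \<open>U\<close>; the factors 2 absorb the + 1 in N + 1 and Y + 1.\<close>
      define X where "X = (C3 + 1) * L ^ R * (2 * x) powr p * (C2 * L * (2 * y) powr q)"
      have X0: "X \<ge> 0" unfolding X_def using C2 C3 L1 by simp
      have XS: "norm ((\<Sum>u\<in>U. \<psi> u) * (\<Sum>v\<in>V. \<psi> v)) \<le> X" if \<psi>: "dirichlet_character k \<psi>" "\<psi> \<noteq> principal_char k" for \<psi>
      proof -
        have "{u. 1 \<le> u \<and> u \<le> N \<and> (\<forall>p. prime p \<longrightarrow> p dvd u \<longrightarrow> M < p)} = insert 1 U"
        proof (rule Set.set_eqI)
          fix u :: nat
          consider "u = 0" | "u = 1" | "u \<ge> 2" by linarith
          then show "u \<in> {u. 1 \<le> u \<and> u \<le> N \<and> (\<forall>p. prime p \<longrightarrow> p dvd u \<longrightarrow> M < p)} \<longleftrightarrow> u \<in> insert 1 U"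
          proof cases
            case 3
            then show ?thesis using le_P_minus_iff[of u z] by (simp add: U_def le_N less_M)
          qed (use N in \<open>auto simp: U_def\<close>)
        qed
        then have "(\<Sum>u | 1 \<le> u \<and> u \<le> N \<and> (\<forall>p. prime p \<longrightarrow> p dvd u \<longrightarrow> M < p). \<psi> u) = \<psi> 1 + (\<Sum>u\<in>U. \<psi> u)"
          using finU by (simp add: U_def)
        then have "(\<Sum>u\<in>U. \<psi> u) = (\<Sum>u | 1 \<le> u \<and> u \<le> N \<and> (\<forall>p. prime p \<longrightarrow> p dvd u \<longrightarrow> M < p). \<psi> u) - \<psi> 1" by simp
        then have "norm (\<Sum>u\<in>U. \<psi> u) \<le> norm (\<Sum>u | 1 \<le> u \<and> u \<le> N \<and> (\<forall>p. prime p \<longrightarrow> p dvd u \<longrightarrow> M < p). \<psi> u) + norm (\<psi> 1)"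
          by (simp only: norm_triangle_ineq4)
        also have "\<dots> \<le> C3 * L ^ R * (real N + 1) powr p + 1"
          unfolding L_def by (intro add_mono S_bound[OF k \<psi> MN N(2) NR] norm_dchar_le_1[OF \<psi>(1)])
        also have "\<dots> \<le> C3 * L ^ R * (2 * x) powr p + L ^ R * (2 * x) powr p"
        proof (rule add_mono)
          show "C3 * L ^ R * (real N + 1) powr p \<le> C3 * L ^ R * (2 * x) powr p"
            using N x pq C3 L1 by (intro mult_left_mono powr_mono2) auto
          have "1 * 1 \<le> L ^ R * (2 * x) powr p"
            using L1 x pq by (intro mult_mono one_le_power ge_one_powr_ge_zero) auto
          then show "1 \<le> L ^ R * (2 * x) powr p" by simp
        qed
        also have "\<dots> = (C3 + 1) * L ^ R * (2 * x) powr p" by (simp add: algebra_simps)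
        finally have S: "norm (\<Sum>u\<in>U. \<psi> u) \<le> (C3 + 1) * L ^ R * (2 * x) powr p" .
        define Y where "Y = nat \<lfloor>y\<rfloor>"
        have Y: "real Y \<le> y" using y1 unfolding Y_def by linarith
        have le_Y: "v \<le> Y \<longleftrightarrow> real v \<le> y" for v using y1 unfolding Y_def by (simp add: le_nat_floor le_nat_iff le_floor_iff)
        have "(\<Sum>v\<in>V. \<psi> v) = (\<Sum>v\<in>{1..Y}. if prime v then \<psi> v else 0)"
          by (rule sum.mono_neutral_cong_left) (auto simp: V_def le_Y prime_gt_0_nat Suc_le_eq)
        also have "\<dots> = (\<Sum>n<Y. if prime (Suc n) then \<psi> (Suc n) else 0)" by (simp add: sum.atLeast1_atMost_eq)
        finally have "norm (\<Sum>v\<in>V. \<psi> v) \<le> C2 * L * (real Y + 1) powr q"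
          unfolding L_def using T_bound[OF k \<psi>] by simp
        also have "\<dots> \<le> C2 * L * (2 * y) powr q"
          using Y y1 C2 L1 pq by (intro mult_left_mono powr_mono2) auto
        finally have T: "norm (\<Sum>v\<in>V. \<psi> v) \<le> C2 * L * (2 * y) powr q" .
        show ?thesis unfolding norm_mult X_def using S T C3 L1 by (intro mult_mono) auto
      qed
      define S0 where "S0 = real (card {u\<in>U. coprime u k})"
      define T0 where "T0 = real (card (primes_coprime_upto k y))"
      define \<phi> where "\<phi> = real (totient k)"
      have \<phi>: "\<phi> > 0" using k1 by (simp add: \<phi>_def)
      have T0: "0 \<le> T0" "T0 \<le> y" unfolding T0_def using card_primes_le(2)[of y k] y1 by auto
      have eqV: "{v\<in>V. coprime v k} = primes_coprime_upto k y" by (auto simp: V_def primes_coprime_upto_def)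
      have eqN: "{(u, v). u \<in> U \<and> v \<in> V \<and> [int u * int v = a] (mod int k)} =
          {(u, v). 2 \<le> u \<and> real u \<le> x \<and> prime v \<and> real v \<le> y \<and> [int u * int v = a] (mod int k) \<and> ereal z \<le> P_minus u}"
        by (auto simp: U_def V_def)
      have 1: "\<bar>real (N_count k a x y z) - T0 / \<phi> * S0\<bar> \<le> X"
        using card_product_congruence[OF k1(1) a finU finV XS X0]
        unfolding eqV eqN N_count_def T0_def S0_def \<phi>_def .
      \<comment> \<open>The 1 is the integer n = 1, which \<open>rough_count\<close> includes
        because P_minus 1 is infinite and which u \<ge> 2 excludes.\<close>
      have rc: "real (rough_count x z) = 1 + S0 + real (card {u\<in>U. \<not> coprime u k})"
      proof -
        have "{n. 1 \<le> n \<and> real n \<le> x \<and> ereal z \<le> P_minus n} = insert 1 U"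
        proof (rule Set.set_eqI)
          fix n :: nat
          consider "n = 0" | "n = 1" | "n \<ge> 2" by linarith
          then show "n \<in> {n. 1 \<le> n \<and> real n \<le> x \<and> ereal z \<le> P_minus n} \<longleftrightarrow> n \<in> insert 1 U"
            by cases (use x in \<open>auto simp: U_def P_minus_def\<close>)
        qed
        then have "rough_count x z = Suc (card U)" using finU by (simp add: rough_count_def U_def)
        also have "card U = card ({u\<in>U. coprime u k} \<union> {u\<in>U. \<not> coprime u k})" by (rule arg_cong[where f=card]) auto
        also have "\<dots> = card {u\<in>U. coprime u k} + card {u\<in>U. \<not> coprime u k}"
          by (rule card_Un_disjoint) (use finU in auto)
        finally show ?thesis by (simp add: S0_def)
      qed
      have nc: "real (card {u\<in>U. \<not> coprime u k}) \<le> l * (x / z)"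
        unfolding l_def by (rule card_noncoprime_rough_le[OF k1(2) z0]) (use x le_P_minus_iff in \<open>auto simp: U_def\<close>)
      have xz: "x / z = x powr (1 - \<beta>)" unfolding z_def using x by (simp add: powr_diff)
      have xz1: "x / z \<ge> 1" using zx z0 by simp
      \<comment> \<open>The cost of counting all rough integers instead of those prime to k. One
        factor 1 + l comes from k / \<open>totient k\<close>, the other from the number of primes
        dividing k.\<close>
      have "T0 / \<phi> * real (rough_count x z) - T0 / \<phi> * S0 = T0 / \<phi> * (1 + real (card {u\<in>U. \<not> coprime u k}))"
        unfolding rc by (simp add: algebra_simps)
      also have "\<dots> \<le> y * ((1 + l) / real k) * ((1 + l) * (x / z))"
      proof (rule mult_mono)
        have "real k \<le> \<phi> * (1 + l)" unfolding \<phi>_def l_def by (rule totient_lower_bound[OF k1(2)])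
        then have "1 / \<phi> \<le> (1 + l) / real k" using \<phi> k1 by (simp add: field_simps)
        then have "T0 * (1 / \<phi>) \<le> y * ((1 + l) / real k)" using T0 \<phi> by (intro mult_mono) auto
        then show "T0 / \<phi> \<le> y * ((1 + l) / real k)" by simp
        show "1 + real (card {u\<in>U. \<not> coprime u k}) \<le> (1 + l) * (x / z)" using nc xz1 unfolding distrib_right mult_1 by linarith
      qed (use y1 l in auto)
      also have "\<dots> = y / real k * ((1 + l)\<^sup>2 * x powr (1 - \<beta>))" unfolding xz by (simp add: power2_eq_square)
      also have "\<dots> \<le> y / real k * x powr (1 - \<epsilon>)"
      proof (rule mult_left_mono)
        have "(1 + l)\<^sup>2 * x powr (1 - \<beta>) \<le> (x powr d)\<^sup>2 * x powr (1 - \<beta>)" using l by (intro mult_right_mono power_mono) auto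
        also have "\<dots> = x powr (2 * d + (1 - \<beta>))" by (simp add: power2_eq_square powr_add[symmetric])
        also have "\<dots> \<le> x powr (1 - \<epsilon>)" using d \<epsilon> x unfolding \<epsilon>0_def by (intro powr_mono) auto
        finally show "(1 + l)\<^sup>2 * x powr (1 - \<beta>) \<le> x powr (1 - \<epsilon>)" .
      qed (use y1 in auto)
      finally have 2: "T0 / \<phi> * real (rough_count x z) - T0 / \<phi> * S0 \<le> y / real k * x powr (1 - \<epsilon>)" .
      have 3: "T0 / \<phi> * real (rough_count x z) - T0 / \<phi> * S0 \<ge> 0"
        unfolding rc right_diff_distrib[symmetric] using T0 \<phi> by (intro mult_nonneg_nonneg) auto
      have 4: "X \<le> K * c2 * (x powr (1 - \<epsilon>) * y / real k)"
      proof -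
        have "X = K * (L ^ (R + 1) * (x powr p * y powr q))"
          unfolding X_def K_def using x y1 by (simp add: powr_mult mult_ac)
        also have "\<dots> \<le> K * ((x powr d) ^ (R + 1) * (x powr p * y powr q))"
          using K0 L L1 by (intro mult_left_mono mult_right_mono power_mono) auto
        also have "(x powr d) ^ (R + 1) * (x powr p * y powr q) = x powr (d * (real R + 1) + (p + \<theta>1 * q))"
          unfolding y_def using x by (simp add: powr_realpow[symmetric] powr_powr powr_add algebra_simps)
        also have "x powr (d * (real R + 1) + (p + \<theta>1 * q)) \<le> x powr (1 - \<epsilon> + \<theta>1 - \<theta>2)"
        proof (rule powr_mono)
          have "p + \<theta>1 * q = 1/2 + \<theta>1 / 2 + e * W" by (simp add: p_def q_def W_def algebra_simps)
          moreover have "\<epsilon> < \<kappa> / 2" using \<epsilon>(2) by (simp add: \<epsilon>0_def)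
          moreover have "1 + \<theta>1 - \<theta>2 = 1/2 + \<theta>1 / 2 + \<kappa>" by (simp add: \<kappa>_def)
          ultimately show "d * (real R + 1) + (p + \<theta>1 * q) \<le> 1 - \<epsilon> + \<theta>1 - \<theta>2"
            using d(3) e(3) \<kappa> by linarith
        qed (use x in simp)
        also have "x powr (1 - \<epsilon> + \<theta>1 - \<theta>2) = x powr (1 - \<epsilon>) * y / x powr \<theta>2"
          by (simp add: y_def powr_diff powr_add)
        also have "\<dots> \<le> c2 * (x powr (1 - \<epsilon>) * y / real k)"
        proof -
          \<comment> \<open>The upper bound on k converts the power of x into 1 / k, and so c2
            enters the final constant.\<close>
          have "1 / x powr \<theta>2 \<le> c2 / real k" using kx x k1 by (simp add: field_simps)
          from mult_left_mono[OF this, of "x powr (1 - \<epsilon>) * y"] show ?thesis using y1 by (simp add: mult_ac)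
        qed
        finally show ?thesis using K0 by (simp add: mult_left_mono mult.assoc)
      qed
      have "\<bar>real (N_count k a x y z) - T0 / \<phi> * real (rough_count x z)\<bar> \<le> X + y / real k * x powr (1 - \<epsilon>)"
      proof -
        have "\<bar>n - r\<bar> \<le> A + B" if "\<bar>n - s\<bar> \<le> A" "r - s \<le> B" "r - s \<ge> 0" for n r s A B :: real
          using that by linarith
        then show ?thesis using 1 2 3 by blast
      qed
      also have "\<dots> \<le> K * c2 * (x powr (1 - \<epsilon>) * y / real k) + y / real k * x powr (1 - \<epsilon>)" using 4 by simp
      also have "\<dots> = (K * c2 + 1) * (x powr (1 - \<epsilon> + 0) * y / real k)" by (simp add: algebra_simps add_divide_distrib)
      finally show "\<bar>real (N_count k a x (x powr \<theta>1) (x powr \<beta>))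
             - real (card (primes_coprime_upto k (x powr \<theta>1))) / real (totient k)
                 * real (rough_count x (x powr \<beta>))\<bar>
          \<le> (K * c2 + 1) * (x powr (1 - \<epsilon> + 0) * x powr \<theta>1 / real k)"
        by (simp only: y_def z_def T0_def \<phi>_def)
    qed
  qed
  show ?thesis
  proof (rule exI[of _ \<epsilon>0], intro conjI \<epsilon>0 allI impI)
    fix \<epsilon> c1 c2 :: real assume "0 < \<epsilon> \<and> \<epsilon> < \<epsilon>0" "c1 > 0" "c2 > 0"
    then show "\<exists>(C :: real) (\<eta> :: real \<Rightarrow> real). (\<eta> \<longlongrightarrow> 0) at_top \<and>
       (\<forall>\<^sub>F x in at_top. \<forall>(k :: nat) (a :: int).
          k > 2 \<and> c1 * x powr \<theta>2 \<le> real k \<and> real k \<le> c2 * x powr \<theta>2 \<and> coprime a (int k) \<longrightarrow>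
          \<bar>real (N_count k a x (x powr \<theta>1) (x powr \<beta>))
             - real (card (primes_coprime_upto k (x powr \<theta>1))) / real (totient k)
                 * real (rough_count x (x powr \<beta>))\<bar>
          \<le> C * (x powr (1 - \<epsilon> + \<eta> x) * x powr \<theta>1 / real k))"
      \<comment> \<open>All logarithms have been absorbed by the margins, so the o(1) in the
        exponent can be taken to be 0.\<close>
      using main[of \<epsilon> c1 c2] by (intro exI[of _ "K * c2 + 1"] exI[of _ "\<lambda>_. 0"] conjI tendsto_const) auto
  qed
qed

end
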